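(* Let $m,n\ge 1$ be integers, let $1<p_i<\infty$ for $i=1,\dots,m$, and let $p$ be defined by $\frac1p=\sum_{i=1}^m\frac1{p_i}$. Suppose that $p<q<\infty$ and $0<\alpha<mn$. Let $u,w_1,\dots,w_m$ be a.e. positive measurable functions on $\mathbb{R}^n$ such that $w_i^{-p_i'}$ satisfies the reverse doubling condition on $\mathbb{R}^n$ for each $i=1,\dots,m$, and suppose in addition that $u^q\in A_\infty(\mathbb{R}^n)$. Then there is a constant $C>0$ such that the inequality $$\| u\,\mathcal{I}_{\alpha}(\overrightarrow{f})\|_{L^q(\mathbb{R}^n)} \leq C \prod_{i=1}^{m} \|w_i f_i \|_{L^{p_i}(\mathbb{R}^n)}$$ holds for all $\overrightarrow{f}=(f_1,\dots,f_m) \in L^{p_1}_{w_1^{p_1}}(\mathbb{R}^n) \times \cdots \times L^{p_m}_{w_m^{p_m}}(\mathbb{R}^n)$ if and only if $$\sup_{Q\in \mathcal{Q}} |Q|^{\alpha/n+1/q-1/p} \bigg( \frac{1}{|Q|} \int_{Q} u^{q}(x)\, dx \bigg)^{1/q} \prod_{i=1}^m \bigg( \frac{1}{|Q|} \int_{Q} w_i^{-p'_i}(y_i)\, dy_i \bigg)^{1/p'_i}< \infty.$$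
   Context: $p_i'=p_i/(p_i-1)$. $\mathcal{Q}$ is the family of all cubes in $\mathbb{R}^n$ with sides parallel to the coordinate axes, and $|Q|$ is the volume of $Q$. A weight is an a.e. positive, locally integrable function. For a.e. positive $\rho$ and $0<r<\infty$, $L^r_\rho(\mathbb{R}^n)$ is the class of measurable $f$ with $\|f\|_{L^r_\rho}=\big(\int_{\mathbb{R}^n}|f|^r\rho\,dx\big)^{1/r}<\infty$. The multilinear fractional integral operator is $$\mathcal{I}_{\alpha}(\overrightarrow{f}) (x) = \int_{(\mathbb{R}^n)^m}\frac{f_1(y_1)\cdots f_m(y_m)}{(|x-y_1|+ \cdots + |x-y_m|)^{mn-\alpha}}\, dy_1\cdots dy_m,\qquad x\in\mathbb{R}^n .$$ A weight $\rho$ on $\mathbb{R}^n$ satisfies the reverse doubling condition ($\rho\in RD(\mathbb{R}^n)$) if there is a constant $d>1$ such that $d\,\rho(Q')\le\rho(Q)$ for all cubes $Q\in\mathcal{Q}$ and all $Q'$ that are one of the $2^n$ equal subcubes arising by dividing $Q$ into $2^n$ equal parts, where $\rho(E)=\int_E\rho\,dx$. $A_\infty(\mathbb{R}^n)=\bigcup_{r\ge1}A_r(\mathbb{R}^n)$, where $A_r(\mathbb{R}^n)$ is the Muckenhoupt class of weights $\rho$ with $\sup_{Q\in\mathcal{Q}}\big(\frac1{|Q|}\int_Q\rho\big)^{1/r}\big(\frac1{|Q|}\int_Q\rho^{1-r'}\big)^{1/r'}<\infty$ (for $r=1$ the second factor is understood as $(\inf_Q\rho)^{-1}$, the essential infimum).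 *)

theory Defs
  imports "HOL-Analysis.Analysis"
begin

definition conjugate_exponent :: "real \<Rightarrow> real" where
  "conjugate_exponent r = r / (r - 1)"

text \<open>
  Powers of extended nonnegative numbers. Only exponents \<open>s > 0\<close> are used, for which
  \<open>\<infinity>\<close> to the power \<open>s\<close> is \<open>\<infinity>\<close>.
\<close>
definition ennpowr :: "ennreal \<Rightarrow> real \<Rightarrow> ennreal" where
  "ennpowr x s = (if x = \<infinity> then \<infinity> else ennreal (enn2real x powr s))"


text \<open>
  \<open>\<real>\<^sup>n\<close> is \<open>real^'n\<close>. Measurability and integrals are with respect to the (complete)
  Lebesgue measure. All norms and averages take values in \<open>[0,\<infinity>]\<close>, so that divergent
  integrals count as \<open>\<infinity>\<close>.
\<close>

definition Lr_norm :: "real \<Rightarrow> (real^'n \<Rightarrow> real) \<Rightarrow> (real^'n \<Rightarrow> real) \<Rightarrow> ennreal" where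
  "Lr_norm r \<rho> f = ennpowr (\<integral>\<^sup>+x. ennreal (\<bar>f x\<bar> powr r * \<rho> x) \<partial>lebesgue) (1 / r)"

definition Lr_space :: "real \<Rightarrow> (real^'n \<Rightarrow> real) \<Rightarrow> (real^'n \<Rightarrow> real) set" where
  "Lr_space r \<rho> = {f. f \<in> borel_measurable lebesgue \<and> Lr_norm r \<rho> f < \<infinity>}"

abbreviation Lr_norm_unweighted :: "real \<Rightarrow> (real^'n \<Rightarrow> real) \<Rightarrow> ennreal" where
  "Lr_norm_unweighted r f \<equiv> Lr_norm r (\<lambda>_. 1) f"


definition cube :: "real^'n \<Rightarrow> real \<Rightarrow> (real^'n) set" where
  "cube a l = cbox a (a + vec l)"

definition cubes :: "(real^'n) set set" where
  "cubes = {cube a l | a l. 0 < l}"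

text \<open>
  The \<open>2^n\<close> equal parts of \<open>cube a l\<close>: the set \<open>S\<close> consists of the coordinates in which
  the upper half is taken.
\<close>
definition dyadic_subcubes :: "real^'n \<Rightarrow> real \<Rightarrow> (real^'n) set set" where
  "dyadic_subcubes a l =
     {cube (a + (\<chi> i. if i \<in> S then l / 2 else 0)) (l / 2) | S. S \<subseteq> UNIV}"


definition weight :: "(real^'n \<Rightarrow> real) \<Rightarrow> bool" where
  "weight \<rho> \<longleftrightarrow> \<rho> \<in> borel_measurable lebesgue \<and> (AE x in lebesgue. 0 < \<rho> x) \<and>
     (\<forall>K. compact K \<longrightarrow> \<rho> absolutely_integrable_on K)"

definition weight_mass :: "(real^'n \<Rightarrow> real) \<Rightarrow> (real^'n) set \<Rightarrow> ennreal" where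
  "weight_mass \<rho> E = (\<integral>\<^sup>+x\<in>E. ennreal (\<rho> x) \<partial>lebesgue)"

definition reverse_doubling :: "(real^'n \<Rightarrow> real) \<Rightarrow> bool" where
  "reverse_doubling \<rho> \<longleftrightarrow> weight \<rho> \<and>
     (\<exists>d::real. 1 < d \<and>
       (\<forall>a l. 0 < l \<longrightarrow> (\<forall>Q'\<in>dyadic_subcubes a l.
          ennreal d * weight_mass \<rho> Q' \<le> weight_mass \<rho> (cube a l))))"

definition average :: "(real^'n) set \<Rightarrow> (real^'n \<Rightarrow> real) \<Rightarrow> ennreal" where
  "average Q g = (\<integral>\<^sup>+x\<in>Q. ennreal (g x) \<partial>lebesgue) / emeasure lebesgue Q"

definition ess_inf_on :: "(real^'n) set \<Rightarrow> (real^'n \<Rightarrow> real) \<Rightarrow> ennreal" where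
  "ess_inf_on Q g = Sup {c. AE x in lebesgue. x \<in> Q \<longrightarrow> c \<le> ennreal (g x)}"

definition A_class :: "real \<Rightarrow> (real^'n \<Rightarrow> real) set" where
  "A_class r = {\<rho>. weight \<rho> \<and>
     (SUP Q\<in>cubes. ennpowr (average Q \<rho>) (1 / r) *
        (if r = 1 then inverse (ess_inf_on Q \<rho>)
         else ennpowr (average Q (\<lambda>x. \<rho> x powr (1 - conjugate_exponent r)))
                (1 / conjugate_exponent r))) < \<infinity>}"

definition A_infinity :: "(real^'n \<Rightarrow> real) set" where
  "A_infinity = (\<Union>r\<in>{1..}. A_class r)"


text \<open>
  A tuple \<open>(y\<^sub>1, \<dots>, y\<^sub>m)\<close> is a point \<open>y\<close> of \<open>(real^'n)^'m\<close>, and \<open>lebesgue\<close> on that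
  type is \<open>dy\<^sub>1 \<dots> dy\<^sub>m\<close>. The Bochner integral is \<open>0\<close> by convention
  when the integrand is not integrable, so statements about \<open>frac_int \<alpha> f x\<close> have to be
  accompanied by \<open>frac_int_exists \<alpha> f x\<close>.
\<close>

definition frac_integrand ::
  "real \<Rightarrow> ('m::finite \<Rightarrow> real^'n \<Rightarrow> real) \<Rightarrow> real^'n \<Rightarrow> (real^'n)^'m \<Rightarrow> real" where
  "frac_integrand \<alpha> f x y = (\<Prod>i\<in>UNIV. f i (y $ i)) /
     (\<Sum>i\<in>UNIV. norm (x - y $ i)) powr (real CARD('m) * real CARD('n) - \<alpha>)"

definition frac_int_exists ::
  "real \<Rightarrow> ('m::finite \<Rightarrow> real^'n \<Rightarrow> real) \<Rightarrow> real^'n \<Rightarrow> bool" where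
  "frac_int_exists \<alpha> f x \<longleftrightarrow> integrable lebesgue (frac_integrand \<alpha> f x)"

definition frac_int ::
  "real \<Rightarrow> ('m::finite \<Rightarrow> real^'n \<Rightarrow> real) \<Rightarrow> real^'n \<Rightarrow> real" where
  "frac_int \<alpha> f x = (\<integral>y. frac_integrand \<alpha> f x y \<partial>lebesgue)"

end

theory Submission
  imports Defs
begin

text \<open>
  Put \<open>v = u\<^sup>q\<close>, \<open>\<sigma>\<^sub>i = w\<^sub>i powr (- p\<^sub>i')\<close> and \<open>f\<^sub>i = g\<^sub>i \<sigma>\<^sub>i\<close>, so that the norms on the right are
  \<open>L\<^sup>p\<close> norms of \<open>g\<^sub>i\<close> with respect to \<open>\<sigma>\<^sub>i\<close>. Necessity follows by testing with
  \<open>f\<^sub>i = \<sigma>\<^sub>i 1\<^sub>Q\<close>. For sufficiency, the kernel is dominated by a sum over scales \<open>4\<^sup>-\<^sup>k\<close>, which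
  bounds the operator by a sum of terms \<open>a\<^sub>k\<close>, each a product of masses of \<open>f\<^sub>i\<close> near the cell of
  \<open>x\<close>. Subdividing a cell, the \<open>1/m\<close>-th powers of the \<open>a\<^sub>k\<close> decay geometrically in Lebesgue mean because
  \<open>\<alpha> > 0\<close>; hence on half of each cell \<open>a\<^sub>k\<close> dominates the sum of all finer terms. As
  \<open>v\<close> is in \<open>A\<^sub>\<infinity>\<close>, that half carries a fixed proportion of the \<open>v\<close>-mass, and
  the \<open>L\<^sup>q(v)\<close> norm of the sum is controlled by that of the sequence \<open>a\<^sub>k\<close> in \<open>\<ell>\<^sup>q\<close>. By the
  testing condition the latter is at most a product of normalised averages of the \<open>g\<^sub>i\<close>, which a
  Carleson embedding (the place where \<open>p < q\<close> and reverse doubling enter) sums over all scales.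
\<close>

subsection \<open>Cells of side \<open>4\<^sup>-\<^sup>k\<close>\<close>

text \<open>The measures \<open>\<sigma>\<^sub>i\<close> are not assumed to be doubling, so the mass
  near a cell cannot be charged to the cell itself: whole neighbourhoods are needed, which overlap
  and form no tree. Sums over the cells of one scale are therefore written as integrals over a base
  point \<open>z\<close> with density \<open>freq k ^ n\<close>. In the Carleson step the
  substitution \<open>z = y + u / freq k\<close> sorts the boxes containing \<open>y\<close> into
  nested chains, one for each \<open>u\<close>, and reverse doubling acts along a chain. The ratio 4
  of consecutive scales leaves room for this: with ratio 2 the doubled cube would have the full side
  of the larger box and would fit only for extreme \<open>u\<close>. For m > 1 a product of masses
  is not additive under subdivision, but its 1/m-th power is at most a sum of normalised masses,
  each of which yields to Fubini. The product is decoupled once more through the exponents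
  \<open>q * P i / p\<close>: the weights \<open>p / P i\<close> sum to 1, and \<open>p < q\<close>
  puts these exponents above \<open>P i\<close>. Scales range over finite intervals until the end,
  so that an absorbed term is finite; the constants do not depend on the interval.\<close>

definition freq :: "int \<Rightarrow> real" where
  "freq k = 4 powr real_of_int k"

lemma freq_pos [simp]: "0 < freq k"
  by (simp add: freq_def)

lemma freq_nonneg [simp]: "0 \<le> freq k"
  by (simp add: freq_def)

lemma freq_nonzero [simp]: "freq k \<noteq> 0"
  by (simp add: freq_def)

lemma freq_add: "freq (j + k) = freq j * freq k"
  by (simp add: freq_def powr_add)

lemma freq_powr: "freq k powr t = 4 powr (real_of_int k * t)"
  by (simp add: freq_def powr_powr)

text \<open>The ratio of two scales is an integer, so rounding commutes with coarsening; this is why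
  cells of different scales are nested.\<close>

lemma floor_freq:
  assumes "k \<le> j"
  shows "\<lfloor>freq k * t\<rfloor> = \<lfloor>freq j * t\<rfloor> div 4 ^ nat (j - k)"
proof -
  have "freq j = freq (j - k) * freq k"
    by (simp flip: freq_add)
  moreover have "freq (j - k) = real_of_int (4 ^ nat (j - k))"
    using assms powr_realpow[of 4 "nat (j - k)"] by (simp add: freq_def)
  ultimately have "freq k * t = freq j * t / real_of_int (4 ^ nat (j - k))"
    by simp
  then show ?thesis
    by (simp only: floor_divide_real_eq_div zero_le_power zero_le_numeral)
qed

text \<open>A shift by at most 1 is a shift by at most the divisor, hence by at most 1 after
  division. Adjacency of cells thus survives passage to coarser scales.\<close>

lemma abs_diff_div_le_1:
  fixes a b c :: int
  assumes "\<bar>a - b\<bar> \<le> 1" "0 < c"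
  shows "\<bar>a div c - b div c\<bar> \<le> 1"
proof -
  have "x div c \<le> y div c + 1" if "x \<le> y + 1" for x y
  proof -
    have "x div c \<le> (y + c) div c"
      using that assms(2) by (intro zdiv_mono1) auto
    then show ?thesis using assms(2) by simp
  qed
  from this[of a b] this[of b a] show ?thesis
    using assms(1) by linarith
qed

definition same_cell :: "int \<Rightarrow> real^'n \<Rightarrow> real^'n \<Rightarrow> bool" where
  "same_cell k x y \<longleftrightarrow> (\<forall>i. \<lfloor>freq k * x $ i\<rfloor> = \<lfloor>freq k * y $ i\<rfloor>)"

definition near_cell :: "int \<Rightarrow> real^'n \<Rightarrow> real^'n \<Rightarrow> bool" where
  "near_cell k x y \<longleftrightarrow> (\<forall>i. \<bar>\<lfloor>freq k * x $ i\<rfloor> - \<lfloor>freq k * y $ i\<rfloor>\<bar> \<le> 1)"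

definition cell :: "int \<Rightarrow> real^'n \<Rightarrow> (real^'n) set" where
  "cell k x = {y. same_cell k x y}"

text \<open>The block of \<open>3^n\<close> grid cells around the cell of \<open>x\<close>. Unlike a
  ball centred at \<open>x\<close> it depends only on the cell, so the terms built from it are
  constant on cells.\<close>

definition nbhd :: "int \<Rightarrow> real^'n \<Rightarrow> (real^'n) set" where
  "nbhd k x = {y. near_cell k x y}"

lemma same_cell_refl [simp]: "same_cell k x x"
  by (simp add: same_cell_def)

lemma same_cell_sym: "same_cell k x y \<longleftrightarrow> same_cell k y x"
  by (auto simp: same_cell_def)

lemma near_cell_sym: "near_cell k x y \<longleftrightarrow> near_cell k y x"
  by (auto simp: near_cell_def abs_minus_commute)

lemma same_cell_mono: "k \<le> j \<Longrightarrow> same_cell j x y \<Longrightarrow> same_cell k x y"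
  by (simp add: same_cell_def floor_freq)

lemma near_cell_mono: "k \<le> j \<Longrightarrow> near_cell j x y \<Longrightarrow> near_cell k x y"
  by (simp add: near_cell_def floor_freq abs_diff_div_le_1)

lemma nbhd_cong: "same_cell k x y \<Longrightarrow> nbhd k x = nbhd k y"
  by (auto simp: nbhd_def near_cell_def same_cell_def)

lemma nbhd_antimono: "k \<le> j \<Longrightarrow> nbhd j x \<subseteq> nbhd k x"
  by (auto simp: nbhd_def near_cell_mono)

lemma borel_measurable_vec_nth [measurable]:
  "(\<lambda>x::'a::topological_space^'n. x $ i) \<in> borel_measurable borel"
  by (intro borel_measurable_continuous_onI continuous_intros)

lemma same_cell_real:
  "same_cell k x y \<longleftrightarrow> (\<forall>i. \<bar>real_of_int \<lfloor>freq k * x $ i\<rfloor> - real_of_int \<lfloor>freq k * y $ i\<rfloor>\<bar> \<le> 0)"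
  by (simp add: same_cell_def)

lemma near_cell_real:
  "near_cell k x y \<longleftrightarrow>
    (\<forall>i. \<bar>real_of_int \<lfloor>freq k * x $ i\<rfloor> - real_of_int \<lfloor>freq k * y $ i\<rfloor>\<bar> \<le> 1)"
  by (simp add: near_cell_def flip: of_int_diff of_int_abs)

lemma pred_same_cell [measurable]:
  "Measurable.pred (borel \<Otimes>\<^sub>M borel) (\<lambda>p. same_cell k (fst p :: real^'n) (snd p))"
  unfolding same_cell_real by measurable

lemma pred_near_cell [measurable]:
  "Measurable.pred (borel \<Otimes>\<^sub>M borel) (\<lambda>p. near_cell k (fst p :: real^'n) (snd p))"
  unfolding near_cell_real by measurable

lemma sets_cell [measurable]: "cell k x \<in> sets borel"
  unfolding cell_def same_cell_real by measurable

lemma sets_nbhd [measurable]: "nbhd k x \<in> sets borel"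
  unfolding nbhd_def near_cell_real by measurable

lemma near_cellI:
  assumes "\<And>i. \<bar>x $ i - y $ i\<bar> \<le> 1 / freq k"
  shows "near_cell k x y"
  unfolding near_cell_def
proof
  fix i
  have "\<bar>freq k * x $ i - freq k * y $ i\<bar> = freq k * \<bar>x $ i - y $ i\<bar>"
    by (simp add: abs_mult flip: right_diff_distrib)
  also have "\<dots> \<le> 1"
    using assms[of i] by (simp add: field_simps)
  finally show "\<bar>\<lfloor>freq k * x $ i\<rfloor> - \<lfloor>freq k * y $ i\<rfloor>\<bar> \<le> 1"
    by linarith
qed

lemma near_cellD:
  assumes "near_cell k x y"
  shows "\<bar>x $ i - y $ i\<bar> \<le> 2 / freq k"
proof -
  have "\<bar>\<lfloor>freq k * x $ i\<rfloor> - \<lfloor>freq k * y $ i\<rfloor>\<bar> \<le> 1"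
    using assms by (simp add: near_cell_def)
  then have "\<bar>freq k * x $ i - freq k * y $ i\<bar> \<le> 2"
    by linarith
  moreover have "\<bar>freq k * x $ i - freq k * y $ i\<bar> = freq k * \<bar>x $ i - y $ i\<bar>"
    by (simp add: abs_mult flip: right_diff_distrib)
  ultimately show ?thesis
    by (simp add: field_simps)
qed

lemma prod_inner_Basis_vec:
  "(\<Prod>b\<in>Basis. (x::real^'n) \<bullet> b) = (\<Prod>i\<in>UNIV. x $ i)"
proof -
  have "inj (\<lambda>i::'n. axis i (1::real))"
    by (auto simp: inj_on_def axis_eq_axis)
  then have "(\<Prod>b\<in>range (\<lambda>i::'n. axis i (1::real)). x \<bullet> b) = (\<Prod>i\<in>UNIV. x $ i)"
    by (subst prod.reindex) (auto simp: inner_axis)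
  moreover have "(Basis :: (real^'n) set) = range (\<lambda>i. axis i 1)"
    by (auto simp: Basis_vec_def)
  ultimately show ?thesis by simp
qed

lemma emeasure_lborel_box_vec:
  fixes a b :: "real^'n"
  assumes "\<And>i. a $ i \<le> b $ i"
  shows "emeasure lborel (cbox a b) = ennreal (\<Prod>i\<in>UNIV. b $ i - a $ i)"
    and "emeasure lborel (box a b) = ennreal (\<Prod>i\<in>UNIV. b $ i - a $ i)"
proof -
  have "(\<Prod>c\<in>Basis. (b - a) \<bullet> c) = (\<Prod>i\<in>UNIV. b $ i - a $ i)"
    using prod_inner_Basis_vec[of "b - a"] by simp
  moreover have "a \<bullet> c \<le> b \<bullet> c" if "c \<in> Basis" for c
    using that assms by (auto simp: Basis_vec_def inner_axis)
  ultimately show "emeasure lborel (cbox a b) = ennreal (\<Prod>i\<in>UNIV. b $ i - a $ i)"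
    "emeasure lborel (box a b) = ennreal (\<Prod>i\<in>UNIV. b $ i - a $ i)"
    by (simp_all add: emeasure_lborel_cbox emeasure_lborel_box)
qed

lemma mem_cube: "x \<in> cube a l \<longleftrightarrow> (\<forall>i. a $ i \<le> x $ i \<and> x $ i \<le> a $ i + l)"
  by (simp add: cube_def mem_box_cart)

lemma sets_cube [measurable]: "cube a l \<in> sets borel"
  by (simp add: cube_def)

lemma emeasure_lborel_cube:
  "0 \<le> l \<Longrightarrow> emeasure lborel (cube (a::real^'n) l) = ennreal (l ^ CARD('n))"
  unfolding cube_def by (subst emeasure_lborel_box_vec(1)) auto

definition cell_corner :: "int \<Rightarrow> real^'n \<Rightarrow> real^'n" where
  "cell_corner k x = (\<chi> i. \<lfloor>freq k * x $ i\<rfloor> / freq k)"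

lemma mem_cell_iff:
  "y \<in> cell k x \<longleftrightarrow>
    (\<forall>i. cell_corner k x $ i \<le> y $ i \<and> y $ i < cell_corner k x $ i + 1 / freq k)"
proof -
  have "\<lfloor>freq k * x $ i\<rfloor> = \<lfloor>freq k * y $ i\<rfloor> \<longleftrightarrow>
      cell_corner k x $ i \<le> y $ i \<and> y $ i < cell_corner k x $ i + 1 / freq k" for i
    using floor_eq_iff[of "freq k * y $ i" "\<lfloor>freq k * x $ i\<rfloor>"]
    by (auto simp: cell_corner_def field_simps)
  then show ?thesis by (simp add: cell_def same_cell_def)
qed

lemma cell_subset_cube: "cell k x \<subseteq> cube (cell_corner k x) (1 / freq k)"
  by (auto simp: mem_cell_iff mem_cube less_imp_le)

lemma emeasure_lborel_cell:
  "emeasure lborel (cell k (x::real^'n)) = ennreal ((1 / freq k) ^ CARD('n))"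
proof (rule antisym)
  show "emeasure lborel (cell k x) \<le> ennreal ((1 / freq k) ^ CARD('n))"
    using emeasure_mono[OF cell_subset_cube[of k x], of lborel]
    by (simp add: emeasure_lborel_cube)
  let ?a = "cell_corner k x"
  have "ennreal ((1 / freq k) ^ CARD('n)) = emeasure lborel (box ?a (?a + vec (1 / freq k)))"
    by (subst emeasure_lborel_box_vec(2)) auto
  also have "\<dots> \<le> emeasure lborel (cell k x)"
    by (intro emeasure_mono) (auto simp: mem_cell_iff mem_box_cart less_imp_le)
  finally show "ennreal ((1 / freq k) ^ CARD('n)) \<le> emeasure lborel (cell k x)" .
qed

lemma nbhd_subset_cube: "nbhd k x \<subseteq> cube (x - vec (2 / freq k)) (4 / freq k)"
  unfolding nbhd_def subset_iff mem_cube
proof (intro allI impI)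
  fix y i assume "y \<in> {y. near_cell k x y}"
  then have "\<bar>x $ i - y $ i\<bar> \<le> 2 / freq k"
    using near_cellD by blast
  then show "(x - vec (2 / freq k)) $ i \<le> y $ i \<and>
      y $ i \<le> (x - vec (2 / freq k)) $ i + 4 / freq k"
    by (simp add: abs_le_iff)
qed

lemma emeasure_lborel_nbhd_le:
  "emeasure lborel (nbhd k (x::real^'n)) \<le> ennreal ((4 / freq k) ^ CARD('n))"
  using emeasure_mono[OF nbhd_subset_cube[of k x], of lborel]
  by (simp add: emeasure_lborel_cube)

section \<open>Locally finite Borel measures and integration cell by cell\<close>

abbreviation rdensity :: "'a measure \<Rightarrow> ('a \<Rightarrow> real) \<Rightarrow> 'a measure" where
  "rdensity M f \<equiv> density M (\<lambda>x. ennreal (f x))"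

text \<open>Finiteness on boxes yields sigma-finiteness, which every use of Fubini below relies
  on.\<close>

definition radon :: "(real^'n) measure \<Rightarrow> bool" where
  "radon M \<longleftrightarrow> sets M = sets borel \<and> (\<forall>a b. emeasure M (cbox a b) < \<infinity>)"

lemma radon_sets:
  "radon M \<Longrightarrow> sets M = sets borel"
  by (simp add: radon_def)

lemma radon_space [simp]: "radon M \<Longrightarrow> space M = UNIV"
  by (metis radon_sets sets_eq_imp_space_eq space_borel)

lemma radon_lborel: "radon lborel"
  by (auto simp: radon_def emeasure_lborel_cbox_eq)

lemma sigma_finite_radon:
  assumes "radon M"
  shows "sigma_finite_measure M"
proof
  let ?A = "range (\<lambda>n::nat. cbox (- vec (real n)) (vec (real n) :: real^'n))"
  have "x \<in> \<Union>?A" for x :: "real^'n"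
  proof -
    obtain n :: nat where n: "norm x \<le> real n"
      using real_arch_simple by blast
    have "\<bar>x $ i\<bar> \<le> real n" for i
      using component_le_norm_cart[of x i] n by linarith
    then show ?thesis by (auto simp: mem_box_cart abs_le_iff minus_le_iff)
  qed
  then have "\<Union>?A = UNIV" by blast
  then show "\<exists>A. countable A \<and> A \<subseteq> sets M \<and> \<Union>A = space M \<and> (\<forall>a\<in>A. emeasure M a \<noteq> \<infinity>)"
    using assms by (intro exI[of _ ?A]) (auto simp: radon_def less_top)
qed

lemma emeasure_cube_finite: "radon M \<Longrightarrow> emeasure M (cube a l) < \<infinity>"
  by (simp add: radon_def cube_def)

lemma emeasure_nbhd_finite:
  assumes "radon M"
  shows "emeasure M (nbhd k x) < \<infinity>"
proof -
  have "emeasure M (nbhd k x) \<le> emeasure M (cube (x - vec (2 / freq k)) (4 / freq k))"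
    using radon_sets[OF assms] by (intro emeasure_mono nbhd_subset_cube) auto
  also have "\<dots> < \<infinity>"
    by (rule emeasure_cube_finite[OF assms])
  finally show ?thesis .
qed

lemma pair_sigma_finite_radon:
  "radon M \<Longrightarrow> radon M' \<Longrightarrow> pair_sigma_finite M M'"
  by (intro pair_sigma_finite.intro sigma_finite_radon)

lemma borel_measurable_emeasure_section:
  fixes M :: "(real^'n) measure"
  assumes "radon M"
    and "Measurable.pred (borel \<Otimes>\<^sub>M borel) (\<lambda>p. P (fst p :: real^'n) (snd p))"
  shows "(\<lambda>x. emeasure M {y. P x y}) \<in> borel_measurable borel"
proof -
  note [measurable_cong] = radon_sets[OF assms(1)]
  interpret sigma_finite_measure M
    by (rule sigma_finite_radon[OF assms(1)])
  have "{p \<in> space (borel \<Otimes>\<^sub>M borel). P (fst p) (snd p)} \<in> sets (borel \<Otimes>\<^sub>M borel)"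
    using assms(2) by measurable
  then have "{p. P (fst p) (snd p)} \<in> sets (borel \<Otimes>\<^sub>M M)"
    using sets_pair_measure_cong[OF refl radon_sets[OF assms(1)], of borel]
    by (simp add: space_pair_measure)
  from measurable_emeasure_Pair[OF this] show ?thesis
    by (simp add: vimage_def)
qed

text \<open>The points \<open>z\<close> whose cell contains \<open>x\<close> form the cell of
  \<open>x\<close>, of volume \<open>(1 / freq k) ^ n\<close>. Inserting \<open>freq k ^ n\<close>
  times this volume and exchanging the integrals replaces a sum over the grid by an integral, with
  no enumeration of cells.\<close>

lemma nn_integral_cells:
  fixes V :: "(real^'n) measure"
  assumes V: "radon V"
    and h [measurable]: "h \<in> borel_measurable borel"
    and h_const: "\<And>x y. same_cell k x y \<Longrightarrow> h x = h y"
    and G [measurable]: "G \<in> sets borel"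
  shows "(\<integral>\<^sup>+x. h x * indicator G x \<partial>V) =
    (\<integral>\<^sup>+z. ennreal (freq k ^ CARD('n)) * h z * emeasure V (cell k z \<inter> G) \<partial>lborel)"
proof -
  note [measurable_cong] = radon_sets[OF V]
  interpret pair_sigma_finite "lborel :: (real^'n) measure" V
    by (intro pair_sigma_finite_radon V radon_lborel)
  let ?c = "ennreal (freq k ^ CARD('n))"
  let ?f = "\<lambda>z x. ?c * h z * (indicator {p. same_cell k (fst p) (snd p)} (z, x) * indicator G x)"
  have c: "?c * ennreal ((1 / freq k) ^ CARD('n)) = 1"
    by (simp add: power_one_over flip: ennreal_mult)
  have "(\<integral>\<^sup>+x. h x * indicator G x \<partial>V) = (\<integral>\<^sup>+x. (\<integral>\<^sup>+z. ?f z x \<partial>lborel) \<partial>V)"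
  proof (intro nn_integral_cong)
    fix x
    have "(\<integral>\<^sup>+z. ?f z x \<partial>lborel) = (\<integral>\<^sup>+z. ?c * h x * indicator G x * indicator (cell k x) z \<partial>lborel)"
    proof (intro nn_integral_cong)
      fix z
      show "?f z x = ?c * h x * indicator G x * indicator (cell k x) z"
        using h_const[of z x] same_cell_sym[of k x z]
        by (cases "same_cell k z x") (auto simp: cell_def mult_ac)
    qed
    also have "\<dots> = ?c * h x * indicator G x * ennreal ((1 / freq k) ^ CARD('n))"
      by (subst nn_integral_cmult_indicator) (auto simp: emeasure_lborel_cell)
    also have "\<dots> = (?c * ennreal ((1 / freq k) ^ CARD('n))) * (h x * indicator G x)"
      by (simp only: mult_ac)
    also have "\<dots> = h x * indicator G x"
      by (simp only: c mult_1)
    finally show "h x * indicator G x = (\<integral>\<^sup>+z. ?f z x \<partial>lborel)" by simp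
  qed
  also have "\<dots> = (\<integral>\<^sup>+z. (\<integral>\<^sup>+x. ?f z x \<partial>V) \<partial>lborel)"
    by (rule Fubini') measurable
  also have "\<dots> = (\<integral>\<^sup>+z. ?c * h z * emeasure V (cell k z \<inter> G) \<partial>lborel)"
  proof (intro nn_integral_cong)
    fix z
    have "(\<integral>\<^sup>+x. ?f z x \<partial>V) = (\<integral>\<^sup>+x. ?c * h z * indicator (cell k z \<inter> G) x \<partial>V)"
      by (intro nn_integral_cong) (auto simp: indicator_def cell_def)
    also have "\<dots> = ?c * h z * emeasure V (cell k z \<inter> G)"
      by (subst nn_integral_cmult_indicator) auto
    finally show "(\<integral>\<^sup>+x. ?f z x \<partial>V) = ?c * h z * emeasure V (cell k z \<inter> G)" .
  qed
  finally show ?thesis .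
qed

text \<open>A comparison of masses on each single cell integrates, because \<open>h\<close> is
  constant there. This is the device that moves a weight from a cell to its good part.\<close>

lemma nn_integral_cells_le:
  fixes V :: "(real^'n) measure"
  assumes V: "radon V"
    and h [measurable]: "h \<in> borel_measurable borel"
    and h_const: "\<And>x y. same_cell k x y \<Longrightarrow> h x = h y"
    and G [measurable]: "G \<in> sets borel"
    and le: "\<And>z. emeasure V (cell k z) \<le> C * emeasure V (cell k z \<inter> G)"
  shows "(\<integral>\<^sup>+x. h x \<partial>V) \<le> C * (\<integral>\<^sup>+x. h x * indicator G x \<partial>V)"
proof -
  note [measurable_cong] = radon_sets[OF V]
  interpret pair_sigma_finite "lborel :: (real^'n) measure" V
    by (intro pair_sigma_finite_radon V radon_lborel)
  have "(\<lambda>z. emeasure V {x. same_cell k z x \<and> x \<in> G}) \<in> borel_measurable borel"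
    by (rule borel_measurable_emeasure_section[OF V]) measurable
  then have [measurable]: "(\<lambda>z. emeasure V (cell k z \<inter> G)) \<in> borel_measurable borel"
    by (simp add: cell_def Collect_conj_eq)
  let ?c = "ennreal (freq k ^ CARD('n))"
  have "(\<integral>\<^sup>+x. h x \<partial>V) = (\<integral>\<^sup>+z. ?c * h z * emeasure V (cell k z) \<partial>lborel)"
    using nn_integral_cells[OF V h h_const, where G = UNIV] by simp
  also have "\<dots> \<le> (\<integral>\<^sup>+z. C * (?c * h z * emeasure V (cell k z \<inter> G)) \<partial>lborel)"
    by (intro nn_integral_mono) (metis le mult.left_commute mult_left_mono zero_le)
  also have "\<dots> = C * (\<integral>\<^sup>+z. ?c * h z * emeasure V (cell k z \<inter> G) \<partial>lborel)"
    by (subst nn_integral_cmult) auto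
  also have "\<dots> = C * (\<integral>\<^sup>+x. h x * indicator G x \<partial>V)"
    using nn_integral_cells[OF V h h_const G] by simp
  finally show ?thesis .
qed

subsection \<open>Averages over neighbourhoods of cells\<close>

lemma powr_add_le:
  fixes a b t :: real
  assumes "0 \<le> a" "0 \<le> b" "0 < t" "t \<le> 1"
  shows "(a + b) powr t \<le> a powr t + b powr t"
proof (cases "a + b = 0")
  case False
  then have pos: "0 < a + b" using assms by linarith
  have frac: "c / (a + b) \<le> (c / (a + b)) powr t" if "0 \<le> c" "c \<le> a + b" for c
    using powr_mono'[of t 1 "c / (a + b)"] that assms pos by simp
  have "1 = a / (a + b) + b / (a + b)"
    using pos by (simp flip: add_divide_distrib)
  also have "\<dots> \<le> (a powr t + b powr t) / (a + b) powr t"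
    using frac[of a] frac[of b] assms pos by (simp add: powr_divide add_divide_distrib)
  finally show ?thesis
    using pos by (simp add: le_divide_eq)
qed (use assms in auto)

lemma powr_sum_le_sum_powr:
  fixes f :: "'a \<Rightarrow> real"
  assumes "finite A" "\<And>x. x \<in> A \<Longrightarrow> 0 \<le> f x" "0 < t" "t \<le> 1"
  shows "(\<Sum>x\<in>A. f x) powr t \<le> (\<Sum>x\<in>A. f x powr t)"
  using assms(1,2)
proof (induction A rule: finite_induct)
  case (insert x F)
  then have "(f x + sum f F) powr t \<le> f x powr t + sum f F powr t"
    using assms by (intro powr_add_le) (auto intro: sum_nonneg)
  with insert show ?case by fastforce
qed simp

text \<open>A crude weighted mean inequality: since the exponents sum to 1, the product is at most
  the largest \<open>x i\<close>.\<close>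

lemma prod_powr_le_sum:
  fixes x \<theta> :: "'a \<Rightarrow> real"
  assumes "finite A" "A \<noteq> {}" "\<And>i. i \<in> A \<Longrightarrow> 0 \<le> x i" "\<And>i. i \<in> A \<Longrightarrow> 0 < \<theta> i"
    and "(\<Sum>i\<in>A. \<theta> i) = 1"
  shows "(\<Prod>i\<in>A. x i powr \<theta> i) \<le> (\<Sum>i\<in>A. x i)"
proof -
  define M where "M = Max (x ` A)"
  have M: "x i \<le> M" if "i \<in> A" for i
    using that assms by (simp add: M_def)
  have "M \<in> x ` A"
    unfolding M_def using assms by (intro Max_in) auto
  then obtain j where j: "j \<in> A" "M = x j" by blast
  have le: "(\<Prod>i\<in>A. x i powr \<theta> i) \<le> (\<Prod>i\<in>A. M powr \<theta> i)"
    using assms M by (intro prod_mono) (auto intro!: powr_mono2 simp: less_imp_le)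
  have "(\<Prod>i\<in>A. M powr \<theta> i) \<le> M"
  proof (cases "M = 0")
    case True
    then show ?thesis
      using j(1) assms(1) by (auto simp: power_0_left card_eq_0_iff)
  next
    case False
    then show ?thesis
      using assms(3)[OF j(1)] by (simp add: j assms(5) flip: powr_sum)
  qed
  also have "M \<le> (\<Sum>i\<in>A. x i)"
    unfolding j(2) using j(1) assms by (intro member_le_sum) auto
  finally show ?thesis using le by linarith
qed

text \<open>Young's inequality for \<open>u * v powr (q - 1)\<close> takes the place of the mean
  value theorem.\<close>

lemma powr_diff_le:
  fixes u v q :: real
  assumes "0 \<le> u" "u \<le> v" "1 \<le> q"
  shows "v powr q - u powr q \<le> q * (v - u) * v powr (q - 1)"
proof (cases "q = 1 \<or> v = 0")
  case False
  then have q: "1 < q" and v: "0 < v" using assms by auto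
  have "u * v powr (q - 1) \<le> u powr q / q + (v powr (q - 1)) powr (q / (q - 1)) / (q / (q - 1))"
    using q v assms by (intro Youngs_inequality) (auto simp: field_simps)
  also have "(v powr (q - 1)) powr (q / (q - 1)) = v powr q"
    using q by (simp add: powr_powr)
  finally have *: "q * (u * v powr (q - 1)) \<le> u powr q + (q * v powr q - v powr q)"
    using q by (simp add: field_simps)
  have v_powr: "v * v powr (q - 1) = v powr q"
    using v by (simp add: powr_mult_base)
  have "q * (v - u) * v powr (q - 1) = q * (v * v powr (q - 1)) - q * (u * v powr (q - 1))"
    by (simp only: left_diff_distrib right_diff_distrib mult.assoc)
  then have "q * (v - u) * v powr (q - 1) = q * v powr q - q * (u * v powr (q - 1))"
    by (simp only: v_powr)
  then show ?thesis using * by linarith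
qed (use assms in auto)

text \<open>The \<open>q\<close>-th powers of the partial sums telescope. Partial sums up to
  \<open>k\<close>, rather than tails, are chosen because they involve only scales at least as
  coarse as \<open>k\<close> and so will be constant on the cells of scale \<open>k\<close>.\<close>

lemma powr_sum_le_partial_sums:
  fixes x :: "int \<Rightarrow> real"
  assumes "\<And>k. 0 \<le> x k" "1 \<le> q"
  shows "(\<Sum>k=a..b. x k) powr q \<le> q * (\<Sum>k=a..b. x k * (\<Sum>j=a..k. x j) powr (q - 1))"
proof -
  have "(\<Sum>k=a..a - 1 + int n. x k) powr q \<le>
      q * (\<Sum>k=a..a - 1 + int n. x k * (\<Sum>j=a..k. x j) powr (q - 1))" for n
  proof (induction n)
    case (Suc n)
    let ?b = "a - 1 + int n"
    have set: "{a..a - 1 + int (Suc n)} = insert (?b + 1) {a..?b}"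
      by auto
    have "(\<Sum>j=a..?b + 1. x j) = x (?b + 1) + (\<Sum>j=a..?b. x j)"
      using set by (simp add: add.commute)
    moreover from this have "(\<Sum>j=a..?b + 1. x j) powr q - (\<Sum>j=a..?b. x j) powr q \<le>
        q * ((\<Sum>j=a..?b + 1. x j) - (\<Sum>j=a..?b. x j)) * (\<Sum>j=a..?b + 1. x j) powr (q - 1)"
      using assms by (intro powr_diff_le) (auto intro: sum_nonneg)
    ultimately have "(\<Sum>j=a..?b + 1. x j) powr q \<le>
        (\<Sum>j=a..?b. x j) powr q + q * (x (?b + 1) * (\<Sum>j=a..?b + 1. x j) powr (q - 1))"
      by simp
    moreover have "a - 1 + int (Suc n) = ?b + 1" by simp
    moreover have "(\<Sum>k=a..?b + 1. x k * (\<Sum>j=a..k. x j) powr (q - 1)) =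
        x (?b + 1) * (\<Sum>j=a..?b + 1. x j) powr (q - 1) +
        (\<Sum>k=a..?b. x k * (\<Sum>j=a..k. x j) powr (q - 1))"
      using set by (simp add: add.commute)
    ultimately show ?case
      using Suc by (simp add: distrib_left)
  qed simp
  from this[of "nat (b - a + 1)"] show ?thesis
    by (cases "a \<le> b") auto
qed

text \<open>The coarsest of the terms that dominate their own tail dominates all the others.\<close>

lemma sum_dominating_terms_le:
  fixes x :: "int \<Rightarrow> real" and a b :: int
  assumes nonneg: "\<And>k. 0 \<le> x k" and "1 \<le> q" "0 < \<delta>" "0 \<le> \<Lambda>"
  defines "S \<equiv> {k \<in> {a..b}. (\<Sum>j=k..b. x j) \<le> \<Lambda> * x k}"
  shows "(\<Sum>k=a..b. x k) powr (q - 1) * (\<Sum>k\<in>S. x k) \<le>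
    \<delta> * (\<Sum>k=a..b. x k) powr q + \<delta> powr (1 - q) * \<Lambda> powr q * (\<Sum>k=a..b. x k powr q)"
proof (cases "S = {}")
  case True
  then show ?thesis
    using assms(3) by (simp only: True) (simp add: sum_nonneg)
next
  case False
  let ?N = "\<Sum>k=a..b. x k"
  have N: "0 \<le> ?N" using nonneg by (simp add: sum_nonneg)
  have finS: "finite S"
    by (rule finite_subset[of _ "{a..b}"]) (auto simp: S_def)
  define k where "k = Min S"
  have k: "k \<in> S" using False finS by (simp add: k_def)
  have "S \<subseteq> {k..b}" using finS by (auto simp: k_def S_def)
  then have "(\<Sum>k\<in>S. x k) \<le> (\<Sum>j=k..b. x j)"
    using nonneg by (intro sum_mono2) auto
  also have "\<dots> \<le> \<Lambda> * x k" using k by (simp add: S_def)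
  finally have S_le: "(\<Sum>k\<in>S. x k) \<le> \<Lambda> * x k" .
  have "?N powr (q - 1) * (\<Lambda> * x k) \<le> \<delta> * ?N powr q + \<delta> powr (1 - q) * (\<Lambda> * x k) powr q"
  \<comment> \<open>A two-case form of Young's inequality: either the dominating term is at most
    \<open>\<delta>\<close> times the total, or the total is at most \<open>1 / \<delta>\<close>
    times that term.\<close>
  proof (cases "\<Lambda> * x k \<le> \<delta> * ?N")
    case True
    have "?N powr (q - 1) * (\<Lambda> * x k) \<le> ?N powr (q - 1) * (\<delta> * ?N)"
      using True by (intro mult_left_mono) auto
    also have "\<dots> = \<delta> * ?N powr q"
      using N by (cases "?N = 0") (simp_all add: powr_mult_base mult.commute mult.left_commute)
    finally show ?thesis
      by (smt (verit) mult_nonneg_nonneg powr_ge_zero)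
  next
    case False
    let ?y = "\<Lambda> * x k"
    have y: "0 < ?y" using False N assms(3) by (smt (verit) mult_nonneg_nonneg)
    have "?N powr (q - 1) * ?y \<le> (?y / \<delta>) powr (q - 1) * ?y"
      using False N y assms(2,3) by (intro mult_right_mono powr_mono2) (auto simp: field_simps)
    also have "\<dots> = \<delta> powr (1 - q) * ?y powr q"
    proof -
      have "?y powr (q - 1) * ?y = ?y powr q"
        using y by (simp add: powr_mult_base mult.commute)
      moreover have "\<delta> powr (1 - q) = 1 / \<delta> powr (q - 1)"
        using powr_minus_divide[of \<delta> "q - 1"] by simp
      ultimately show ?thesis by (simp add: powr_divide)
    qed
    finally show ?thesis
      using assms(3) by (smt (verit) mult_nonneg_nonneg powr_ge_zero)
  qed
  moreover have "(\<Lambda> * x k) powr q \<le> \<Lambda> powr q * (\<Sum>k=a..b. x k powr q)"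
  proof -
    have "x k powr q \<le> (\<Sum>k=a..b. x k powr q)"
      using k by (intro member_le_sum) (auto simp: S_def)
    then show ?thesis by (simp add: powr_mult mult_left_mono)
  qed
  then have "\<delta> powr (1 - q) * (\<Lambda> * x k) powr q \<le>
      \<delta> powr (1 - q) * (\<Lambda> powr q * (\<Sum>k=a..b. x k powr q))"
    by (intro mult_left_mono) auto
  moreover have "?N powr (q - 1) * (\<Sum>k\<in>S. x k) \<le> ?N powr (q - 1) * (\<Lambda> * x k)"
    using S_le by (intro mult_left_mono) auto
  ultimately show ?thesis unfolding mult.assoc by linarith
qed

lemma sum_geometric_int_le:
  fixes \<rho> :: real
  assumes "finite J" "\<And>j. j \<in> J \<Longrightarrow> k \<le> j" "0 \<le> \<rho>" "\<rho> < 1"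
  shows "(\<Sum>j\<in>J. \<rho> ^ nat (j - k)) \<le> 1 / (1 - \<rho>)"
proof -
  have "inj_on (\<lambda>j. nat (j - k)) J"
    using assms(2) by (intro inj_onI) (metis diff_eq_eq diff_ge_0_iff_ge diff_add_cancel nat_eq_iff2 eq_nat_nat_iff)
  then have "(\<Sum>j\<in>J. \<rho> ^ nat (j - k)) = (\<Sum>i\<in>(\<lambda>j. nat (j - k)) ` J. \<rho> ^ i)"
    by (simp add: sum.reindex)
  also have "\<dots> \<le> (\<Sum>i. \<rho> ^ i)"
    using assms by (intro sum_le_suminf summable_geometric) auto
  also have "\<dots> = 1 / (1 - \<rho>)"
    using assms by (simp add: suminf_geometric)
  finally show ?thesis .
qed


section \<open>Terms of the dominating sum and their decay inside a cell\<close>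

text \<open>The contribution of one scale to the operator: for tuples at distance about
  \<open>1 / freq k\<close> from \<open>x\<close> the kernel has size about
  \<open>freq k powr (m n - \<alpha>)\<close>, and all entries of such a tuple lie in
  \<open>nbhd k x\<close>.\<close>

definition avg_term ::
  "real \<Rightarrow> ('m::finite \<Rightarrow> (real^'n) measure) \<Rightarrow> int \<Rightarrow> real^'n \<Rightarrow> real" where
  "avg_term \<alpha> \<Phi> k x =
    freq k powr (real CARD('m) * real CARD('n) - \<alpha>) * (\<Prod>i\<in>UNIV. measure (\<Phi> i) (nbhd k x))"

lemma avg_term_nonneg [simp]: "0 \<le> avg_term \<alpha> \<Phi> k x"
  by (simp add: avg_term_def prod_nonneg)

lemma avg_term_cong: "same_cell k x y \<Longrightarrow> avg_term \<alpha> \<Phi> k x = avg_term \<alpha> \<Phi> k y"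
  by (simp add: avg_term_def nbhd_cong)

lemma borel_measurable_emeasure_nbhd [measurable]:
  "radon M \<Longrightarrow> (\<lambda>x. emeasure M (nbhd k x)) \<in> borel_measurable borel"
  unfolding nbhd_def by (rule borel_measurable_emeasure_section) measurable

lemma borel_measurable_avg_term:
  assumes "\<And>i. radon (\<Phi> i)"
  shows "avg_term \<alpha> \<Phi> k \<in> borel_measurable borel"
  unfolding avg_term_def[abs_def] measure_def using assms by measurable

text \<open>By Fubini, a point \<open>y\<close> is counted only for \<open>x\<close> in
  \<open>nbhd j y\<close>, whose volume is at most \<open>(4 / freq j) ^ n\<close>, and only if
  \<open>y\<close> lies in the coarser neighbourhood \<open>nbhd k z\<close>.\<close>

lemma nn_integral_cell_nbhd_le:
  fixes M :: "(real^'n) measure"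
  assumes M: "radon M" and "k \<le> j"
  shows "(\<integral>\<^sup>+x\<in>cell k z. emeasure M (nbhd j x) \<partial>lborel) \<le>
    ennreal ((4 / freq j) ^ CARD('n)) * emeasure M (nbhd k z)"
proof -
  note [measurable_cong] = radon_sets[OF M]
  interpret pair_sigma_finite "lborel :: (real^'n) measure" M
    by (intro pair_sigma_finite_radon M radon_lborel)
  let ?f = "\<lambda>x y. indicator {p. near_cell j (fst p) (snd p)} (x, y) * indicator (cell k z) x :: ennreal"
  have "(\<integral>\<^sup>+x\<in>cell k z. emeasure M (nbhd j x) \<partial>lborel) = (\<integral>\<^sup>+x. (\<integral>\<^sup>+y. ?f x y \<partial>M) \<partial>lborel)"
  proof (intro nn_integral_cong)
    fix x
    have "(\<integral>\<^sup>+y. ?f x y \<partial>M) = (\<integral>\<^sup>+y. indicator (cell k z) x * indicator (nbhd j x) y \<partial>M)"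
      by (intro nn_integral_cong) (auto simp: nbhd_def indicator_def)
    also have "\<dots> = indicator (cell k z) x * emeasure M (nbhd j x)"
      by (intro nn_integral_cmult_indicator) measurable
    finally show "emeasure M (nbhd j x) * indicator (cell k z) x = (\<integral>\<^sup>+y. ?f x y \<partial>M)"
      by (simp add: mult.commute)
  qed
  also have "\<dots> = (\<integral>\<^sup>+y. (\<integral>\<^sup>+x. ?f x y \<partial>lborel) \<partial>M)"
    by (rule Fubini'[symmetric]) measurable
  also have "\<dots> \<le> (\<integral>\<^sup>+y. ennreal ((4 / freq j) ^ CARD('n)) * indicator (nbhd k z) y \<partial>M)"
  proof (intro nn_integral_mono)
    fix y
    have "?f x y \<le> indicator (nbhd k z) y * indicator (nbhd j y) x" for x
    proof (cases "near_cell j x y \<and> x \<in> cell k z")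
      case True
      then have "near_cell k x y" "nbhd k x = nbhd k z"
        using near_cell_mono[OF assms(2)] nbhd_cong[of k z x] by (auto simp: cell_def)
      then have "y \<in> nbhd k z" by (auto simp: nbhd_def)
      moreover have "x \<in> nbhd j y" using True near_cell_sym[of j x y] by (simp add: nbhd_def)
      ultimately show ?thesis using True by simp
    qed (auto simp: indicator_def)
    then have "(\<integral>\<^sup>+x. ?f x y \<partial>lborel) \<le>
        (\<integral>\<^sup>+x. indicator (nbhd k z) y * indicator (nbhd j y) x \<partial>lborel)"
      by (intro nn_integral_mono)
    also have "\<dots> = indicator (nbhd k z) y * emeasure lborel (nbhd j y)"
      by (intro nn_integral_cmult_indicator) simp
    also have "\<dots> \<le> indicator (nbhd k z) y * ennreal ((4 / freq j) ^ CARD('n))"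
      by (intro mult_left_mono emeasure_lborel_nbhd_le) simp
    finally show "(\<integral>\<^sup>+x. ?f x y \<partial>lborel) \<le> ennreal ((4 / freq j) ^ CARD('n)) * indicator (nbhd k z) y"
      by (simp add: mult.commute)
  qed
  also have "\<dots> = ennreal ((4 / freq j) ^ CARD('n)) * emeasure M (nbhd k z)"
    by (intro nn_integral_cmult_indicator) simp
  finally show ?thesis .
qed

lemma emeasure_eq_measure_nbhd:
  "radon M \<Longrightarrow> emeasure M (nbhd k x) = ennreal (measure M (nbhd k x))"
  using emeasure_nbhd_finite[of M k x] by (simp add: emeasure_eq_ennreal_measure less_top)

lemma measure_nbhd_mono:
  assumes M: "radon M" and "k \<le> j"
  shows "measure M (nbhd j x) \<le> measure M (nbhd k x)"
  unfolding measure_def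
  using emeasure_nbhd_finite[OF M, of k x] radon_sets[OF M] nbhd_antimono[OF assms(2)]
  by (intro enn2real_mono emeasure_mono) auto

text \<open>Normalise each mass at scale \<open>j\<close> by the mass \<open>c i\<close> at scale
  \<open>k\<close>. The 1/m-th power of the product of these ratios is at most their sum, and each
  ratio integrates to a volume of order \<open>freq j powr (- n)\<close>. Against the factor
  \<open>freq j powr (n - \<alpha> / m)\<close> this leaves
  \<open>freq j powr (- \<alpha> / m)\<close>, which is the decay.\<close>

lemma nn_integral_cell_avg_term_le:
  fixes \<Phi> :: "'m::finite \<Rightarrow> (real^'n) measure"
  assumes \<Phi>: "\<And>i. radon (\<Phi> i)" and "k \<le> j"
  defines "\<mu> \<equiv> real CARD('m)"
  shows "(\<integral>\<^sup>+x\<in>cell k z. ennreal (avg_term \<alpha> \<Phi> j x powr (1 / \<mu>)) \<partial>lborel) \<le>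
    ennreal (\<mu> * 4 ^ CARD('n) * (4 powr (- \<alpha> / \<mu>)) ^ nat (j - k) *
      (avg_term \<alpha> \<Phi> k z powr (1 / \<mu>) * (1 / freq k) ^ CARD('n)))"
proof -
  have \<mu>: "0 < \<mu>" by (simp add: \<mu>_def)
  let ?r = "\<lambda>x. avg_term \<alpha> \<Phi> j x powr (1 / \<mu>)"
  let ?I = "\<lambda>i. \<integral>\<^sup>+x\<in>cell k z. emeasure (\<Phi> i) (nbhd j x) \<partial>lborel"
  let ?n = "CARD('n)"
  define c where "c i = measure (\<Phi> i) (nbhd k z)" for i
  have c_ge: "measure (\<Phi> i) (nbhd j x) \<le> c i" if "x \<in> cell k z" for i x
  proof -
    have "nbhd k z = nbhd k x"
      using that by (intro nbhd_cong) (simp add: cell_def)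
    then show ?thesis
      using measure_nbhd_mono[OF \<Phi> assms(2)] by (simp add: c_def)
  qed
  show ?thesis
  \<comment> \<open>No normalisation is possible if some coarse mass vanishes, but then the term at
    the finer scale is zero on the whole cell.\<close>
  proof (cases "\<exists>i. c i = 0")
    case True
    then obtain i where i: "c i = 0" by blast
    have "avg_term \<alpha> \<Phi> j x = 0" if "x \<in> cell k z" for x
    proof -
      have "measure (\<Phi> i) (nbhd j x) = 0"
        using c_ge[OF that, of i] i by (simp add: measure_le_0_iff)
      then show ?thesis by (auto simp: avg_term_def)
    qed
    then have "(\<integral>\<^sup>+x\<in>cell k z. ennreal (?r x) \<partial>lborel) = (\<integral>\<^sup>+x. 0 \<partial>(lborel :: (real^'n) measure))"
      by (intro nn_integral_cong) (auto simp: indicator_def)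
    then show ?thesis by simp
  next
    case False
    then have c_pos: "0 < c i" for i
      by (metis c_def measure_nonneg order_le_less)
    define e where "e = (\<mu> * real ?n - \<alpha>) / \<mu>"
    define A where "A = freq j powr e * (\<Prod>i\<in>UNIV. c i) powr (1 / \<mu>)"
    have A: "0 \<le> A" by (simp add: A_def)
    have pointwise: "?r x \<le> A * (\<Sum>i\<in>UNIV. measure (\<Phi> i) (nbhd j x) / c i)" for x
    proof -
      let ?t = "\<lambda>i. measure (\<Phi> i) (nbhd j x) / c i"
      have "(\<Prod>i\<in>UNIV. measure (\<Phi> i) (nbhd j x)) = (\<Prod>i\<in>UNIV. c i * ?t i)"
        by (intro prod.cong) (use c_pos in \<open>auto simp: less_imp_neq[symmetric]\<close>)
      also have "\<dots> = (\<Prod>i\<in>UNIV. c i) * (\<Prod>i\<in>UNIV. ?t i)"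
        by (simp only: prod.distrib)
      finally have "?r x = A * (\<Prod>i\<in>UNIV. ?t i) powr (1 / \<mu>)"
        by (simp only: avg_term_def powr_mult A_def e_def powr_powr \<mu>_def mult_1_right times_divide_eq_right mult.assoc)
      also have "(\<Prod>i\<in>UNIV. ?t i) powr (1 / \<mu>) = (\<Prod>i\<in>UNIV. ?t i powr (1 / \<mu>))"
        by (rule prod_powr_distrib)
      also have "\<dots> \<le> (\<Sum>i\<in>UNIV. ?t i)"
        using c_pos \<mu> by (intro prod_powr_le_sum) (auto simp: less_imp_le \<mu>_def)
      finally show ?thesis using A by (simp add: mult_left_mono)
    qed
    have "(\<integral>\<^sup>+x\<in>cell k z. ennreal (?r x) \<partial>lborel) \<le>
        (\<integral>\<^sup>+x. (\<Sum>i\<in>UNIV. ennreal (A / c i) * (emeasure (\<Phi> i) (nbhd j x) * indicator (cell k z) x)) \<partial>lborel)"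
    proof (intro nn_integral_mono)
      fix x
      have "ennreal (?r x) \<le>
          ennreal (\<Sum>i\<in>UNIV. A / c i * measure (\<Phi> i) (nbhd j x))"
        using pointwise[of x] by (intro ennreal_leI) (simp add: sum_distrib_left)
      also have "\<dots> = (\<Sum>i\<in>UNIV. ennreal (A / c i) * emeasure (\<Phi> i) (nbhd j x))"
        using A c_pos by (simp add: emeasure_eq_measure_nbhd[OF \<Phi>] less_imp_le flip: ennreal_mult sum_ennreal)
      finally show "ennreal (?r x) * indicator (cell k z) x \<le>
          (\<Sum>i\<in>UNIV. ennreal (A / c i) * (emeasure (\<Phi> i) (nbhd j x) * indicator (cell k z) x))"
        by (auto simp: indicator_def)
    qed
    also have "\<dots> = (\<Sum>i\<in>UNIV. ennreal (A / c i) * ?I i)"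
      using borel_measurable_emeasure_nbhd[OF \<Phi>]
      by (subst nn_integral_sum) (auto intro!: sum.cong nn_integral_cmult)
    also have "\<dots> \<le> (\<Sum>i\<in>(UNIV::'m set). ennreal (A * (4 / freq j) ^ ?n))"
    proof (intro sum_mono)
      fix i :: 'm
      have "ennreal (A / c i) * ?I i \<le>
          ennreal (A / c i) * (ennreal ((4 / freq j) ^ ?n) * ennreal (c i))"
        using nn_integral_cell_nbhd_le[OF \<Phi> assms(2), of i z]
        by (intro mult_left_mono) (simp_all add: emeasure_eq_measure_nbhd[OF \<Phi>] c_def)
      also have "\<dots> = ennreal (A / c i * ((4 / freq j) ^ ?n * c i))"
        using A c_pos by (simp add: less_imp_le flip: ennreal_mult)
      also have "A / c i * ((4 / freq j) ^ ?n * c i) = A * (4 / freq j) ^ ?n"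
        using c_pos[of i] by simp
      finally show "ennreal (A / c i) * ?I i \<le>
          ennreal (A * (4 / freq j) ^ ?n)" .
    qed
    also have "\<dots> = ennreal (\<mu> * (A * (4 / freq j) ^ ?n))"
      using A by (simp add: \<mu>_def ennreal_mult' flip: ennreal_of_nat_eq_real_of_nat)
    also have "\<mu> * (A * (4 / freq j) ^ ?n) = \<mu> * 4 ^ CARD('n) * (4 powr (- \<alpha> / \<mu>)) ^ nat (j - k) *
      (avg_term \<alpha> \<Phi> k z powr (1 / \<mu>) * (1 / freq k) ^ CARD('n))"
    proof -
      have fpow: "(1 / freq i) ^ ?n = 4 powr (- real_of_int i * real ?n)" for i
        by (simp add: freq_def powr_powr powr_minus powr_realpow[symmetric] power_one_over inverse_eq_divide powr_minus_divide)
      have "avg_term \<alpha> \<Phi> k z powr (1 / \<mu>) = freq k powr e * (\<Prod>i\<in>UNIV. c i) powr (1 / \<mu>)"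
        by (simp add: avg_term_def powr_mult e_def powr_powr \<mu>_def c_def)
      moreover have "freq j powr e * (1 / freq j) ^ ?n = (4 powr (- \<alpha> / \<mu>)) ^ nat (j - k) * (freq k powr e * (1 / freq k) ^ ?n)"
      proof -
        have e: "e = real ?n - \<alpha> / \<mu>"
          using \<mu> by (simp add: e_def diff_divide_distrib)
        have "(4 powr (- \<alpha> / \<mu>)) ^ nat (j - k) = 4 powr ((- \<alpha> / \<mu>) * (real_of_int j - real_of_int k))"
          using assms(2) by (simp add: powr_realpow[symmetric] powr_powr)
        then show ?thesis
          unfolding fpow freq_powr by (simp add: e algebra_simps flip: powr_add)
      qed
      moreover have "(4 / freq j) ^ ?n = 4 ^ ?n * (1 / freq j) ^ ?n"
        by (simp add: power_divide)
      ultimately show ?thesis by (simp add: A_def)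
    qed
    finally show ?thesis .
  qed
qed

text \<open>Since \<open>1 / \<mu> \<le> 1\<close>, the root of the sum is at most the sum of the
  roots, and these decay with ratio \<open>4 powr (- \<alpha> / \<mu>) < 1\<close>.\<close>

lemma nn_integral_cell_tail_le:
  fixes \<Phi> :: "'m::finite \<Rightarrow> (real^'n) measure"
  assumes \<Phi>: "\<And>i. radon (\<Phi> i)" and \<alpha>: "0 < \<alpha>"
    and J: "finite J" "\<And>j. j \<in> J \<Longrightarrow> k \<le> j"
  defines "\<mu> \<equiv> real CARD('m)"
  shows "(\<integral>\<^sup>+x\<in>cell k z. ennreal ((\<Sum>j\<in>J. avg_term \<alpha> \<Phi> j x) powr (1 / \<mu>)) \<partial>lborel) \<le>
    ennreal (\<mu> * 4 ^ CARD('n) / (1 - 4 powr (- \<alpha> / \<mu>)) *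
      (avg_term \<alpha> \<Phi> k z powr (1 / \<mu>) * (1 / freq k) ^ CARD('n)))"
proof -
  have \<mu>: "1 \<le> \<mu>" by (simp add: \<mu>_def Suc_leI)
  let ?t = "\<lambda>j x. avg_term \<alpha> \<Phi> j x powr (1 / \<mu>)"
  define \<rho> where "\<rho> = 4 powr (- \<alpha> / \<mu>)"
  have \<rho>: "0 \<le> \<rho>" "\<rho> < 1"
    using \<alpha> \<mu> powr_less_mono[of "- \<alpha> / \<mu>" 0 4] by (auto simp: \<rho>_def divide_neg_pos)
  define B where "B = avg_term \<alpha> \<Phi> k z powr (1 / \<mu>) * (1 / freq k) ^ CARD('n)"
  have B: "0 \<le> B" by (simp add: B_def)
  have meas [measurable]: "avg_term \<alpha> \<Phi> j \<in> borel_measurable borel" for j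
    by (rule borel_measurable_avg_term[OF \<Phi>])
  have "(\<integral>\<^sup>+x\<in>cell k z. ennreal ((\<Sum>j\<in>J. avg_term \<alpha> \<Phi> j x) powr (1 / \<mu>)) \<partial>lborel) \<le>
      (\<integral>\<^sup>+x. (\<Sum>j\<in>J. ennreal (?t j x) * indicator (cell k z) x) \<partial>lborel)"
  proof (intro nn_integral_mono)
    fix x
    have "ennreal ((\<Sum>j\<in>J. avg_term \<alpha> \<Phi> j x) powr (1 / \<mu>)) \<le>
        ennreal (\<Sum>j\<in>J. ?t j x)"
      using \<mu> J by (intro ennreal_leI powr_sum_le_sum_powr) auto
    also have "\<dots> = (\<Sum>j\<in>J. ennreal (?t j x))"
      by simp
    finally show "ennreal ((\<Sum>j\<in>J. avg_term \<alpha> \<Phi> j x) powr (1 / \<mu>)) * indicator (cell k z) x \<le>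
        (\<Sum>j\<in>J. ennreal (?t j x) * indicator (cell k z) x)"
      by (auto simp: indicator_def)
  qed
  also have "\<dots> = (\<Sum>j\<in>J. \<integral>\<^sup>+x\<in>cell k z. ennreal (?t j x) \<partial>lborel)"
    by (rule nn_integral_sum) measurable
  also have "\<dots> \<le> (\<Sum>j\<in>J. ennreal (\<mu> * 4 ^ CARD('n) * \<rho> ^ nat (j - k) * B))"
    using nn_integral_cell_avg_term_le[OF \<Phi> J(2), where z = z and \<alpha> = \<alpha>]
    by (intro sum_mono) (simp only: \<rho>_def B_def \<mu>_def)
  also have "\<dots> = ennreal (\<mu> * 4 ^ CARD('n) * (\<Sum>j\<in>J. \<rho> ^ nat (j - k)) * B)"
    using \<mu> B \<rho> by (simp add: sum_distrib_left sum_distrib_right)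
  also have "\<dots> \<le> ennreal (\<mu> * 4 ^ CARD('n) * (1 / (1 - \<rho>)) * B)"
    using J \<rho> \<mu> B
    by (intro ennreal_leI mult_right_mono mult_left_mono sum_geometric_int_le) auto
  finally show ?thesis by (simp add: B_def \<rho>_def)
qed

text \<open>Twice the constant of the preceding mean bound, raised to the power m to undo the root.
  With this threshold Chebyshev's inequality confines the exceptional set to half of the
  cell.\<close>

definition tail_const :: "'m::finite itself \<Rightarrow> 'n::finite itself \<Rightarrow> real \<Rightarrow> real" where
  "tail_const _ _ \<alpha> =
    (2 * (CARD('m) * 4 ^ CARD('n) / (1 - 4 powr (- \<alpha> / CARD('m))))) powr CARD('m)"

lemma emeasure_cell_tail_le:
  fixes \<Phi> :: "'m::finite \<Rightarrow> (real^'n) measure"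
  assumes \<Phi>: "\<And>i. radon (\<Phi> i)" and \<alpha>: "0 < \<alpha>"
    and J: "finite J" "\<And>j. j \<in> J \<Longrightarrow> k \<le> j"
  defines "G \<equiv> {x. (\<Sum>j\<in>J. avg_term \<alpha> \<Phi> j x) \<le>
    tail_const TYPE('m) TYPE('n) \<alpha> * avg_term \<alpha> \<Phi> k x}"
  shows "emeasure lborel (cell k z) \<le> 2 * emeasure lborel (cell k z \<inter> G)"
proof -
  define \<mu> where "\<mu> = real CARD('m)"
  have \<mu>: "1 \<le> \<mu>" by (simp add: \<mu>_def Suc_leI)
  define T where "T = \<mu> * 4 ^ CARD('n) / (1 - 4 powr (- \<alpha> / \<mu>))"
  have "4 powr (- \<alpha> / \<mu>) < 1"
    using \<alpha> \<mu> powr_less_mono[of "- \<alpha> / \<mu>" 0 4] by (simp add: divide_neg_pos)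
  then have T: "0 < T" using \<mu> by (simp add: T_def)
  define \<Lambda> where "\<Lambda> = tail_const TYPE('m) TYPE('n) \<alpha>"
  have \<Lambda>: "\<Lambda> = (2 * T) powr \<mu>" by (simp add: \<Lambda>_def tail_const_def T_def \<mu>_def)
  have \<Lambda>_root: "\<Lambda> powr (1 / \<mu>) = 2 * T"
    using T \<mu> by (simp add: \<Lambda> powr_powr)
  let ?F = "\<lambda>x. \<Sum>j\<in>J. avg_term \<alpha> \<Phi> j x"
  let ?a = "avg_term \<alpha> \<Phi> k z"
  let ?v = "(1 / freq k) ^ CARD('n)"
  have meas [measurable]: "avg_term \<alpha> \<Phi> j \<in> borel_measurable borel" for j
    by (rule borel_measurable_avg_term[OF \<Phi>])
  have G [measurable]: "G \<in> sets borel"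
    unfolding G_def by measurable
  have int: "(\<integral>\<^sup>+x\<in>cell k z. ennreal (?F x powr (1 / \<mu>)) \<partial>lborel) \<le>
      ennreal (T * (?a powr (1 / \<mu>) * ?v))"
    using nn_integral_cell_tail_le[OF \<Phi> \<alpha> J, where z = z] by (simp add: T_def \<mu>_def)
  have a_const: "avg_term \<alpha> \<Phi> k x = ?a" if "x \<in> cell k z" for x
    using that by (metis avg_term_cong cell_def mem_Collect_eq)
  have half: "emeasure lborel (cell k z - G) \<le> ennreal (?v / 2)"
  \<comment> \<open>For \<open>?a = 0\<close> the threshold is zero and Chebyshev's inequality is
    void; instead the mean bound makes the tail vanish almost everywhere on the cell.\<close>
  proof (cases "?a = 0")
    case True
    have "(\<integral>\<^sup>+x\<in>cell k z. ennreal (?F x powr (1 / \<mu>)) \<partial>lborel) = 0"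
      using int by (simp add: True)
    then have "AE x in lborel. ennreal (?F x powr (1 / \<mu>)) * indicator (cell k z) x = 0"
      by (subst (asm) nn_integral_0_iff_AE) auto
    moreover have "?F x powr (1 / \<mu>) * indicator (cell k z) x \<noteq> 0" if "x \<in> cell k z - G" for x
      using that a_const[of x] True by (auto simp: G_def)
    ultimately have "AE x in lborel. x \<notin> cell k z - G"
      by (auto elim!: eventually_mono simp: indicator_def G_def a_const True)
    then have "emeasure lborel {x \<in> cell k z. x \<notin> G} = 0"
      by (subst (asm) AE_iff_measurable[OF _ refl]) auto
    moreover have "cell k z - G = {x \<in> cell k z. x \<notin> G}" by auto
    ultimately have "emeasure lborel (cell k z - G) = 0" by (simp only:)
    then show ?thesis by simp
  next
    case False
    then have a: "0 < ?a" using avg_term_nonneg[of \<alpha> \<Phi> k z] by linarith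
    let ?s = "2 * T * ?a powr (1 / \<mu>)"
    have s: "0 < ?s" using T a by simp
    have "ennreal ?s * emeasure lborel (cell k z - G) = (\<integral>\<^sup>+x. ennreal ?s * indicator (cell k z - G) x \<partial>lborel)"
      by (subst nn_integral_cmult_indicator) auto
    also have "\<dots> \<le> (\<integral>\<^sup>+x\<in>cell k z. ennreal (?F x powr (1 / \<mu>)) \<partial>lborel)"
    proof (intro nn_integral_mono)
      fix x
      have "?s \<le> ?F x powr (1 / \<mu>)" if "x \<in> cell k z - G"
      proof -
        have "\<Lambda> * ?a \<le> ?F x"
          using that a_const[of x] by (auto simp: G_def \<Lambda>_def)
        then have "(\<Lambda> * ?a) powr (1 / \<mu>) \<le> ?F x powr (1 / \<mu>)"
          using \<mu> a by (intro powr_mono2) (auto simp: \<Lambda>)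
        then show ?thesis by (simp add: powr_mult \<Lambda>_root)
      qed
      then show "ennreal ?s * indicator (cell k z - G) x \<le> ennreal (?F x powr (1 / \<mu>)) * indicator (cell k z) x"
        by (auto simp: indicator_def intro!: ennreal_leI)
    qed
    also have "\<dots> \<le> ennreal (?s * (?v / 2))"
      using int by (simp add: mult_ac)
    also have "\<dots> = ennreal ?s * ennreal (?v / 2)"
      using s by (intro ennreal_mult) auto
    finally have "ennreal ?s * emeasure lborel (cell k z - G) \<le> ennreal ?s * ennreal (?v / 2)" .
    then show ?thesis
      using ennreal_mult_le_mult_iff[of "ennreal ?s"] s by (metis ennreal_eq_0_iff ennreal_neq_top not_le)
  qed
  have "ennreal ?v = emeasure lborel (cell k z \<inter> G) + emeasure lborel (cell k z - G)"
    by (subst plus_emeasure) (auto simp: Int_Diff_Un emeasure_lborel_cell)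
  also have "\<dots> \<le> emeasure lborel (cell k z \<inter> G) + ennreal (?v / 2)"
    using half by (intro add_left_mono)
  finally have le: "ennreal ?v \<le> emeasure lborel (cell k z \<inter> G) + ennreal (?v / 2)" .
  have "emeasure lborel (cell k z \<inter> G) \<le> emeasure lborel (cell k z)"
    by (intro emeasure_mono) auto
  then obtain r where r: "0 \<le> r" "emeasure lborel (cell k z \<inter> G) = ennreal r"
    unfolding emeasure_lborel_cell by (cases "emeasure lborel (cell k z \<inter> G)") (auto simp: top_unique)
  have "?v \<le> r + ?v / 2"
    using le r by (simp flip: ennreal_plus)
  then have "ennreal ?v \<le> ennreal (2 * r)"
    by (intro ennreal_leI) linarith
  then show ?thesis
    using r by (simp add: emeasure_lborel_cell ennreal_mult)
qed

section \<open>Transfer to the weight and the norm of the sum of all terms\<close>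

text \<open>The quantitative form in which \<open>A_infinity\<close> enters. The proportion one half
  matches the good part of a cell in \<open>emeasure_cell_tail_le\<close>.\<close>

definition comparable_on_cubes :: "real \<Rightarrow> (real^'n) measure \<Rightarrow> bool" where
  "comparable_on_cubes C V \<longleftrightarrow> (\<forall>a l F. 0 < l \<longrightarrow> F \<in> sets borel \<longrightarrow> F \<subseteq> cube a l \<longrightarrow>
     emeasure lborel (cube a l) \<le> 2 * emeasure lborel F \<longrightarrow>
     emeasure V (cube a l) \<le> ennreal C * emeasure V F)"

text \<open>A half-open cell and its closed cube have the same volume, so the condition on cubes
  applies to the part of \<open>G\<close> in the cell.\<close>

lemma comparable_on_cell:
  assumes V: "radon V" "comparable_on_cubes C V" and [measurable]: "G \<in> sets borel"
    and "emeasure lborel (cell k z) \<le> 2 * emeasure lborel (cell k z \<inter> G)"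
  shows "emeasure V (cell k z) \<le> ennreal C * emeasure V (cell k z \<inter> G)"
proof -
  let ?Q = "cube (cell_corner k z) (1 / freq k)"
  have "emeasure V (cell k z) \<le> emeasure V ?Q"
    using radon_sets[OF V(1)] by (intro emeasure_mono cell_subset_cube) simp
  also have "emeasure lborel ?Q \<le> 2 * emeasure lborel (cell k z \<inter> G)"
    using assms(4) by (simp add: emeasure_lborel_cube emeasure_lborel_cell)
  then have "emeasure V ?Q \<le> ennreal C * emeasure V (cell k z \<inter> G)"
    using cell_subset_cube[of k z]
    by (intro V(2)[unfolded comparable_on_cubes_def, rule_format]) auto
  finally show ?thesis .
qed

text \<open>
  A Muckenhoupt-Wheeden type bound. On each cell the weight is moved to the part where the
  \<open>k\<close>-th term dominates its tail; there the sum over \<open>k\<close> collapses to a single term.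
\<close>

lemma nn_integral_avg_sum_powr_le_ge_1:
  fixes \<Phi> :: "'m::finite \<Rightarrow> (real^'n) measure"
  assumes \<Phi>: "\<And>i. radon (\<Phi> i)" and \<alpha>: "0 < \<alpha>"
    and V: "radon V" "comparable_on_cubes C V" and C: "0 < C" and q: "1 \<le> q"
    and fin: "(\<Sum>k=a..b. \<integral>\<^sup>+x. ennreal (avg_term \<alpha> \<Phi> k x powr q) \<partial>V) < \<infinity>"
  defines "\<delta> \<equiv> 1 / (2 * q * C)"
  shows "(\<integral>\<^sup>+x. ennreal ((\<Sum>k=a..b. avg_term \<alpha> \<Phi> k x) powr q) \<partial>V) \<le>
    ennreal (2 * q * C * \<delta> powr (1 - q) * tail_const TYPE('m) TYPE('n) \<alpha> powr q) *
      (\<Sum>k=a..b. \<integral>\<^sup>+x. ennreal (avg_term \<alpha> \<Phi> k x powr q) \<partial>V)"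
proof -
  note [measurable_cong] = radon_sets[OF V(1)]
  \<comment> \<open>With \<open>\<delta> = 1 / (2 * q * C)\<close> the term to be absorbed,
    \<open>q * C * \<delta> * I\<close>, is exactly half of \<open>I\<close>.\<close>
  have \<delta>: "0 < \<delta>" using q C by (simp add: \<delta>_def)
  define \<Lambda> where "\<Lambda> = tail_const TYPE('m) TYPE('n) \<alpha>"
  have \<Lambda>: "0 \<le> \<Lambda>" by (simp add: \<Lambda>_def tail_const_def)
  let ?x = "\<lambda>k x. avg_term \<alpha> \<Phi> k x"
  let ?N = "\<lambda>x. \<Sum>k=a..b. ?x k x"
  have meas [measurable]: "?x j \<in> borel_measurable borel" for j
    by (rule borel_measurable_avg_term[OF \<Phi>])
  define G where "G k = {x. (\<Sum>j=k..b. ?x j x) \<le> \<Lambda> * ?x k x}" for k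
  have G [measurable]: "G k \<in> sets borel" for k
    unfolding G_def by measurable
  define h where "h k x = ?x k x * (\<Sum>j=a..k. ?x j x) powr (q - 1)" for k x
  have h_nonneg: "0 \<le> h k x" for k x by (simp add: h_def)
  have h_meas [measurable]: "h k \<in> borel_measurable borel" for k
    unfolding h_def[abs_def] by measurable
  have h_const: "h k x = h k y" if "same_cell k x y" for k x y
  proof -
    have "?x j x = ?x j y" if "j \<le> k" for j
      using \<open>same_cell k x y\<close> that by (intro avg_term_cong same_cell_mono[of j k])
    then show ?thesis by (simp add: h_def)
  qed
  define I where "I = (\<integral>\<^sup>+x. ennreal (?N x powr q) \<partial>V)"
  define S where "S = (\<Sum>k=a..b. \<integral>\<^sup>+x. ennreal (?x k x powr q) \<partial>V)"
  have N_nonneg: "0 \<le> ?N x" for x by (simp add: sum_nonneg)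
  \<comment> \<open>Absorbing half of \<open>I\<close> requires \<open>I\<close> to be finite. The
    bound used for this depends on the number of scales, but it does not enter the final
    constant.\<close>
  have I_fin: "I < \<infinity>"
  proof -
    have le: "?N x powr q \<le> real (card {a..b}) powr q * (\<Sum>k=a..b. ?x k x powr q)" for x
    proof -
      let ?Y = "\<Sum>k=a..b. ?x k x powr q"
      have "?x k x \<le> ?Y powr (1 / q)" if "k \<in> {a..b}" for k
      proof -
        have "(?x k x powr q) powr (1 / q) \<le> ?Y powr (1 / q)"
          using q that by (intro powr_mono2 member_le_sum) auto
        then show ?thesis using q by (simp add: powr_powr)
      qed
      then have "?N x \<le> real (card {a..b}) * ?Y powr (1 / q)" by (rule sum_bounded_above)
      then have "?N x powr q \<le> (real (card {a..b}) * ?Y powr (1 / q)) powr q"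
        using q N_nonneg by (intro powr_mono2) auto
      then show ?thesis using q by (simp add: powr_mult powr_powr sum_nonneg)
    qed
    have "I \<le> (\<integral>\<^sup>+x. ennreal (real (card {a..b}) powr q) * (\<Sum>k=a..b. ennreal (?x k x powr q)) \<partial>V)"
      unfolding I_def using le by (intro nn_integral_mono) (simp add: ennreal_leI sum_nonneg flip: ennreal_mult)
    also have "\<dots> = ennreal (real (card {a..b}) powr q) * S"
      unfolding S_def by (simp add: nn_integral_cmult nn_integral_sum del: sum_ennreal)
    also have "\<dots> < \<infinity>"
      using fin by (simp add: S_def ennreal_mult_less_top)
    finally show ?thesis .
  qed
  have "I \<le> (\<integral>\<^sup>+x. ennreal q * (\<Sum>k=a..b. ennreal (h k x)) \<partial>V)"
    unfolding I_def
  proof (intro nn_integral_mono)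
    fix x
    have "?N x powr q \<le> q * (\<Sum>k=a..b. h k x)"
      unfolding h_def using q by (intro powr_sum_le_partial_sums) auto
    then show "ennreal (?N x powr q) \<le> ennreal q * (\<Sum>k=a..b. ennreal (h k x))"
      using q by (simp add: h_nonneg sum_nonneg ennreal_leI flip: ennreal_mult)
  qed
  also have "\<dots> = ennreal q * (\<Sum>k=a..b. \<integral>\<^sup>+x. ennreal (h k x) \<partial>V)"
  proof -
    have hV: "(\<lambda>x. ennreal (h k x)) \<in> borel_measurable V" for k
      by measurable
    have "(\<lambda>x. \<Sum>k=a..b. ennreal (h k x)) \<in> borel_measurable V"
      by (intro borel_measurable_sum hV)
    then have "(\<integral>\<^sup>+x. ennreal q * (\<Sum>k=a..b. ennreal (h k x)) \<partial>V) =
        ennreal q * (\<integral>\<^sup>+x. (\<Sum>k=a..b. ennreal (h k x)) \<partial>V)"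
      by (rule nn_integral_cmult)
    also have "(\<integral>\<^sup>+x. (\<Sum>k=a..b. ennreal (h k x)) \<partial>V) = (\<Sum>k=a..b. \<integral>\<^sup>+x. ennreal (h k x) \<partial>V)"
      by (intro nn_integral_sum hV)
    finally show ?thesis .
  qed
  also have "\<dots> \<le> ennreal q * (\<Sum>k=a..b. ennreal C * (\<integral>\<^sup>+x. ennreal (h k x) * indicator (G k) x \<partial>V))"
  proof (intro mult_left_mono sum_mono nn_integral_cells_le[OF V(1)])
    fix k z
    show "emeasure V (cell k z) \<le> ennreal C * emeasure V (cell k z \<inter> G k)"
    proof (rule comparable_on_cell[OF V])
      show "emeasure lborel (cell k z) \<le> 2 * emeasure lborel (cell k z \<inter> G k)"
        unfolding G_def \<Lambda>_def by (rule emeasure_cell_tail_le[OF \<Phi> \<alpha>]) auto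
    qed (rule G)
  next
    fix k and x y :: "real^'n" assume "same_cell k x y"
    then show "ennreal (h k x) = ennreal (h k y)"
      by (simp only: h_const[of k x y])
  qed auto
  also have "\<dots> = ennreal (q * C) * (\<integral>\<^sup>+x. (\<Sum>k=a..b. ennreal (h k x) * indicator (G k) x) \<partial>V)"
    using q C by (subst nn_integral_sum) (auto simp: ennreal_mult mult.assoc sum_distrib_left)
  also have "\<dots> \<le> ennreal (q * C) * (\<integral>\<^sup>+x. ennreal \<delta> * ennreal (?N x powr q) +
      ennreal (\<delta> powr (1 - q) * \<Lambda> powr q) * (\<Sum>k=a..b. ennreal (?x k x powr q)) \<partial>V)"
  proof (intro mult_left_mono nn_integral_mono)
    fix x
    let ?S = "{k \<in> {a..b}. (\<Sum>j=k..b. ?x j x) \<le> \<Lambda> * ?x k x}"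
    have "(\<Sum>k=a..b. ennreal (h k x) * indicator (G k) x) = (\<Sum>k\<in>?S. ennreal (h k x))"
    proof -
      have "(\<Sum>k=a..b. ennreal (h k x) * indicator (G k) x) =
          (\<Sum>k\<in>{a..b}. if (\<Sum>j=k..b. ?x j x) \<le> \<Lambda> * ?x k x then ennreal (h k x) else 0)"
        by (intro sum.cong) (auto simp: G_def)
      also have "\<dots> = (\<Sum>k\<in>?S. ennreal (h k x))"
        by (rule sum.inter_filter[symmetric]) simp
      finally show ?thesis .
    qed
    also have "\<dots> = ennreal (\<Sum>k\<in>?S. h k x)"
      by (simp add: h_nonneg)
    also have "(\<Sum>k\<in>?S. h k x) \<le> (\<Sum>k\<in>?S. ?x k x * ?N x powr (q - 1))"
      unfolding h_def using q
      by (intro sum_mono mult_left_mono powr_mono2 sum_mono2) (auto intro: sum_nonneg)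
    then have "ennreal (\<Sum>k\<in>?S. h k x) \<le> ennreal (?N x powr (q - 1) * (\<Sum>k\<in>?S. ?x k x))"
      by (intro ennreal_leI) (simp add: sum_distrib_left mult.commute)
    also have "\<dots> \<le> ennreal (\<delta> * ?N x powr q + \<delta> powr (1 - q) * \<Lambda> powr q * (\<Sum>k=a..b. ?x k x powr q))"
      using \<delta> \<Lambda> q by (intro ennreal_leI sum_dominating_terms_le) auto
    also have "\<dots> = ennreal \<delta> * ennreal (?N x powr q) +
        ennreal (\<delta> powr (1 - q) * \<Lambda> powr q) * (\<Sum>k=a..b. ennreal (?x k x powr q))"
      using \<delta> by (simp add: ennreal_mult sum_nonneg)
    finally show "(\<Sum>k=a..b. ennreal (h k x) * indicator (G k) x) \<le> ennreal \<delta> * ennreal (?N x powr q) +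
        ennreal (\<delta> powr (1 - q) * \<Lambda> powr q) * (\<Sum>k=a..b. ennreal (?x k x powr q))" .
  qed auto
  also have "\<dots> = ennreal (q * C) * (ennreal \<delta> * I + ennreal (\<delta> powr (1 - q) * \<Lambda> powr q) * S)"
    unfolding I_def S_def
    by (simp add: nn_integral_add nn_integral_cmult nn_integral_sum del: sum_ennreal)
  finally have main: "I \<le> ennreal (q * C) * (ennreal \<delta> * I + ennreal (\<delta> powr (1 - q) * \<Lambda> powr q) * S)" .
  obtain i where i: "0 \<le> i" "I = ennreal i" using I_fin by (cases I) auto
  obtain s where s: "0 \<le> s" "S = ennreal s" using fin unfolding S_def[symmetric] by (cases S) auto
  let ?D = "\<delta> powr (1 - q) * \<Lambda> powr q"
  have "ennreal i \<le> ennreal (q * C * (\<delta> * i + ?D * s))"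
    using main i s \<delta> q C by (simp add: ennreal_mult ennreal_plus)
  then have "i \<le> q * C * (\<delta> * i + ?D * s)"
    using i s \<delta> q C by (subst (asm) ennreal_le_iff) auto
  also have "\<dots> = i / 2 + q * C * ?D * s"
    using q C by (simp add: \<delta>_def field_simps)
  finally have "i \<le> 2 * q * C * ?D * s" by linarith
  then have "I \<le> ennreal (2 * q * C * ?D * s)"
    using i by (simp add: ennreal_leI)
  also have "\<dots> = ennreal (2 * q * C * ?D) * S"
    using s q C by (simp add: ennreal_mult)
  finally show ?thesis
    by (simp add: I_def S_def \<Lambda>_def mult.assoc)
qed

lemma nn_integral_avg_sum_powr_le:
  fixes V :: "(real^'n) measure"
  assumes \<alpha>: "0 < \<alpha>" and V: "radon V" "comparable_on_cubes C V" and C: "0 < C" and q: "0 < q"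
  shows "\<exists>D>0. \<forall>(\<Phi> :: 'm::finite \<Rightarrow> (real^'n) measure) a b. (\<forall>i. radon (\<Phi> i)) \<longrightarrow>
    (\<integral>\<^sup>+x. ennreal ((\<Sum>k=a..b. avg_term \<alpha> \<Phi> k x) powr q) \<partial>V) \<le>
      ennreal D * (\<Sum>k=a..b. \<integral>\<^sup>+x. ennreal (avg_term \<alpha> \<Phi> k x powr q) \<partial>V)"
    (is "\<exists>D>0. \<forall>\<Phi> a b. _ \<longrightarrow> ?L \<Phi> a b \<le> ennreal D * ?S \<Phi> a b")
proof (cases "1 \<le> q")
  case True
  let ?\<delta> = "1 / (2 * q * C)"
  let ?\<Lambda> = "tail_const TYPE('m) TYPE('n) \<alpha>"
  let ?D = "2 * q * C * ?\<delta> powr (1 - q) * ?\<Lambda> powr q"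
  \<comment> \<open>The summand 1 guarantees a positive constant, so that an infinite right-hand
    side stays infinite; zero times infinity would be zero.\<close>
  have D: "0 < 1 + ?D" using q C by (simp add: add_pos_nonneg)
  show ?thesis
  proof (intro exI[of _ "1 + ?D"] conjI allI impI D)
    fix \<Phi> :: "'m \<Rightarrow> (real^'n) measure" and a b
    assume \<Phi>: "\<forall>i. radon (\<Phi> i)"
    show "?L \<Phi> a b \<le> ennreal (1 + ?D) * ?S \<Phi> a b"
    proof (cases "?S \<Phi> a b < \<infinity>")
      case True
      have "?L \<Phi> a b \<le> ennreal ?D * ?S \<Phi> a b"
        using \<Phi> \<open>1 \<le> q\<close> by (intro nn_integral_avg_sum_powr_le_ge_1 \<alpha> V C True) auto
      also have "\<dots> \<le> ennreal (1 + ?D) * ?S \<Phi> a b"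
        by (intro mult_right_mono ennreal_leI) auto
      finally show ?thesis .
    next
      case False
      then have "?S \<Phi> a b = \<infinity>"
        by (simp only: infinity_ennreal_def less_top[symmetric] not_not)
      moreover have "ennreal (1 + ?D) \<noteq> 0" using D by (simp add: ennreal_eq_0_iff)
      ultimately show ?thesis by (simp only: ennreal_mult_top infinity_ennreal_def top_greatest if_False)
    qed
  qed
next
  \<comment> \<open>An exponent below 1 does occur, since \<open>p\<close> may lie below 1 when m >
    1. The \<open>q\<close>-th power is then subadditive, and the constant is 1.\<close>
  case False
  show ?thesis
  proof (intro exI[of _ 1] conjI allI impI)
    fix \<Phi> :: "'m \<Rightarrow> (real^'n) measure" and a b
    assume \<Phi>: "\<forall>i. radon (\<Phi> i)"
    have meas: "avg_term \<alpha> \<Phi> j \<in> borel_measurable borel" for j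
      using \<Phi> by (intro borel_measurable_avg_term) auto
    have meas_V [measurable]: "avg_term \<alpha> \<Phi> j \<in> borel_measurable V" for j
      using meas measurable_cong_sets[OF radon_sets[OF V(1)] refl, of borel] by auto
    have "?L \<Phi> a b \<le>
        (\<integral>\<^sup>+x. (\<Sum>k=a..b. ennreal (avg_term \<alpha> \<Phi> k x powr q)) \<partial>V)"
      using q False by (intro nn_integral_mono) (auto intro!: ennreal_leI powr_sum_le_sum_powr)
    also have "\<dots> = ?S \<Phi> a b"
      by (rule nn_integral_sum) measurable
    finally show "?L \<Phi> a b \<le>
        ennreal 1 * ?S \<Phi> a b"
      by simp
  qed simp
qed

subsection \<open>A Carleson embedding for reverse doubling measures\<close>

text \<open>The sequence decreases at least geometrically, so the sum is controlled by its first and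
  largest admissible term, which is at most \<open>A\<close>.\<close>

lemma sum_powr_below_le:
  fixes \<phi> :: "int \<Rightarrow> real"
  assumes \<phi>: "\<And>k. 0 < \<phi> k" "\<And>k. d * \<phi> (k + 1) \<le> \<phi> k" and d: "1 < d"
    and \<beta>: "0 < \<beta>" and A: "0 < A" and I: "finite I"
  shows "(\<Sum>k\<in>{k\<in>I. \<phi> k \<le> A}. \<phi> k powr \<beta>) \<le> A powr \<beta> / (1 - d powr (- \<beta>))"
proof -
  define \<rho> where "\<rho> = d powr (- \<beta>)"
  have \<rho>: "0 \<le> \<rho>" "\<rho> < 1"
    using d \<beta> powr_less_mono[of "- \<beta>" 0 d] by (auto simp: \<rho>_def)
  let ?I = "{k\<in>I. \<phi> k \<le> A}"
  show ?thesis
  proof (cases "?I = {}")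
    case True
    then show ?thesis using \<rho> by (simp only: True) (simp add: \<rho>_def)
  next
    case False
    define k0 where "k0 = Min ?I"
    have fin: "finite ?I" using I by simp
    have k0: "k0 \<in> ?I" using Min_in[OF fin False] by (simp add: k0_def)
    have ge: "k0 \<le> k" if "k \<in> ?I" for k using Min_le[OF fin that] by (simp add: k0_def)
    have iter: "d ^ n * \<phi> (k0 + int n) \<le> \<phi> k0" for n
    proof (induction n)
      case (Suc n)
      have "d ^ Suc n * \<phi> (k0 + int (Suc n)) = d ^ n * (d * \<phi> (k0 + int n + 1))"
        by (simp add: algebra_simps)
      also have "\<dots> \<le> d ^ n * \<phi> (k0 + int n)"
        using d \<phi>(2) by (intro mult_left_mono) auto
      finally show ?case using Suc by linarith
    qed simp
    have "\<phi> k powr \<beta> \<le> A powr \<beta> * \<rho> ^ nat (k - k0)" if "k \<in> ?I" for k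
    proof -
      let ?n = "nat (k - k0)"
      have "d ^ ?n * \<phi> k \<le> A"
        using iter[of ?n] ge[OF that] k0 by simp
      then have "(d ^ ?n * \<phi> k) powr \<beta> \<le> A powr \<beta>"
        using \<phi>(1)[of k] d \<beta> by (intro powr_mono2) auto
      moreover have "(d ^ ?n * \<phi> k) powr \<beta> * \<rho> ^ ?n = \<phi> k powr \<beta>"
      proof -
        have "(d ^ ?n) powr \<beta> = d powr (real ?n * \<beta>)"
          using d by (simp add: powr_powr flip: powr_realpow)
        moreover have "\<rho> ^ ?n = d powr (- (real ?n * \<beta>))"
          using d by (simp add: \<rho>_def powr_power mult.commute)
        ultimately have "(d ^ ?n) powr \<beta> * \<rho> ^ ?n = 1"
          using d by (simp flip: powr_add)
        then show ?thesis by (simp add: powr_mult)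
      qed
      moreover have "(d ^ ?n * \<phi> k) powr \<beta> * \<rho> ^ ?n \<le> A powr \<beta> * \<rho> ^ ?n"
        using calculation(1) \<rho> by (intro mult_right_mono) auto
      ultimately show ?thesis by simp
    qed
    then have "(\<Sum>k\<in>?I. \<phi> k powr \<beta>) \<le> (\<Sum>k\<in>?I. A powr \<beta> * \<rho> ^ nat (k - k0))"
      by (rule sum_mono)
    also have "\<dots> \<le> A powr \<beta> * (1 / (1 - \<rho>))"
      unfolding sum_distrib_left[symmetric]
      using ge \<rho> fin by (intro mult_left_mono sum_geometric_int_le) auto
    finally show ?thesis by (simp add: \<rho>_def)
  qed
qed

text \<open>The reflected reciprocal \<open>1 / \<phi> (- k)\<close> satisfies the same decay, and
  the condition \<open>A \<le> \<phi> k\<close> becomes an upper bound for it.\<close>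

lemma sum_powr_above_le:
  fixes \<phi> :: "int \<Rightarrow> real"
  assumes \<phi>: "\<And>k. 0 < \<phi> k" "\<And>k. d * \<phi> (k + 1) \<le> \<phi> k" and d: "1 < d"
    and \<beta>: "0 < \<beta>" and A: "0 < A" and I: "finite I"
  shows "(\<Sum>k\<in>{k\<in>I. A \<le> \<phi> k}. \<phi> k powr (- \<beta>)) \<le> A powr (- \<beta>) / (1 - d powr (- \<beta>))"
proof -
  let ?\<psi> = "\<lambda>k. 1 / \<phi> (- k)"
  have "d * ?\<psi> (k + 1) \<le> ?\<psi> k" for k
    using \<phi>(1)[of "- k"] \<phi>(1)[of "- (k + 1)"] \<phi>(2)[of "- (k + 1)"] by (simp add: field_simps)
  then have "(\<Sum>k\<in>{k\<in>uminus ` I. ?\<psi> k \<le> 1 / A}. ?\<psi> k powr \<beta>) \<le> (1 / A) powr \<beta> / (1 - d powr (- \<beta>))"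
    using \<phi>(1) d \<beta> A I by (intro sum_powr_below_le) auto
  also have "{k\<in>uminus ` I. ?\<psi> k \<le> 1 / A} = uminus ` {k\<in>I. A \<le> \<phi> k}"
    using \<phi>(1) A by (auto simp: field_simps)
  also have "(\<Sum>k\<in>uminus ` {k\<in>I. A \<le> \<phi> k}. ?\<psi> k powr \<beta>) = (\<Sum>k\<in>{k\<in>I. A \<le> \<phi> k}. \<phi> k powr (- \<beta>))"
    by (subst sum.reindex) (auto simp: powr_minus_divide powr_divide)
  finally show ?thesis by (simp add: powr_minus_divide powr_divide)
qed

text \<open>The two entries of the minimum agree at \<open>\<phi> = g powr (- p)\<close>. Below this
  value the total exponent of \<open>\<phi>\<close> is \<open>(r - p) / p\<close>, positive because
  \<open>p < r\<close>; above it the exponent is \<open>-(1 - 1 / p)\<close>, negative because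
  \<open>1 < p\<close>. Both halves are thus geometric sums governed by the crossing point, where
  they have size \<open>g powr (p - 1)\<close>.\<close>

lemma sum_min_powr_le:
  fixes \<phi> :: "int \<Rightarrow> real"
  assumes \<phi>: "\<And>k. 0 < \<phi> k" "\<And>k. d * \<phi> (k + 1) \<le> \<phi> k" and d: "1 < d"
    and p: "1 < p" "p < r" and g: "0 < g" and I: "finite I"
  shows "(\<Sum>k\<in>I. min 1 (g * \<phi> k powr (1 / p)) powr (r - 1) * \<phi> k powr (- (1 - 1 / p))) \<le>
    (1 / (1 - d powr (- ((r - p) / p))) + 1 / (1 - d powr (- (1 - 1 / p)))) * g powr (p - 1)"
proof -
  define A where "A = g powr (- p)"
  have A: "0 < A" using g by (simp add: A_def)
  let ?f = "\<lambda>k. min 1 (g * \<phi> k powr (1 / p)) powr (r - 1) * \<phi> k powr (- (1 - 1 / p))"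
  have \<beta>: "0 < (r - p) / p" "0 < 1 - 1 / p" using p by auto
  have split: "(\<Sum>k\<in>I. ?f k) = (\<Sum>k\<in>{k\<in>I. \<phi> k \<le> A}. ?f k) + (\<Sum>k\<in>{k\<in>I. A < \<phi> k}. ?f k)"
  proof -
    have "I = {k\<in>I. \<phi> k \<le> A} \<union> {k\<in>I. A < \<phi> k}" by auto
    then have "(\<Sum>k\<in>I. ?f k) = (\<Sum>k\<in>{k\<in>I. \<phi> k \<le> A} \<union> {k\<in>I. A < \<phi> k}. ?f k)"
      by (rule arg_cong)
    also have "\<dots> = (\<Sum>k\<in>{k\<in>I. \<phi> k \<le> A}. ?f k) + (\<Sum>k\<in>{k\<in>I. A < \<phi> k}. ?f k)"
      by (rule sum.union_disjoint) (use I in auto)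
    finally show ?thesis .
  qed
  have "(\<Sum>k\<in>{k\<in>I. A < \<phi> k}. ?f k) \<le> (\<Sum>k\<in>{k\<in>I. A \<le> \<phi> k}. ?f k)"
  proof (rule sum_mono2)
    show "0 \<le> ?f k" for k by (intro mult_nonneg_nonneg powr_ge_zero)
  qed (use I in auto)
  also have "\<dots> \<le> (\<Sum>k\<in>{k\<in>I. A \<le> \<phi> k}. \<phi> k powr (- (1 - 1 / p)))"
  proof (intro sum_mono)
    fix k
    have "min 1 (g * \<phi> k powr (1 / p)) powr (r - 1) \<le> 1 powr (r - 1)"
      using p g \<phi>(1)[of k] by (intro powr_mono2) auto
    then have "?f k \<le> 1 * \<phi> k powr (- (1 - 1 / p))"
      by (intro mult_right_mono) auto
    then show "?f k \<le> \<phi> k powr (- (1 - 1 / p))" by simp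
  qed
  also have "\<dots> \<le> A powr (- (1 - 1 / p)) / (1 - d powr (- (1 - 1 / p)))"
    by (rule sum_powr_above_le[where \<phi> = \<phi>, OF \<phi> d \<beta>(2) A I])
  also have "A powr (- (1 - 1 / p)) = g powr (p - 1)"
  proof -
    have "- p * - (1 - 1 / p) = p - 1" using p by (simp add: field_simps)
    then show ?thesis by (simp add: A_def powr_powr)
  qed
  finally have 1: "(\<Sum>k\<in>{k\<in>I. A < \<phi> k}. ?f k) \<le> g powr (p - 1) / (1 - d powr (- (1 - 1 / p)))" .
  have "(\<Sum>k\<in>{k\<in>I. \<phi> k \<le> A}. ?f k) \<le> (\<Sum>k\<in>{k\<in>I. \<phi> k \<le> A}. g powr (r - 1) * \<phi> k powr ((r - p) / p))"
  proof (intro sum_mono)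
    fix k
    have "min 1 (g * \<phi> k powr (1 / p)) powr (r - 1) \<le> (g * \<phi> k powr (1 / p)) powr (r - 1)"
      using p g \<phi>(1)[of k] by (intro powr_mono2) auto
    then have "?f k \<le> (g * \<phi> k powr (1 / p)) powr (r - 1) * \<phi> k powr (- (1 - 1 / p))"
      by (intro mult_right_mono) auto
    also have "\<dots> = g powr (r - 1) * (\<phi> k powr ((r - 1) / p) * \<phi> k powr (- (1 - 1 / p)))"
      by (simp add: powr_mult powr_powr)
    also have "\<phi> k powr ((r - 1) / p) * \<phi> k powr (- (1 - 1 / p)) = \<phi> k powr ((r - p) / p)"
    proof -
      have "(r - 1) / p + - (1 - 1 / p) = (r - p) / p" using p by (simp add: field_simps)
      then show ?thesis by (simp only: powr_add[symmetric])
    qed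
    finally show "?f k \<le> g powr (r - 1) * \<phi> k powr ((r - p) / p)" .
  qed
  also have "\<dots> = g powr (r - 1) * (\<Sum>k\<in>{k\<in>I. \<phi> k \<le> A}. \<phi> k powr ((r - p) / p))"
    by (simp add: sum_distrib_left)
  also have "\<dots> \<le> g powr (r - 1) * (A powr ((r - p) / p) / (1 - d powr (- ((r - p) / p))))"
    by (intro mult_left_mono sum_powr_below_le[where \<phi> = \<phi>, OF \<phi> d \<beta>(1) A I]) auto
  also have "g powr (r - 1) * (A powr ((r - p) / p) / (1 - d powr (- ((r - p) / p)))) =
      g powr (p - 1) / (1 - d powr (- ((r - p) / p)))"
  proof -
    have "r - 1 + - p * ((r - p) / p) = p - 1" using p by (simp add: field_simps)
    then have "g powr (r - 1) * A powr ((r - p) / p) = g powr (p - 1)"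
      by (simp only: A_def powr_powr powr_add[symmetric])
    then show ?thesis by simp
  qed
  finally have 2: "(\<Sum>k\<in>{k\<in>I. \<phi> k \<le> A}. ?f k) \<le> g powr (p - 1) / (1 - d powr (- ((r - p) / p)))" .
  show ?thesis
    unfolding split using add_mono[OF 2 1] by (simp only: distrib_right times_divide_eq_left mult_1)
qed

text \<open>Boxes centred at \<open>z\<close> instead of attached to the grid: they contain
  \<open>nbhd k z\<close>, and they follow translations and dilations of \<open>z\<close>, as the
  change of variables in the embedding requires.\<close>

definition box_at :: "int \<Rightarrow> real^'n \<Rightarrow> (real^'n) set" where
  "box_at k z = cube (z - vec (3 / freq k)) (6 / freq k)"

lemma mem_box_at: "y \<in> box_at k z \<longleftrightarrow> (\<forall>i. \<bar>z $ i - y $ i\<bar> \<le> 3 / freq k)"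
  by (auto simp: box_at_def mem_cube abs_le_iff algebra_simps)

lemma sets_box_at [measurable]: "box_at k z \<in> sets borel"
  by (simp add: box_at_def)

lemma pred_box_at [measurable]:
  "Measurable.pred (borel \<Otimes>\<^sub>M borel) (\<lambda>p. (snd p :: real^'n) \<in> box_at k (fst p))"
  unfolding mem_box_at by measurable

lemma emeasure_box_at_finite: "radon M \<Longrightarrow> emeasure M (box_at k z) < \<infinity>"
  unfolding box_at_def by (rule emeasure_cube_finite)

lemma emeasure_eq_measure_box_at:
  "radon M \<Longrightarrow> emeasure M (box_at k z) = ennreal (measure M (box_at k z))"
  using emeasure_box_at_finite[of M k z] by (simp add: emeasure_eq_ennreal_measure less_top)

lemma borel_measurable_emeasure_box_at:
  "radon M \<Longrightarrow> (\<lambda>z. emeasure M (box_at k z)) \<in> borel_measurable borel"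
  using borel_measurable_emeasure_section[OF _ pred_box_at, of M k] by simp

lemma borel_measurable_measure_box_at:
  "radon M \<Longrightarrow> (\<lambda>z. measure M (box_at k z)) \<in> borel_measurable borel"
  unfolding measure_def by (intro borel_measurable_enn2real borel_measurable_emeasure_box_at)

definition reverse_doubling_measure :: "real \<Rightarrow> (real^'n) measure \<Rightarrow> bool" where
  "reverse_doubling_measure d M \<longleftrightarrow>
     (\<forall>a l. 0 < l \<longrightarrow> (\<forall>Q'\<in>dyadic_subcubes a l. ennreal d * emeasure M Q' \<le> emeasure M (cube a l)))"

text \<open>
  The boxes \<open>y + 4\<^sup>-\<^sup>k B\<close> with \<open>0 \<in> B\<close> are nested, and each one lies in a corner of a cube
  of twice its side inside the next larger one.
\<close>

lemma reverse_doubling_chain: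
  assumes M: "radon M" "reverse_doubling_measure d M" and d: "0 \<le> d"
    and u: "\<And>i. \<bar>u $ i\<bar> \<le> 3"
  shows "d * measure M (box_at (k + 1) (y + (1 / freq (k + 1)) *\<^sub>R u)) \<le>
    measure M (box_at k (y + (1 / freq k) *\<^sub>R u))"
proof -
  define c where "c = freq k"
  have c: "0 < c" by (simp add: c_def)
  have f: "freq (k + 1) = 4 * c" by (simp add: c_def freq_add) (simp add: freq_def)
  let ?B = "box_at k (y + (1 / freq k) *\<^sub>R u)" and ?B' = "box_at (k + 1) (y + (1 / freq (k + 1)) *\<^sub>R u)"
  \<comment> \<open>In each coordinate a side of length \<open>3 / c\<close> is placed so that the
    smaller box fills its upper half if \<open>u $ i < 0\<close> and its lower half otherwise.
    Following the sign of \<open>u $ i\<close> keeps the doubled cube inside the larger box.\<close>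
  define a where "a = (\<chi> i. y $ i + (if u $ i < 0 then ((u $ i + 3) / 4 - 3) else (u $ i - 3) / 4) / c)"
  define S where "S = {i. u $ i < 0}"
  let ?Q = "cube a (3 / c)"
  have "?B' = cube (a + (\<chi> i. if i \<in> S then 3 / c / 2 else 0)) (3 / c / 2)"
  proof -
    have "y + (1 / freq (k + 1)) *\<^sub>R u - vec (3 / freq (k + 1)) = a + (\<chi> i. if i \<in> S then 3 / c / 2 else 0)"
      using c by (simp add: vec_eq_iff a_def S_def f field_simps f[unfolded add.commute[of k]])
    moreover have "6 / freq (k + 1) = 3 / c / 2" by (simp add: f)
    ultimately show ?thesis by (simp only: box_at_def)
  qed
  then have "?B' \<in> dyadic_subcubes a (3 / c)"
    unfolding dyadic_subcubes_def by blast
  then have "ennreal d * emeasure M ?B' \<le> emeasure M ?Q"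
    using M(2) c by (simp add: reverse_doubling_measure_def)
  also have "\<dots> \<le> emeasure M ?B"
  proof (rule emeasure_mono)
    show "?Q \<subseteq> ?B"
    proof
      fix x assume x: "x \<in> ?Q"
      show "x \<in> ?B"
        unfolding mem_box_at
      proof
        fix i
        have "a $ i \<le> x $ i" "x $ i \<le> a $ i + 3 / c" using x by (auto simp: mem_cube)
        then have f1: "c * a $ i \<le> c * x $ i" "c * x $ i \<le> c * a $ i + 3"
          using c by (auto simp: field_simps)
        have f2: "c * a $ i = c * y $ i + (if u $ i < 0 then ((u $ i + 3) / 4 - 3) else (u $ i - 3) / 4)"
          using c by (simp add: a_def algebra_simps)
        have aux: "\<bar>Y + v - X\<bar> \<le> 3"
          if "A \<le> X" "X \<le> A + 3" "\<bar>v\<bar> \<le> 3"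
            "v < 0 \<and> A = Y + ((v + 3) / 4 - 3) \<or> 0 \<le> v \<and> A = Y + (v - 3) / 4"
          for A X Y v :: real
          using that by (auto simp: abs_le_iff field_simps)
        have "\<bar>c * y $ i + u $ i - c * x $ i\<bar> \<le> 3"
          by (rule aux[OF f1 u]) (use f2 in auto)
        then have "\<bar>c * (y $ i + u $ i / c - x $ i)\<bar> \<le> 3"
          using c by (simp add: algebra_simps)
        then have "c * \<bar>y $ i + u $ i / c - x $ i\<bar> \<le> 3"
          using c by (simp add: abs_mult)
        then show "\<bar>(y + (1 / freq k) *\<^sub>R u) $ i - x $ i\<bar> \<le> 3 / freq k"
          using c by (simp add: c_def field_simps)
      qed
    qed
    show "?B \<in> sets M" using radon_sets[OF M(1)] by simp
  qed
  finally show ?thesis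
    using d by (simp add: emeasure_eq_measure_box_at[OF M(1)] flip: ennreal_mult)
qed

lemma nn_integral_lborel_rescale:
  fixes h :: "real^'n \<Rightarrow> ennreal"
  assumes [measurable]: "h \<in> borel_measurable borel" and "0 < c"
  shows "(\<integral>\<^sup>+z. ennreal (c ^ CARD('n)) * h z \<partial>lborel) = (\<integral>\<^sup>+u. h (y + (1 / c) *\<^sub>R u) \<partial>lborel)"
proof -
  have "(\<integral>\<^sup>+z. h z \<partial>lborel) = ennreal ((1 / c) ^ CARD('n)) * (\<integral>\<^sup>+u. h (y + (1 / c) *\<^sub>R u) \<partial>lborel)"
    using assms(2)
    by (subst lborel_affine[of "1 / c" y])
      (simp_all add: nn_integral_density nn_integral_distr nn_integral_cmult)
  moreover have "ennreal (c ^ CARD('n)) * ennreal ((1 / c) ^ CARD('n)) = 1"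
    using assms(2) by (simp add: power_one_over flip: ennreal_mult)
  ultimately show ?thesis
    by (simp add: nn_integral_cmult flip: mult.assoc)
qed

section \<open>The embedding for a single function of norm at most 1\<close>

context
  fixes S :: "(real^'n) measure" and g :: "real^'n \<Rightarrow> real" and p r :: real
  assumes S: "radon S"
    and S_pos: "\<And>a l. 0 < l \<Longrightarrow> 0 < emeasure S (cube a l)"
    and g [measurable]: "g \<in> borel_measurable borel" and g_nonneg: "\<And>x. 0 \<le> g x"
    and p: "1 < p" and pr: "p < r"
    and norm: "(\<integral>\<^sup>+x. ennreal (g x powr p) \<partial>S) \<le> 1"
begin

private abbreviation s where "s k z \<equiv> measure S (box_at k z)"
private abbreviation m where "m k z \<equiv> measure (rdensity S g) (box_at k z)"
text \<open>The mass of \<open>g\<close> on a box, normalised by the power of \<open>s k z\<close>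
  that Hoelder's inequality predicts, so that it is bounded uniformly in \<open>k\<close> and
  \<open>z\<close>.\<close>

private abbreviation b where "b k z \<equiv> m k z * s k z powr (- (1 - 1 / p))"

private lemma sets_S: "sets S = sets borel"
  by (rule radon_sets[OF S])

private lemma mass_pos: "0 < s k z"
proof -
  have "0 < emeasure S (box_at k z)" by (simp add: box_at_def S_pos)
  then show ?thesis by (simp add: emeasure_eq_measure_box_at[OF S])
qed

private lemma emeasure_density_box_at:
  "emeasure (rdensity S g) (box_at k z) = (\<integral>\<^sup>+x\<in>box_at k z. ennreal (g x) \<partial>S)"
proof -
  note [measurable_cong] = sets_S
  show ?thesis by (rule emeasure_density) measurable
qed

text \<open>Hoelder's inequality with constant 2: split \<open>g\<close> at the level
  \<open>\<tau> = s k z powr (- (1 / p))\<close>, where the small part and the large part receive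
  the same bound.\<close>

private lemma emeasure_density_box_at_le:
  "emeasure (rdensity S g) (box_at k z) \<le> ennreal (2 * s k z powr (1 - 1 / p))"
proof -
  note [measurable_cong] = sets_S
  define \<tau> where "\<tau> = s k z powr (- (1 / p))"
  have \<tau>: "0 < \<tau>" using mass_pos[of k z] by (simp add: \<tau>_def)
  have pw: "g x \<le> \<tau> + \<tau> powr (1 - p) * g x powr p" for x
  proof (cases "g x \<le> \<tau>")
    case True
    then show ?thesis by (smt (verit) powr_ge_zero mult_nonneg_nonneg)
  next
    case False
    then have gx: "0 < g x" using \<tau> by linarith
    have "g x = g x powr (1 - p) * g x powr p"
      using gx by (simp flip: powr_add)
    also have "\<dots> \<le> \<tau> powr (1 - p) * g x powr p"
      using False \<tau> p by (intro mult_right_mono powr_mono2') auto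
    finally show ?thesis using \<tau> by linarith
  qed
  have "(\<integral>\<^sup>+x\<in>box_at k z. ennreal (g x) \<partial>S) \<le>
      (\<integral>\<^sup>+x. ennreal \<tau> * indicator (box_at k z) x + ennreal (\<tau> powr (1 - p)) * ennreal (g x powr p) \<partial>S)"
    using pw \<tau> by (intro nn_integral_mono)
      (auto simp: indicator_def simp flip: ennreal_mult ennreal_plus intro!: ennreal_leI)
  also have "\<dots> = ennreal \<tau> * emeasure S (box_at k z) +
      ennreal (\<tau> powr (1 - p)) * (\<integral>\<^sup>+x. ennreal (g x powr p) \<partial>S)"
    by (simp add: nn_integral_add nn_integral_cmult nn_integral_cmult_indicator)
  also have "\<dots> \<le> ennreal \<tau> * ennreal (s k z) + ennreal (\<tau> powr (1 - p)) * 1"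
    using norm by (intro add_mono mult_left_mono) (auto simp: emeasure_eq_measure_box_at[OF S])
  also have "\<dots> = ennreal (\<tau> * s k z + \<tau> powr (1 - p))"
    using \<tau> mass_pos[of k z] by (simp add: ennreal_mult ennreal_plus less_imp_le)
  also have "\<tau> * s k z + \<tau> powr (1 - p) = 2 * s k z powr (1 - 1 / p)"
  proof -
    have "\<tau> * s k z = s k z powr (1 - 1 / p)"
      using mass_pos[of k z] by (simp add: \<tau>_def powr_mult_base mult.commute[of "_ powr _"])
    moreover have "- (1 / p) * (1 - p) = 1 - 1 / p" using p by (simp add: field_simps)
    ultimately show ?thesis by (simp only: \<tau>_def powr_powr)
  qed
  finally show ?thesis by (simp add: emeasure_density_box_at)
qed

private lemma emeasure_density_box_at_eq:
  "emeasure (rdensity S g) (box_at k z) = ennreal (m k z)"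
  using emeasure_density_box_at_le[of k z]
  by (intro emeasure_eq_ennreal_measure) (auto simp: top_unique)

private lemma m_le: "m k z \<le> 2 * s k z powr (1 - 1 / p)"
  using emeasure_density_box_at_le[of k z] by (simp add: emeasure_density_box_at_eq)

private lemma b_nonneg: "0 \<le> b k z"
  by simp

private lemma m_eq: "m k z = b k z * s k z powr (1 - 1 / p)"
proof -
  have "s k z powr (- (1 - 1 / p)) * s k z powr (1 - 1 / p) = 1"
    using mass_pos[of k z] by (simp flip: powr_add)
  then show ?thesis by (simp add: mult.assoc)
qed

private lemma b_le_2: "b k z \<le> 2"
proof -
  have "b k z \<le> 2 * s k z powr (1 - 1 / p) * s k z powr (- (1 - 1 / p))"
    using m_le[of k z] by (rule mult_right_mono) simp
  also have "\<dots> = 2 * (s k z powr (1 - 1 / p) * s k z powr (- (1 - 1 / p)))"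
    by (rule mult.assoc)
  also have "s k z powr (1 - 1 / p) * s k z powr (- (1 - 1 / p)) = 1"
    using mass_pos[of k z] by (simp flip: powr_add)
  finally show ?thesis by simp
qed

text \<open>
  The part of \<open>g\<close> below half of its normalised average is irrelevant, and above it the
  average is controlled by \<open>g\<close> itself.
\<close>

private lemma b_powr_le:
  "ennreal (b k z powr r) \<le> ennreal (2 powr r) *
    (\<integral>\<^sup>+y\<in>box_at k z. ennreal (g y * (min 1 (g y * s k z powr (1 / p)) powr (r - 1) *
      s k z powr (- (1 - 1 / p)))) \<partial>S)"
proof (cases "b k z = 0")
  case False
  note [measurable_cong] = sets_S
  let ?s = "s k z" and ?b = "b k z"
  let ?m = "\<lambda>y. min 1 (g y * ?s powr (1 / p)) powr (r - 1)"
  let ?\<psi> = "\<lambda>y. ennreal (g y * (?m y * ?s powr (- (1 - 1 / p))))"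
  have sp: "0 < ?s" by (rule mass_pos)
  have bp: "0 < ?b" using False b_nonneg[of k z] by linarith
  define t where "t = ?b * ?s powr (- (1 / p)) / 2"
  have t: "0 < t" using sp bp by (simp add: t_def)
  define H where "H = {y \<in> box_at k z. t \<le> g y}"
  let ?I = "\<integral>\<^sup>+y\<in>H. ennreal (g y) \<partial>S"
  have [measurable]: "H \<in> sets borel" unfolding H_def by measurable
  have "ennreal (m k z) = (\<integral>\<^sup>+y\<in>box_at k z. ennreal (g y) \<partial>S)"
    by (simp add: emeasure_density_box_at flip: emeasure_density_box_at_eq)
  also have "\<dots> \<le> (\<integral>\<^sup>+y. ennreal t * indicator (box_at k z) y + ennreal (g y) * indicator H y \<partial>S)"
    by (intro nn_integral_mono) (auto simp: indicator_def H_def intro!: ennreal_leI)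
  also have "\<dots> = ennreal t * ennreal ?s + ?I"
    by (simp add: nn_integral_add nn_integral_cmult_indicator emeasure_eq_measure_box_at[OF S])
  also have "ennreal t * ennreal ?s = ennreal (m k z / 2)"
  proof -
    have "?s powr (- (1 / p)) * ?s = ?s powr (1 - 1 / p)"
      using sp by (simp add: powr_mult_base mult.commute[of "_ powr _"])
    then have "t * ?s = m k z / 2"
      using m_eq[of k z] by (simp add: t_def mult.assoc)
    then show ?thesis using t sp by (simp flip: ennreal_mult)
  qed
  finally have le: "ennreal (m k z) \<le> ennreal (m k z / 2) + ?I" .
  have H_le: "ennreal (m k z / 2) \<le> ?I"
  proof (cases ?I)
    case (real x)
    then have "m k z \<le> m k z / 2 + x"
      using le by (simp flip: ennreal_plus)
    then show ?thesis using real by (simp add: ennreal_leI)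
  qed simp
  let ?c = "2 * ?b powr (r - 1) * ?s powr (- (1 - 1 / p))"
  have "?b powr r = ?c * (m k z / 2)"
    using bp by (simp add: powr_mult_base[of ?b "r - 1", simplified, symmetric] del: mult_eq_0_iff)
  then have "ennreal (?b powr r) = ennreal ?c * ennreal (m k z / 2)"
    by (simp flip: ennreal_mult)
  also have "\<dots> \<le> ennreal ?c * ?I"
    by (intro mult_left_mono H_le) simp
  also have "\<dots> = (\<integral>\<^sup>+y. ennreal ?c * (ennreal (g y) * indicator H y) \<partial>S)"
    by (simp add: nn_integral_cmult)
  also have "\<dots> \<le> (\<integral>\<^sup>+y. ennreal (2 powr r) * (?\<psi> y * indicator (box_at k z) y) \<partial>S)"
  proof (intro nn_integral_mono)
    fix y
    show "ennreal ?c * (ennreal (g y) * indicator H y) \<le>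
      ennreal (2 powr r) * (?\<psi> y * indicator (box_at k z) y)"
    proof (cases "y \<in> H")
      case True
      have "?b * (?s powr (- (1 / p)) * ?s powr (1 / p)) \<le> 2 * (g y * ?s powr (1 / p))"
        using True sp by (simp add: H_def t_def field_simps del: minus_divide_left)
      then have "?b \<le> 2 * (g y * ?s powr (1 / p))"
        using sp by (simp flip: powr_add)
      \<comment> \<open>The bound by \<open>b_le_2\<close> supplies the entry 1 of the minimum. It
        is the better one at coarse scales, where \<open>s k z\<close> is large and the other entry
        would not give a convergent sum.\<close>
      then have "?b \<le> 2 * min 1 (g y * ?s powr (1 / p))"
        using b_le_2[of k z] by (simp add: min_def)
      then have "?b powr (r - 1) \<le> (2 * min 1 (g y * ?s powr (1 / p))) powr (r - 1)"
        using bp p pr by (intro powr_mono2) auto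
      then have "2 * ?b powr (r - 1) \<le> 2 * (2 powr (r - 1) * ?m y)"
        by (simp add: powr_mult)
      also have "\<dots> = 2 powr r * ?m y"
        by (simp add: powr_mult_base flip: mult.assoc)
      finally have "?c \<le> 2 powr r * ?m y * ?s powr (- (1 - 1 / p))"
        by (intro mult_right_mono) auto
      then have "?c * g y \<le> 2 powr r * ?m y * ?s powr (- (1 - 1 / p)) * g y"
        using g_nonneg by (rule mult_right_mono)
      moreover have "y \<in> box_at k z" using True by (simp add: H_def)
      ultimately show ?thesis
        using True g_nonneg[of y] by (simp add: ennreal_leI mult_ac flip: ennreal_mult)
    qed simp
  qed
  also have "\<dots> = ennreal (2 powr r) * (\<integral>\<^sup>+y\<in>box_at k z. ?\<psi> y \<partial>S)"
    by (intro nn_integral_cmult) measurable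
  finally show ?thesis .
next
  case True
  show ?thesis by (simp only: True) simp
qed

text \<open>After Fubini and the substitution \<open>z = y + u / freq k\<close>, the condition that
  the box contains \<open>y\<close> becomes \<open>u \<in> box_at 0 0\<close>, whatever
  \<open>k\<close> is. For fixed \<open>y\<close> and \<open>u\<close> the masses along
  \<open>k\<close> decay geometrically, and \<open>sum_min_powr_le\<close> returns
  \<open>g y powr (p - 1)\<close>, the missing factor of \<open>g y powr p\<close>. The constant
  \<open>6 ^ n\<close> is the volume of the parameter box.\<close>

lemma sum_nn_integral_averages_le:
  assumes d: "1 < d" and rd: "reverse_doubling_measure d S" and I: "finite I"
  shows "(\<Sum>k\<in>I. \<integral>\<^sup>+z. ennreal (freq k ^ CARD('n) *
      (measure (rdensity S g) (box_at k z) *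
        measure S (box_at k z) powr (- (1 - 1 / p))) powr r) \<partial>lborel) \<le>
    ennreal (2 powr r * 6 ^ CARD('n) *
      (1 / (1 - d powr (- ((r - p) / p))) + 1 / (1 - d powr (- (1 - 1 / p)))))"
proof -
  note [measurable_cong] = sets_S
  interpret pair_sigma_finite "lborel :: (real^'n) measure" S
    by (intro pair_sigma_finite_radon S radon_lborel)
  have [measurable]: "(\<lambda>z. s k z) \<in> borel_measurable borel" for k
    by (rule borel_measurable_measure_box_at[OF S])
  define \<psi> where "\<psi> t k z = min 1 (t * s k z powr (1 / p)) powr (r - 1) * s k z powr (- (1 - 1 / p))" for t k z
  have \<psi>_nonneg: "0 \<le> \<psi> t k z" for t k z by (simp add: \<psi>_def)
  let ?T = "\<lambda>k y u. ennreal (g y * \<psi> (g y) k (y + (1 / freq k) *\<^sub>R u)) * indicator (box_at 0 0) u"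
  define K where "K = 1 / (1 - d powr (- ((r - p) / p))) + 1 / (1 - d powr (- (1 - 1 / p)))"
  have K: "0 \<le> K"
  proof -
    have "d powr (- ((r - p) / p)) < 1" "d powr (- (1 - 1 / p)) < 1"
      using d p pr powr_less_mono[of "- ((r - p) / p)" 0 d] powr_less_mono[of "- (1 - 1 / p)" 0 d] by auto
    then show ?thesis by (simp add: K_def)
  qed
  have "(\<integral>\<^sup>+z. ennreal (freq k ^ CARD('n) * b k z powr r) \<partial>lborel) \<le>
      ennreal (2 powr r) * (\<integral>\<^sup>+y. (\<integral>\<^sup>+u. ?T k y u \<partial>lborel) \<partial>S)"
    for k
  proof -
    let ?c = "ennreal (freq k ^ CARD('n))"
    let ?h = "\<lambda>z y. ennreal (g y * \<psi> (g y) k z) * indicator {q. \<forall>i. \<bar>fst q $ i - snd q $ i\<bar> \<le> 3 / freq k} (z, y)"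
    have h_meas: "(\<lambda>(z, y). ?h z y) \<in> borel_measurable (lborel \<Otimes>\<^sub>M S)"
      unfolding \<psi>_def by measurable
    have "(\<integral>\<^sup>+z. ennreal (freq k ^ CARD('n) * b k z powr r) \<partial>lborel) \<le>
        (\<integral>\<^sup>+z. ennreal (2 powr r) * (?c * (\<integral>\<^sup>+y. ?h z y \<partial>S)) \<partial>lborel)"
    proof (intro nn_integral_mono)
      fix z
      have "ennreal (b k z powr r) \<le> ennreal (2 powr r) * (\<integral>\<^sup>+y. ?h z y \<partial>S)"
        using b_powr_le[of k z] by (simp add: \<psi>_def indicator_def mem_box_at)
      then have "?c * ennreal (b k z powr r) \<le> ?c * (ennreal (2 powr r) * (\<integral>\<^sup>+y. ?h z y \<partial>S))"
        by (intro mult_left_mono) auto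
      then show "ennreal (freq k ^ CARD('n) * b k z powr r) \<le> ennreal (2 powr r) * (?c * (\<integral>\<^sup>+y. ?h z y \<partial>S))"
        by (simp add: ennreal_mult mult.left_commute)
    qed
    also have "\<dots> = (\<integral>\<^sup>+z. ennreal (2 powr r) * (\<integral>\<^sup>+y. ?c * ?h z y \<partial>S) \<partial>lborel)"
      unfolding \<psi>_def by (intro nn_integral_cong arg_cong2[where f = "(*)"] refl nn_integral_cmult[symmetric]) measurable
    also have "\<dots> = ennreal (2 powr r) * (\<integral>\<^sup>+z. (\<integral>\<^sup>+y. ?c * ?h z y \<partial>S) \<partial>lborel)"
      unfolding \<psi>_def by (intro nn_integral_cmult) measurable
    also have "(\<integral>\<^sup>+z. (\<integral>\<^sup>+y. ?c * ?h z y \<partial>S) \<partial>lborel) = (\<integral>\<^sup>+y. (\<integral>\<^sup>+z. ?c * ?h z y \<partial>lborel) \<partial>S)"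
      unfolding \<psi>_def by (intro Fubini'[symmetric]) measurable
    also have "\<dots> = (\<integral>\<^sup>+y. (\<integral>\<^sup>+u. ?T k y u \<partial>lborel) \<partial>S)"
    proof (rule nn_integral_cong)
      fix y
      have "(\<integral>\<^sup>+z. ?c * ?h z y \<partial>lborel) = (\<integral>\<^sup>+u. ?h (y + (1 / freq k) *\<^sub>R u) y \<partial>lborel)"
        unfolding \<psi>_def by (intro nn_integral_lborel_rescale) measurable
      also have "\<dots> = (\<integral>\<^sup>+u. ?T k y u \<partial>lborel)"
      proof (intro nn_integral_cong)
        fix u
        have "y \<in> box_at k (y + (1 / freq k) *\<^sub>R u) \<longleftrightarrow> u \<in> box_at 0 0"
          using freq_nonneg[of k]
          by (simp add: mem_box_at freq_def[of 0] abs_mult divide_le_cancel not_less del: freq_nonneg)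
        then show "?h (y + (1 / freq k) *\<^sub>R u) y =
            ?T k y u"
          by (simp add: indicator_def mem_box_at)
      qed
      finally show "(\<integral>\<^sup>+z. ?c * ?h z y \<partial>lborel) =
          (\<integral>\<^sup>+u. ?T k y u \<partial>lborel)" .
    qed
    finally show ?thesis .
  qed
  then have "(\<Sum>k\<in>I. \<integral>\<^sup>+z. ennreal (freq k ^ CARD('n) * b k z powr r) \<partial>lborel) \<le>
      (\<Sum>k\<in>I. ennreal (2 powr r) * (\<integral>\<^sup>+y. (\<integral>\<^sup>+u. ?T k y u \<partial>lborel) \<partial>S))"
    by (rule sum_mono)
  also have "\<dots> = ennreal (2 powr r) * (\<integral>\<^sup>+y. (\<integral>\<^sup>+u. (\<Sum>k\<in>I. ?T k y u) \<partial>lborel) \<partial>S)"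
  proof -
    have T_meas [measurable]: "(\<lambda>(y, u). ?T k y u) \<in> borel_measurable (S \<Otimes>\<^sub>M lborel)" for k
      unfolding \<psi>_def by measurable
    have "(\<lambda>y. \<integral>\<^sup>+u. ?T k y u \<partial>lborel) \<in> borel_measurable S" for k
      using lborel.borel_measurable_nn_integral[OF T_meas[of k]] by simp
    then have "(\<Sum>k\<in>I. \<integral>\<^sup>+y. (\<integral>\<^sup>+u. ?T k y u \<partial>lborel) \<partial>S) = (\<integral>\<^sup>+y. (\<Sum>k\<in>I. \<integral>\<^sup>+u. ?T k y u \<partial>lborel) \<partial>S)"
      by (intro nn_integral_sum[symmetric])
    also have "\<dots> = (\<integral>\<^sup>+y. (\<integral>\<^sup>+u. (\<Sum>k\<in>I. ?T k y u) \<partial>lborel) \<partial>S)"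
    proof (rule nn_integral_cong)
      fix y
      have "(\<lambda>u. ?T k y u) \<in> borel_measurable lborel" for k
        unfolding \<psi>_def by measurable
      then show "(\<Sum>k\<in>I. \<integral>\<^sup>+u. ?T k y u \<partial>lborel) = (\<integral>\<^sup>+u. (\<Sum>k\<in>I. ?T k y u) \<partial>lborel)"
        by (intro nn_integral_sum[symmetric])
    qed
    finally show ?thesis
      by (simp only: sum_distrib_left[symmetric])
  qed
  also have "\<dots> \<le> ennreal (2 powr r) * (\<integral>\<^sup>+y. ennreal (6 ^ CARD('n) * K) * ennreal (g y powr p) \<partial>S)"
  proof (intro mult_left_mono nn_integral_mono)
    fix y
    have "(\<Sum>k\<in>I. ?T k y u) \<le>
        ennreal (K * g y powr p) * indicator (box_at 0 0) u" for u
    proof (cases "u \<in> box_at 0 0 \<and> g y \<noteq> 0")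
      case True
      then have gy: "0 < g y" using g_nonneg[of y] by linarith
      have u: "\<bar>u $ i\<bar> \<le> 3" for i
        using True by (simp add: mem_box_at freq_def[of 0])
      have "(\<Sum>k\<in>I. \<psi> (g y) k (y + (1 / freq k) *\<^sub>R u)) \<le> K * g y powr (p - 1)"
        unfolding \<psi>_def K_def
        using mass_pos d p pr gy I by (intro sum_min_powr_le reverse_doubling_chain[OF S rd] u) auto
      then have "g y * (\<Sum>k\<in>I. \<psi> (g y) k (y + (1 / freq k) *\<^sub>R u)) \<le> g y * (K * g y powr (p - 1))"
        using gy by (intro mult_left_mono) auto
      also have "\<dots> = K * g y powr p"
        using gy by (simp add: powr_mult_base mult.left_commute[of "g y"])
      finally show ?thesis
        using True gy by (simp add: sum_distrib_left \<psi>_nonneg ennreal_leI)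
    qed auto
    then have "(\<integral>\<^sup>+u. (\<Sum>k\<in>I. ?T k y u) \<partial>lborel) \<le>
        (\<integral>\<^sup>+u. ennreal (K * g y powr p) * indicator (box_at 0 (0 :: real^'n)) u \<partial>lborel)"
      by (rule nn_integral_mono)
    also have "\<dots> = ennreal (K * g y powr p) * ennreal (6 ^ CARD('n))"
      by (subst nn_integral_cmult_indicator) (auto simp: box_at_def emeasure_lborel_cube freq_def)
    also have "\<dots> = ennreal (6 ^ CARD('n) * K) * ennreal (g y powr p)"
      using K by (simp add: mult_ac flip: ennreal_mult)
    finally show "(\<integral>\<^sup>+u. (\<Sum>k\<in>I. ?T k y u) \<partial>lborel) \<le>
        ennreal (6 ^ CARD('n) * K) * ennreal (g y powr p)" .
  qed simp
  also have "\<dots> = ennreal (2 powr r) * (ennreal (6 ^ CARD('n) * K) * (\<integral>\<^sup>+y. ennreal (g y powr p) \<partial>S))"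
    by (simp add: nn_integral_cmult)
  also have "\<dots> \<le> ennreal (2 powr r) * (ennreal (6 ^ CARD('n) * K) * 1)"
    using norm by (intro mult_left_mono) auto
  also have "\<dots> = ennreal (2 powr r * 6 ^ CARD('n) * K)"
    using K by (simp add: mult.assoc flip: ennreal_mult)
  finally show ?thesis by (simp add: K_def)
qed

end

subsection \<open>The testing condition\<close>

text \<open>Local integrability of an \<open>L^p\<close> function follows from the pointwise bound
  \<open>g \<le> 1 + g powr p\<close>.\<close>

lemma radon_density:
  fixes g :: "real^'n \<Rightarrow> real"
  assumes S: "radon S" and g [measurable]: "g \<in> borel_measurable borel"
    and g_nonneg: "\<And>x. 0 \<le> g x" and p: "1 \<le> p"
    and fin: "(\<integral>\<^sup>+x. ennreal (g x powr p) \<partial>S) < \<infinity>"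
  shows "radon (rdensity S g)"
proof -
  note [measurable_cong] = radon_sets[OF S]
  have le: "g x \<le> 1 + g x powr p" for x
  proof (cases "g x \<le> 1")
    case True
    then show ?thesis by (smt (verit) powr_ge_zero)
  next
    case False
    then have "g x powr 1 \<le> g x powr p" using p by (intro powr_mono) auto
    then show ?thesis using False by simp
  qed
  have "emeasure (rdensity S g) (cbox a b) < \<infinity>" for a b
  proof -
    have "emeasure (rdensity S g) (cbox a b) = (\<integral>\<^sup>+x\<in>cbox a b. ennreal (g x) \<partial>S)"
      by (rule emeasure_density) measurable
    also have "\<dots> \<le> (\<integral>\<^sup>+x. indicator (cbox a b) x + ennreal (g x powr p) \<partial>S)"
    proof (rule nn_integral_mono)
      fix x
      have "ennreal (g x) \<le> 1 + ennreal (g x powr p)"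
        using le[of x] by (simp add: ennreal_leI flip: ennreal_plus ennreal_1)
      then show "ennreal (g x) * indicator (cbox a b) x \<le> indicator (cbox a b) x + ennreal (g x powr p)"
        by (auto simp: indicator_def)
    qed
    also have "\<dots> = emeasure S (cbox a b) + (\<integral>\<^sup>+x. ennreal (g x powr p) \<partial>S)"
      by (subst nn_integral_add) auto
    also have "\<dots> < \<infinity>"
      using fin S by (simp add: radon_def)
    finally show ?thesis .
  qed
  then show ?thesis
    by (simp add: radon_def radon_sets[OF S])
qed

lemma nbhd_subset_box_at: "nbhd k z \<subseteq> box_at k z"
proof
  fix y assume "y \<in> nbhd k z"
  then have "near_cell k z y" by (simp add: nbhd_def)
  then have "\<bar>z $ i - y $ i\<bar> \<le> 2 / freq k" for i by (rule near_cellD)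
  moreover have "2 / freq k \<le> 3 / freq k" by (simp add: divide_right_mono)
  ultimately show "y \<in> box_at k z"
    unfolding mem_box_at by (meson order_trans)
qed

lemma cell_subset_box_at: "cell k z \<subseteq> box_at k z"
  using nbhd_subset_box_at[of k z] by (force simp: cell_def nbhd_def same_cell_def near_cell_def)

lemma measure_mono_box_at:
  "radon M \<Longrightarrow> E \<subseteq> box_at k z \<Longrightarrow> measure M E \<le> measure M (box_at k z)"
  unfolding measure_def
  using emeasure_box_at_finite[of M k z] radon_sets[of M]
  by (intro enn2real_mono emeasure_mono) auto

text \<open>The testing expression with all powers of the volume collected: \<open>p\<close>
  cancels, and \<open>1 - 1 / P i\<close> is the reciprocal of the conjugate exponent.\<close>

abbreviation testing_value ::
  "real \<Rightarrow> real \<Rightarrow> ('m::finite \<Rightarrow> real) \<Rightarrow> (real^'n) measure \<Rightarrow> ('m \<Rightarrow> (real^'n) measure) \<Rightarrow>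
    real^'n \<Rightarrow> real \<Rightarrow> real" where
  "testing_value \<alpha> q P V S a l \<equiv>
    l powr (\<alpha> - real CARD('m) * real CARD('n)) * measure V (cube a l) powr (1 / q) *
      (\<Prod>i\<in>UNIV. measure (S i) (cube a l) powr (1 - 1 / P i))"

text \<open>The testing condition on the box of side \<open>6 / freq k\<close> absorbs all masses
  and leaves the product of the normalised averages \<open>b i\<close>; the 6 in the constant is
  this side. Since the weights \<open>p / P i\<close> sum to 1, the \<open>q\<close>-th power of
  that product is at most the sum of the \<open>b i powr (q * P i / p)\<close>, and each function
  can then be treated separately.\<close>

lemma avg_term_powr_mass_le:
  fixes V :: "(real^'n) measure" and \<Phi> S :: "'m::finite \<Rightarrow> (real^'n) measure" and P :: "'m \<Rightarrow> real"
  assumes V: "radon V" and \<Phi>: "\<And>i. radon (\<Phi> i)"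
    and S_pos: "\<And>i. 0 < measure (S i) (box_at k z)"
    and P: "\<And>i. 1 < P i" and p: "0 < p" "1 / p = (\<Sum>i\<in>UNIV. 1 / P i)" and q: "0 < q"
    and test: "\<And>a l. 0 < l \<Longrightarrow> testing_value \<alpha> q P V S a l \<le> A"
  defines "b \<equiv> \<lambda>i. measure (\<Phi> i) (box_at k z) * measure (S i) (box_at k z) powr (- (1 - 1 / P i))"
  shows "avg_term \<alpha> \<Phi> k z powr q * measure V (cell k z) \<le>
    (6 powr (real CARD('m) * real CARD('n) - \<alpha>) * A) powr q * (\<Sum>i\<in>UNIV. b i powr (q * P i / p))"
proof -
  define e where "e = real CARD('m) * real CARD('n) - \<alpha>"
  define l where "l = 6 / freq k"
  have l: "0 < l" by (simp add: l_def)
  let ?B = "box_at k z"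
  let ?s = "\<lambda>i. measure (S i) ?B"
  let ?v = "measure V ?B"
  have b_nonneg: "0 \<le> b i" for i by (simp add: b_def)
  have \<Phi>_eq: "measure (\<Phi> i) ?B = b i * ?s i powr (1 - 1 / P i)" for i
  proof -
    have "?s i powr (- (1 - 1 / P i)) * ?s i powr (1 - 1 / P i) = 1"
      using S_pos[of i] by (simp flip: powr_add)
    then show ?thesis by (simp add: b_def mult.assoc)
  qed
  define X where "X = freq k powr e * (\<Prod>i\<in>UNIV. measure (\<Phi> i) ?B) * ?v powr (1 / q)"
  have "avg_term \<alpha> \<Phi> k z \<le> freq k powr e * (\<Prod>i\<in>UNIV. measure (\<Phi> i) ?B)"
    unfolding avg_term_def e_def
    by (intro mult_left_mono prod_mono) (auto intro: measure_mono_box_at[OF \<Phi> nbhd_subset_box_at])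
  then have "avg_term \<alpha> \<Phi> k z powr q * measure V (cell k z) \<le>
      (freq k powr e * (\<Prod>i\<in>UNIV. measure (\<Phi> i) ?B)) powr q * ?v"
    using q by (intro mult_mono powr_mono2 measure_mono_box_at[OF V cell_subset_box_at]) auto
  also have "\<dots> = X powr q"
    using q by (simp add: X_def powr_mult[of _ "?v powr (1 / q)"] powr_powr)
  also have "\<dots> \<le> (6 powr e * A * (\<Prod>i\<in>UNIV. b i)) powr q"
  proof (rule powr_mono2)
    have "freq k powr e = 6 powr e * l powr (- e)"
      by (simp add: l_def powr_divide powr_minus_divide)
    then have "X = 6 powr e * (l powr (- e) * ?v powr (1 / q) * (\<Prod>i\<in>UNIV. ?s i powr (1 - 1 / P i))) * (\<Prod>i\<in>UNIV. b i)"
      by (simp add: X_def \<Phi>_eq prod.distrib mult_ac)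
    also have "\<dots> \<le> 6 powr e * A * (\<Prod>i\<in>UNIV. b i)"
      using test[OF l, of "z - vec (3 / freq k)"] b_nonneg
      by (intro mult_right_mono mult_left_mono prod_nonneg) (auto simp: box_at_def e_def l_def)
    finally show "X \<le> 6 powr e * A * (\<Prod>i\<in>UNIV. b i)" .
    show "0 \<le> X" by (simp add: X_def prod_nonneg)
  qed (use q in simp)
  also have "\<dots> = (6 powr e * A) powr q * (\<Prod>i\<in>UNIV. b i) powr q"
    by (rule powr_mult)
  also have "(\<Prod>i\<in>UNIV. b i) powr q = (\<Prod>i\<in>UNIV. (b i powr (q * P i / p)) powr (p / P i))"
  proof -
    have "q * P i / p * (p / P i) = q" for i
      using P[of i] p(1) by (simp add: field_simps)
    then show ?thesis by (simp only: prod_powr_distrib powr_powr)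
  qed
  also have "\<dots> \<le> (\<Sum>i\<in>UNIV. b i powr (q * P i / p))"
  proof (rule prod_powr_le_sum)
    show "(\<Sum>i\<in>UNIV. p / P i) = 1"
    proof -
      have "(\<Sum>i\<in>UNIV. p / P i) = p * (\<Sum>i\<in>UNIV. 1 / P i)"
        by (simp add: sum_distrib_left)
      then show ?thesis using p(1) by (simp flip: p(2))
    qed
    show "0 < p / P i" for i using p(1) P[of i] by simp
  qed auto
  then have "(6 powr e * A) powr q * (\<Prod>i\<in>UNIV. (b i powr (q * P i / p)) powr (p / P i)) \<le>
      (6 powr e * A) powr q * (\<Sum>i\<in>UNIV. b i powr (q * P i / p))"
    by (intro mult_left_mono) auto
  finally show ?thesis by (simp add: e_def)
qed

lemma measure_density_scale:
  fixes g :: "real^'n \<Rightarrow> real"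
  assumes S: "radon S" and [measurable]: "g \<in> borel_measurable borel" "E \<in> sets borel"
    and g: "\<And>x. 0 \<le> g x" and c: "0 \<le> c"
  shows "measure (density S (\<lambda>x. ennreal (c * g x))) E = c * measure (rdensity S g) E"
proof -
  note [measurable_cong] = radon_sets[OF S]
  have "emeasure (density S (\<lambda>x. ennreal (c * g x))) E = ennreal c * emeasure (rdensity S g) E"
  proof -
    have "emeasure (density S (\<lambda>x. ennreal (c * g x))) E = (\<integral>\<^sup>+x\<in>E. ennreal (c * g x) \<partial>S)"
      by (rule emeasure_density) measurable
    also have "\<dots> = (\<integral>\<^sup>+x. ennreal c * (ennreal (g x) * indicator E x) \<partial>S)"
      using c g by (simp add: ennreal_mult mult.assoc)
    also have "\<dots> = ennreal c * (\<integral>\<^sup>+x\<in>E. ennreal (g x) \<partial>S)"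
      by (rule nn_integral_cmult) measurable
    also have "(\<integral>\<^sup>+x\<in>E. ennreal (g x) \<partial>S) = emeasure (rdensity S g) E"
      by (rule emeasure_density[symmetric]) measurable
    finally show ?thesis .
  qed
  then show ?thesis using c by (simp add: measure_def enn2real_mult)
qed

context
  fixes V :: "(real^'n) measure" and S :: "'m::finite \<Rightarrow> (real^'n) measure" and P :: "'m \<Rightarrow> real"
    and p q \<alpha> A :: real and d :: "'m \<Rightarrow> real"
  assumes V: "radon V" and S: "\<And>i. radon (S i)"
    and S_pos: "\<And>i a l. 0 < l \<Longrightarrow> 0 < emeasure (S i) (cube a l)"
    and P: "\<And>i. 1 < P i" and p: "0 < p" "1 / p = (\<Sum>i\<in>UNIV. 1 / P i)" and q: "p < q"
    and rd: "\<And>i. 1 < d i" "\<And>i. reverse_doubling_measure (d i) (S i)"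
    and test: "\<And>a l. 0 < l \<Longrightarrow> testing_value \<alpha> q P V S a l \<le> A"
begin

lemma sum_nn_integral_avg_term_le:
  shows "\<exists>D\<ge>0. \<forall>g I. finite I \<longrightarrow> (\<forall>i. g i \<in> borel_measurable borel \<and> (\<forall>x. 0 \<le> g i x) \<and>
      (\<integral>\<^sup>+x. ennreal (g i x powr P i) \<partial>S i) \<le> 1) \<longrightarrow>
    (\<Sum>k\<in>I. \<integral>\<^sup>+x. ennreal (avg_term \<alpha> (\<lambda>i. rdensity (S i) (g i)) k x powr q) \<partial>V) \<le> ennreal D"
proof -
  define c where "c = (6 powr (real CARD('m) * real CARD('n) - \<alpha>) * A) powr q"
  define r where "r i = q * P i / p" for i
  have q0: "0 < q" using p q by linarith
  \<comment> \<open>This is where \<open>p < q\<close> is used: it provides the strict gap of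
    exponents required by the embedding.\<close>
  have r: "P i < r i" for i
    using P[of i] p(1) q by (simp add: r_def field_simps)
  define E where "E i = 2 powr r i * 6 ^ CARD('n) *
      (1 / (1 - d i powr (- ((r i - P i) / P i))) + 1 / (1 - d i powr (- (1 - 1 / P i))))" for i
  define D where "D = c * (\<Sum>i\<in>UNIV. \<bar>E i\<bar>)"
  show ?thesis
  proof (intro exI[of _ D] conjI allI impI)
    show "0 \<le> D" by (simp add: D_def c_def sum_nonneg)
    fix g :: "'m \<Rightarrow> real^'n \<Rightarrow> real" and I :: "int set"
    assume I: "finite I"
    assume g: "\<forall>i. g i \<in> borel_measurable borel \<and> (\<forall>x. 0 \<le> g i x) \<and>
      (\<integral>\<^sup>+x. ennreal (g i x powr P i) \<partial>S i) \<le> 1"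
    define \<Phi> where "\<Phi> i = rdensity (S i) (g i)" for i
    have \<Phi>: "radon (\<Phi> i)" for i
    proof -
      have "(\<integral>\<^sup>+x. ennreal (g i x powr P i) \<partial>S i) < \<infinity>"
        using g by (metis ennreal_one_less_top infinity_ennreal_def le_less_trans)
      then show ?thesis
        unfolding \<Phi>_def using g P[of i]
        by (intro radon_density[where p = "P i"] S) auto
    qed
    define b where "b i k z = measure (\<Phi> i) (box_at k z) * measure (S i) (box_at k z) powr (- (1 - 1 / P i))" for i k z
    let ?b = "\<lambda>k i z. freq k ^ CARD('n) * b i k z powr r i"
    let ?I = "\<lambda>k i. \<integral>\<^sup>+z. ennreal (?b k i z) \<partial>lborel"
    have b_meas [measurable]: "b i k \<in> borel_measurable borel" for i k
      unfolding b_def[abs_def]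
      using borel_measurable_measure_box_at[OF \<Phi>[of i]] borel_measurable_measure_box_at[OF S[of i]]
      by measurable
    have meas [measurable]: "avg_term \<alpha> \<Phi> k \<in> borel_measurable borel" for k
      by (rule borel_measurable_avg_term[OF \<Phi>])
    have s_pos: "0 < measure (S i) (box_at k z)" for i k z
      using S_pos[of "6 / freq k" i "z - vec (3 / freq k)"]
      by (simp add: box_at_def[symmetric] emeasure_eq_measure_box_at[OF S])
    have step: "(\<integral>\<^sup>+x. ennreal (avg_term \<alpha> \<Phi> k x powr q) \<partial>V) \<le>
        (\<Sum>i\<in>UNIV. ennreal c * ?I k i)" for k
    proof -
      have "(\<integral>\<^sup>+x. ennreal (avg_term \<alpha> \<Phi> k x powr q) \<partial>V) =
          (\<integral>\<^sup>+z. ennreal (freq k ^ CARD('n)) * ennreal (avg_term \<alpha> \<Phi> k z powr q) * emeasure V (cell k z) \<partial>lborel)"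
        using nn_integral_cells[OF V, of "\<lambda>x. ennreal (avg_term \<alpha> \<Phi> k x powr q)" k UNIV]
        by (simp add: avg_term_cong)
      also have "\<dots> \<le> (\<integral>\<^sup>+z. (\<Sum>i\<in>UNIV. ennreal c * ennreal (?b k i z)) \<partial>lborel)"
      proof (rule nn_integral_mono)
        fix z
        have fin: "emeasure V (cell k z) = ennreal (measure V (cell k z))"
        proof (rule emeasure_eq_ennreal_measure)
          have "emeasure V (cell k z) \<le> emeasure V (box_at k z)"
            using radon_sets[OF V] by (intro emeasure_mono cell_subset_box_at) auto
          then show "emeasure V (cell k z) \<noteq> top"
            using emeasure_box_at_finite[OF V, of k z] by (auto simp: top_unique)
        qed
        have "avg_term \<alpha> \<Phi> k z powr q * measure V (cell k z) \<le> c * (\<Sum>i\<in>UNIV. b i k z powr r i)"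
          unfolding c_def b_def r_def
          by (rule avg_term_powr_mass_le[OF V \<Phi> s_pos P p q0 test])
        then have "freq k ^ CARD('n) * (avg_term \<alpha> \<Phi> k z powr q * measure V (cell k z)) \<le>
            freq k ^ CARD('n) * (c * (\<Sum>i\<in>UNIV. b i k z powr r i))"
          by (rule mult_left_mono) simp
        also have "\<dots> = (\<Sum>i\<in>UNIV. c * (?b k i z))"
          by (simp add: sum_distrib_left mult_ac)
        finally have "ennreal (freq k ^ CARD('n) * (avg_term \<alpha> \<Phi> k z powr q * measure V (cell k z))) \<le>
            ennreal (\<Sum>i\<in>UNIV. c * (?b k i z))"
          by (rule ennreal_leI)
        also have "\<dots> = (\<Sum>i\<in>UNIV. ennreal (c * (?b k i z)))"
          by (rule sum_ennreal[symmetric]) (simp add: c_def)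
        also have "\<dots> = (\<Sum>i\<in>UNIV. ennreal c * ennreal (?b k i z))"
          by (intro sum.cong refl ennreal_mult) (auto simp: c_def)
        finally show "ennreal (freq k ^ CARD('n)) * ennreal (avg_term \<alpha> \<Phi> k z powr q) * emeasure V (cell k z) \<le>
            (\<Sum>i\<in>UNIV. ennreal c * ennreal (?b k i z))"
          unfolding fin by (simp add: ennreal_mult mult.assoc del: sum_ennreal)
      qed
      also have "\<dots> = (\<Sum>i\<in>UNIV. ennreal c * ?I k i)"
        by (subst nn_integral_sum) (auto intro!: sum.cong nn_integral_cmult)
      finally show ?thesis .
    qed
    have "(\<Sum>k\<in>I. \<integral>\<^sup>+x. ennreal (avg_term \<alpha> \<Phi> k x powr q) \<partial>V) \<le>
        (\<Sum>k\<in>I. \<Sum>i\<in>UNIV. ennreal c * ?I k i)"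
      by (rule sum_mono) (rule step)
    also have "\<dots> = (\<Sum>i\<in>UNIV. ennreal c * (\<Sum>k\<in>I. ?I k i))"
      by (subst sum.swap) (simp only: sum_distrib_left)
    also have "\<dots> \<le> (\<Sum>i\<in>UNIV. ennreal c * ennreal \<bar>E i\<bar>)"
    proof (intro sum_mono mult_left_mono)
      fix i
      have "(\<Sum>k\<in>I. ?I k i) \<le> ennreal (E i)"
        unfolding E_def b_def \<Phi>_def
        using g by (intro sum_nn_integral_averages_le S S_pos P r rd I) auto
      also have "\<dots> \<le> ennreal \<bar>E i\<bar>" by (rule ennreal_leI) simp
      finally show "(\<Sum>k\<in>I. ?I k i) \<le> ennreal \<bar>E i\<bar>" .
    qed simp
    also have "\<dots> = ennreal D"
      by (simp add: D_def c_def sum_nonneg ennreal_mult sum_distrib_left[symmetric])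
    finally show "(\<Sum>k\<in>I. \<integral>\<^sup>+x. ennreal (avg_term \<alpha> (\<lambda>i. rdensity (S i) (g i)) k x powr q) \<partial>V) \<le> ennreal D"
      by (simp add: \<Phi>_def[abs_def])
  qed
qed

text \<open>Homogeneity reduces to functions of norm at most 1. The numbers \<open>X i\<close> are
  arbitrary positive bounds of the norms, so that the division is possible even for a vanishing
  function.\<close>

lemma nn_integral_avg_sum_powr_bound:
  assumes \<alpha>: "0 < \<alpha>" and C: "comparable_on_cubes C V" "0 < C"
  shows "\<exists>D\<ge>0. \<forall>g X a b. (\<forall>i. g i \<in> borel_measurable borel \<and> (\<forall>x. 0 \<le> g i x) \<and> 0 < X i \<and>
      (\<integral>\<^sup>+x. ennreal (g i x powr P i) \<partial>S i) \<le> ennreal (X i powr P i)) \<longrightarrow>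
    (\<integral>\<^sup>+x. ennreal ((\<Sum>k=a..b. avg_term \<alpha> (\<lambda>i. rdensity (S i) (g i)) k x) powr q) \<partial>V) \<le>
      ennreal (D * (\<Prod>i\<in>UNIV. X i) powr q)"
proof -
  have q0: "0 < q" using p q by linarith
  obtain D1 where D1: "0 < D1" and D1_le: "\<And>(\<Phi> :: 'm \<Rightarrow> (real^'n) measure) a b. (\<And>i. radon (\<Phi> i)) \<Longrightarrow>
    (\<integral>\<^sup>+x. ennreal ((\<Sum>k=a..b. avg_term \<alpha> \<Phi> k x) powr q) \<partial>V) \<le>
      ennreal D1 * (\<Sum>k=a..b. \<integral>\<^sup>+x. ennreal (avg_term \<alpha> \<Phi> k x powr q) \<partial>V)"
    using nn_integral_avg_sum_powr_le[OF \<alpha> V C q0, where 'm = 'm] by blast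
  obtain D2 where D2: "0 \<le> D2" and D2_le: "\<And>g I. finite I \<Longrightarrow> (\<And>i. g i \<in> borel_measurable borel \<and> (\<forall>x. 0 \<le> g i x) \<and>
      (\<integral>\<^sup>+x. ennreal (g i x powr P i) \<partial>S i) \<le> 1) \<Longrightarrow>
    (\<Sum>k\<in>I. \<integral>\<^sup>+x. ennreal (avg_term \<alpha> (\<lambda>i. rdensity (S i) (g i)) k x powr q) \<partial>V) \<le> ennreal D2"
    using sum_nn_integral_avg_term_le by blast
  show ?thesis
  proof (intro exI[of _ "D1 * D2"] conjI allI impI)
    show "0 \<le> D1 * D2" using D1 D2 by simp
    fix g :: "'m \<Rightarrow> real^'n \<Rightarrow> real" and X :: "'m \<Rightarrow> real" and a b :: int
    assume g: "\<forall>i. g i \<in> borel_measurable borel \<and> (\<forall>x. 0 \<le> g i x) \<and> 0 < X i \<and>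
      (\<integral>\<^sup>+x. ennreal (g i x powr P i) \<partial>S i) \<le> ennreal (X i powr P i)"
    note [measurable_cong] = radon_sets[OF S] radon_sets[OF V]
    have g_meas [measurable]: "g i \<in> borel_measurable borel" for i using g by simp
    have X: "0 < X i" for i using g by simp
    define h where "h i x = g i x / X i" for i x
    have h: "h i \<in> borel_measurable borel \<and> (\<forall>x. 0 \<le> h i x) \<and> (\<integral>\<^sup>+x. ennreal (h i x powr P i) \<partial>S i) \<le> 1" for i
    proof (intro conjI allI)
      show "h i \<in> borel_measurable borel" unfolding h_def[abs_def] by measurable
      show "0 \<le> h i x" for x using g X[of i] by (simp add: h_def divide_nonneg_pos)
      have "(\<integral>\<^sup>+x. ennreal (h i x powr P i) \<partial>S i) = (\<integral>\<^sup>+x. ennreal (1 / X i powr P i) * ennreal (g i x powr P i) \<partial>S i)"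
        by (simp add: h_def powr_divide flip: ennreal_mult)
      also have "\<dots> = ennreal (1 / X i powr P i) * (\<integral>\<^sup>+x. ennreal (g i x powr P i) \<partial>S i)"
        by (intro nn_integral_cmult) measurable
      also have "\<dots> \<le> ennreal (1 / X i powr P i) * ennreal (X i powr P i)"
        using g by (intro mult_left_mono) auto
      also have "\<dots> = 1" using X[of i] by (simp flip: ennreal_mult)
      finally show "(\<integral>\<^sup>+x. ennreal (h i x powr P i) \<partial>S i) \<le> 1" .
    qed
    define \<Psi> where "\<Psi> i = rdensity (S i) (h i)" for i
    have \<Psi>: "radon (\<Psi> i)" for i
    proof -
      have "(\<integral>\<^sup>+x. ennreal (h i x powr P i) \<partial>S i) < \<infinity>"
        using h[of i] by (metis ennreal_one_less_top infinity_ennreal_def le_less_trans)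
      then show ?thesis
        unfolding \<Psi>_def using h[of i] P[of i]
        by (intro radon_density[where p = "P i"] S) auto
    qed
    let ?X = "\<Prod>i\<in>UNIV. X i"
    have X_pos: "0 < ?X" using X by (simp add: prod_pos)
    have scale: "avg_term \<alpha> (\<lambda>i. rdensity (S i) (g i)) k x = ?X * avg_term \<alpha> \<Psi> k x" for k x
    proof -
      have "measure (rdensity (S i) (g i)) (nbhd k x) = X i * measure (\<Psi> i) (nbhd k x)" for i
      proof -
        have "(\<lambda>x. ennreal (g i x)) = (\<lambda>x. ennreal (X i * h i x))"
          using X[of i] by (simp add: h_def)
        then show ?thesis
          unfolding \<Psi>_def using h[of i] X[of i]
          by (simp only:) (intro measure_density_scale S, auto)
      qed
      then show ?thesis by (simp add: avg_term_def prod.distrib)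
    qed
    have meas [measurable]: "avg_term \<alpha> \<Psi> k \<in> borel_measurable borel" for k
      by (rule borel_measurable_avg_term[OF \<Psi>])
    have "(\<integral>\<^sup>+x. ennreal ((\<Sum>k=a..b. avg_term \<alpha> (\<lambda>i. rdensity (S i) (g i)) k x) powr q) \<partial>V) =
        (\<integral>\<^sup>+x. ennreal (?X powr q) * ennreal ((\<Sum>k=a..b. avg_term \<alpha> \<Psi> k x) powr q) \<partial>V)"
      unfolding scale sum_distrib_left[symmetric] by (simp add: powr_mult flip: ennreal_mult)
    also have "\<dots> = ennreal (?X powr q) * (\<integral>\<^sup>+x. ennreal ((\<Sum>k=a..b. avg_term \<alpha> \<Psi> k x) powr q) \<partial>V)"
      by (intro nn_integral_cmult) measurable
    also have "\<dots> \<le> ennreal (?X powr q) * (ennreal D1 * ennreal D2)"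
    proof (intro mult_left_mono order_trans[OF D1_le[OF \<Psi>]])
      show "(\<Sum>k=a..b. \<integral>\<^sup>+x. ennreal (avg_term \<alpha> \<Psi> k x powr q) \<partial>V) \<le> ennreal D2"
        using D2_le[of "{a..b}" h, OF _ h] by (simp add: \<Psi>_def[abs_def])
    qed auto
    also have "\<dots> = ennreal (D1 * D2 * ?X powr q)"
      using D1 D2 by (simp add: mult.commute flip: ennreal_mult)
    finally show "(\<integral>\<^sup>+x. ennreal ((\<Sum>k=a..b. avg_term \<alpha> (\<lambda>i. rdensity (S i) (g i)) k x) powr q) \<partial>V) \<le>
      ennreal (D1 * D2 * ?X powr q)" .
  qed
qed

end

subsection \<open>The kernel of the fractional integral\<close>

lemma Basis_vec_eq_image:
  "(Basis :: ('a::euclidean_space^'m) set) = (\<lambda>(i, c). axis i c) ` (UNIV \<times> Basis)"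
  by (auto simp: Basis_vec_def)

lemma borel_measurable_vec_lambda [measurable]:
  "(\<lambda>f. \<chi> i. f i) \<in> borel_measurable (Pi\<^sub>M UNIV (\<lambda>_::'m::finite. lborel :: 'a::euclidean_space measure))"
proof (subst borel_measurable_euclidean_space, rule ballI)
  fix b :: "'a^'m" assume "b \<in> Basis"
  then obtain j c where "b = axis j c" by (auto simp: Basis_vec_def)
  then have "(\<lambda>f. (\<chi> i. f i) \<bullet> b) = (\<lambda>f. f j \<bullet> c)"
    by (simp add: inner_axis)
  moreover have "(\<lambda>f. f j \<bullet> c) \<in> borel_measurable (Pi\<^sub>M UNIV (\<lambda>_::'m. lborel :: 'a measure))"
    by measurable
  ultimately show "(\<lambda>f. (\<chi> i. f i) \<bullet> b) \<in> borel_measurable (Pi\<^sub>M UNIV (\<lambda>_::'m. lborel :: 'a measure))"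
    by simp
qed

text \<open>A box of tuples is a product of boxes, and both measures give it the product of the
  volumes. The identification makes integrals of products over tuples factor.\<close>

lemma lborel_vec_eq:
  "(lborel :: ('a::euclidean_space^'m) measure) =
    distr (Pi\<^sub>M UNIV (\<lambda>_. lborel)) borel (\<lambda>f. \<chi> i. f i)"
proof (rule lborel_eqI)
  interpret product_sigma_finite "\<lambda>_::'m. lborel :: 'a measure"
    by standard
  have inj: "inj_on (\<lambda>(i, c). axis i c) (UNIV \<times> Basis :: ('m \<times> 'a) set)"
    by (auto simp: inj_on_def axis_eq_axis nonzero_Basis)
  fix l u :: "'a^'m" assume le: "\<And>b. b \<in> Basis \<Longrightarrow> l \<bullet> b \<le> u \<bullet> b"
  have le': "l $ i \<bullet> c \<le> u $ i \<bullet> c" if "c \<in> Basis" for i c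
    using le[of "axis i c"] that by (simp add: inner_axis axis_in_Basis_iff)
  have "(\<lambda>f. \<chi> i. f i) -` box l u \<inter> space (Pi\<^sub>M UNIV (\<lambda>_. lborel)) = Pi\<^sub>E UNIV (\<lambda>i. box (l $ i) (u $ i))"
    by (auto simp: space_PiM PiE_iff box_def Basis_vec_eq_image inner_axis)
  then have "emeasure (distr (Pi\<^sub>M UNIV (\<lambda>_. lborel)) borel (\<lambda>f. \<chi> i. f i)) (box l u) =
      (\<Prod>i\<in>UNIV. emeasure lborel (box (l $ i) (u $ i)))"
    by (simp add: emeasure_distr[OF borel_measurable_vec_lambda] emeasure_PiM)
  also have "\<dots> = (\<Prod>i\<in>UNIV. ennreal (\<Prod>c\<in>Basis. (u $ i - l $ i) \<bullet> c))"
    using le' by (intro prod.cong refl emeasure_lborel_box) auto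
  also have "\<dots> = ennreal (\<Prod>i\<in>UNIV. \<Prod>c\<in>Basis. (u $ i - l $ i) \<bullet> c)"
    using le' by (intro prod_ennreal prod_nonneg) (auto simp: inner_diff_left)
  also have "(\<Prod>i\<in>UNIV. \<Prod>c\<in>Basis. (u $ i - l $ i) \<bullet> c) = (\<Prod>b\<in>Basis. (u - l) \<bullet> b)"
    unfolding Basis_vec_eq_image by (subst prod.reindex[OF inj]) (simp add: prod.cartesian_product inner_axis split_def)
  finally show "emeasure (distr (Pi\<^sub>M UNIV (\<lambda>_. lborel)) borel (\<lambda>f. \<chi> i. f i)) (box l u) =
      (\<Prod>b\<in>Basis. (u - l) \<bullet> b)" .
qed simp

lemma nn_integral_prod_vec:
  fixes f :: "'m::finite \<Rightarrow> 'a::euclidean_space \<Rightarrow> ennreal"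
  assumes f [measurable]: "\<And>i. f i \<in> borel_measurable borel"
  shows "(\<integral>\<^sup>+y. (\<Prod>i\<in>UNIV. f i (y $ i)) \<partial>lborel) = (\<Prod>i\<in>UNIV. \<integral>\<^sup>+x. f i x \<partial>lborel)"
proof -
  interpret product_sigma_finite "\<lambda>_::'m. lborel :: 'a measure"
    by standard
  have "(\<integral>\<^sup>+y. (\<Prod>i\<in>UNIV. f i (y $ i)) \<partial>lborel) =
      (\<integral>\<^sup>+x. (\<Prod>i\<in>UNIV. f i (x i)) \<partial>Pi\<^sub>M UNIV (\<lambda>_. lborel))"
    unfolding lborel_vec_eq by (subst nn_integral_distr[OF borel_measurable_vec_lambda]) simp_all
  also have "\<dots> = (\<Prod>i\<in>UNIV. \<integral>\<^sup>+x. f i x \<partial>lborel)"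
    by (rule product_nn_integral_prod) auto
  finally show ?thesis .
qed

text \<open>Changing one \<open>f i\<close> on a null set must not affect the integrand over tuples;
  the exceptional tuples are a product with one null factor.\<close>

lemma AE_lborel_vec_component:
  assumes "AE x in (lborel :: 'a::euclidean_space measure). Q x"
  shows "AE y in (lborel :: ('a^'m) measure). Q (y $ i)"
proof -
  obtain N where "{x \<in> space lborel. \<not> Q x} \<subseteq> N" "emeasure lborel N = 0" "N \<in> sets lborel"
    by (rule AE_E[OF assms])
  then have N: "{x. \<not> Q x} \<subseteq> N" "N \<in> sets borel" "emeasure lborel N = 0"
    by simp_all
  let ?f = "\<lambda>j. if j = i then indicator N else (\<lambda>_. 1) :: 'a \<Rightarrow> ennreal"
  have "(\<integral>\<^sup>+y. (\<Prod>j\<in>UNIV. ?f j (y $ j)) \<partial>(lborel :: ('a^'m) measure)) = (\<Prod>j\<in>UNIV. \<integral>\<^sup>+x. ?f j x \<partial>lborel)"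
    using N(2) by (intro nn_integral_prod_vec) auto
  \<comment> \<open>The remaining factors are infinite, but zero times infinity is zero in
    \<open>ennreal\<close>.\<close>
  also have "\<dots> = 0"
    using N by (intro prod_zero bexI[of _ i]) auto
  also have "(\<lambda>y::'a^'m. \<Prod>j\<in>UNIV. ?f j (y $ j)) = (\<lambda>y. indicator N (y $ i))"
  proof
    fix y :: "'a^'m"
    have "(\<Prod>j\<in>UNIV. ?f j (y $ j)) = (\<Prod>j\<in>UNIV. if j = i then indicator N (y $ i) else 1)"
      by (intro prod.cong) auto
    then show "(\<Prod>j\<in>UNIV. ?f j (y $ j)) = indicator N (y $ i)" by simp
  qed
  finally have "AE y in (lborel :: ('a^'m) measure). indicator N (y $ i) = (0 :: ennreal)"
    using N(2) by (subst (asm) nn_integral_0_iff_AE) auto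
  then show ?thesis
    using N(1) by (auto elim!: eventually_mono simp: indicator_def split: if_splits)
qed

text \<open>Choose \<open>k\<close> with \<open>freq k \<le> 1 / D \<le> 4 * freq k\<close>. The
  first inequality puts every \<open>y $ i\<close> into the neighbourhood, and the second costs the
  factor \<open>4 powr e\<close>.\<close>

lemma frac_kernel_le:
  fixes x :: "real^'n" and y :: "(real^'n)^'m::finite"
  defines "D \<equiv> \<Sum>i\<in>UNIV. norm (x - y $ i)"
  assumes e: "0 \<le> e" and "D \<noteq> 0"
  shows "\<exists>k. (\<forall>i. y $ i \<in> nbhd k x) \<and> 1 / D powr e \<le> 4 powr e * freq k powr e"
proof -
  have "0 \<le> D" by (simp add: D_def sum_nonneg)
  with assms have D_pos: "0 < D" by linarith
  define k where "k = \<lfloor>log 4 (1 / D)\<rfloor>"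
  have "4 powr real_of_int k \<le> 4 powr log 4 (1 / D)"
    by (simp add: k_def)
  then have k1: "freq k \<le> 1 / D" using D_pos by (simp add: freq_def)
  have "4 powr log 4 (1 / D) \<le> 4 powr (real_of_int k + 1)"
    unfolding k_def by (intro powr_mono) linarith+
  then have k2: "1 / D \<le> 4 * freq k" using D_pos by (simp add: freq_def powr_add)
  have "y $ i \<in> nbhd k x" for i
    unfolding nbhd_def mem_Collect_eq
  proof (rule near_cellI)
    fix j
    have "\<bar>x $ j - y $ i $ j\<bar> \<le> norm (x - y $ i)"
      using component_le_norm_cart[of "x - y $ i" j] by simp
    also have "\<dots> \<le> D"
      unfolding D_def by (rule member_le_sum) auto
    also have "\<dots> \<le> 1 / freq k"
      using k1 D_pos by (simp add: field_simps)
    finally show "\<bar>x $ j - y $ i $ j\<bar> \<le> 1 / freq k" .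
  qed
  moreover have "(1 / D) powr e \<le> (4 * freq k) powr e"
    using k2 D_pos e by (intro powr_mono2) auto
  ultimately show ?thesis by (auto simp: powr_divide powr_mult)
qed

text \<open>Each tuple off the diagonal point is caught by some scale, so the kernel is below a sum
  over scales of indicators of product sets, and these integrals factor. The symmetric ranges
  increase with \<open>K\<close>, which permits monotone convergence.\<close>

lemma nn_integral_frac_integrand_le:
  fixes f :: "'m::finite \<Rightarrow> real^'n \<Rightarrow> real"
  assumes f [measurable]: "\<And>i. f i \<in> borel_measurable borel"
    and \<Phi>: "\<And>i. radon (density lborel (\<lambda>y. ennreal \<bar>f i y\<bar>))"
    and \<alpha>: "\<alpha> \<le> real CARD('m) * real CARD('n)"
  defines "\<Phi> \<equiv> \<lambda>i. density lborel (\<lambda>y. ennreal \<bar>f i y\<bar>)"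
  shows "(\<integral>\<^sup>+y. ennreal \<bar>frac_integrand \<alpha> f x y\<bar> \<partial>lborel) \<le>
    ennreal (4 powr (real CARD('m) * real CARD('n) - \<alpha>)) *
      (SUP K. ennreal (\<Sum>k=-int K..int K. avg_term \<alpha> \<Phi> k x))"
proof -
  define e where "e = real CARD('m) * real CARD('n) - \<alpha>"
  have e: "0 \<le> e" using \<alpha> by (simp add: e_def)
  let ?p = "\<lambda>k y. \<Prod>i\<in>UNIV. ennreal \<bar>f i (y $ i)\<bar> * indicator (nbhd k x) (y $ i)"
  define G where "G K y = (\<Sum>k=-int K..int K. ennreal (freq k powr e) *
      ?p k y)" for K and y :: "(real^'n)^'m"
  have G_meas [measurable]: "G K \<in> borel_measurable borel" for K
    unfolding G_def[abs_def] by measurable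
  have "incseq G"
    unfolding incseq_def le_fun_def G_def
    by (intro allI impI sum_mono2) auto
  have "(\<integral>\<^sup>+y. ennreal \<bar>frac_integrand \<alpha> f x y\<bar> \<partial>lborel) \<le>
      (\<integral>\<^sup>+y. ennreal (4 powr e) * (SUP K. G K y) \<partial>lborel)"
  proof (rule nn_integral_mono)
    fix y :: "(real^'n)^'m"
    let ?F = "\<Prod>i\<in>UNIV. \<bar>f i (y $ i)\<bar>" and ?D = "\<Sum>i\<in>UNIV. norm (x - y $ i)"
    have F: "0 \<le> ?F" by (simp add: prod_nonneg)
    have frac: "\<bar>frac_integrand \<alpha> f x y\<bar> = ?F / ?D powr e"
      by (simp add: frac_integrand_def e_def abs_prod)
    show "ennreal \<bar>frac_integrand \<alpha> f x y\<bar> \<le> ennreal (4 powr e) * (SUP K. G K y)"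
    proof (cases "?D = 0")
      \<comment> \<open>Here \<open>0 powr e\<close> is 0 and division by zero gives 0, so the
        integrand vanishes at the tuple whose entries all equal \<open>x\<close>.\<close>
      case True
      show ?thesis unfolding frac True by simp
    next
      case False
      obtain k where k: "\<And>i. y $ i \<in> nbhd k x" "1 / ?D powr e \<le> 4 powr e * freq k powr e"
        using frac_kernel_le[OF e False] by blast
      have "ennreal \<bar>frac_integrand \<alpha> f x y\<bar> \<le> ennreal (4 powr e * (freq k powr e * ?F))"
        unfolding frac using mult_left_mono[OF k(2) F] by (intro ennreal_leI) (simp add: mult_ac)
      also have "\<dots> = ennreal (4 powr e) * (ennreal (freq k powr e) * ?p k y)"
        using k(1) F by (simp add: ennreal_mult prod_ennreal)
      also have "\<dots> \<le> ennreal (4 powr e) * (SUP K. G K y)"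
      proof (rule mult_left_mono)
        have "ennreal (freq k powr e) * ?p k y \<le> G (nat \<bar>k\<bar>) y"
          unfolding G_def by (rule member_le_sum) auto
        also have "\<dots> \<le> (SUP K. G K y)" by (rule SUP_upper) simp
        finally show "ennreal (freq k powr e) * ?p k y \<le> (SUP K. G K y)" .
      qed simp
      finally show ?thesis .
    qed
  qed
  also have "\<dots> = ennreal (4 powr e) * (\<integral>\<^sup>+y. (SUP K. G K y) \<partial>lborel)"
    by (rule nn_integral_cmult) measurable
  also have "(\<integral>\<^sup>+y. (SUP K. G K y) \<partial>lborel) = (SUP K. \<integral>\<^sup>+y. G K y \<partial>lborel)"
    using \<open>incseq G\<close> by (rule nn_integral_monotone_convergence_SUP) simp
  also have "(\<lambda>K. \<integral>\<^sup>+y. G K y \<partial>lborel) = (\<lambda>K. ennreal (\<Sum>k=-int K..int K. avg_term \<alpha> \<Phi> k x))"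
  proof
    fix K
    have "(\<integral>\<^sup>+y. G K y \<partial>lborel) = (\<Sum>k=-int K..int K. ennreal (freq k powr e) *
        (\<integral>\<^sup>+y. ?p k y \<partial>lborel))"
      unfolding G_def by (subst nn_integral_sum) (auto intro!: sum.cong nn_integral_cmult)
    also have "\<dots> = (\<Sum>k=-int K..int K. ennreal (avg_term \<alpha> \<Phi> k x))"
    proof (intro sum.cong refl)
      fix k
      have "(\<integral>\<^sup>+y. ?p k y \<partial>lborel) =
          (\<Prod>i\<in>UNIV. \<integral>\<^sup>+y. ennreal \<bar>f i y\<bar> * indicator (nbhd k x) y \<partial>lborel)"
        by (rule nn_integral_prod_vec) measurable
      also have "\<dots> = (\<Prod>i\<in>UNIV. emeasure (\<Phi> i) (nbhd k x))"
        unfolding \<Phi>_def by (intro prod.cong refl emeasure_density[symmetric]) measurable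
      also have "\<dots> = (\<Prod>i\<in>UNIV. ennreal (measure (\<Phi> i) (nbhd k x)))"
        unfolding \<Phi>_def by (intro prod.cong refl emeasure_eq_measure_nbhd \<Phi>)
      also have "\<dots> = ennreal (\<Prod>i\<in>UNIV. measure (\<Phi> i) (nbhd k x))"
        by (rule prod_ennreal) simp
      finally show "ennreal (freq k powr e) *
        (\<integral>\<^sup>+y. ?p k y \<partial>lborel) = ennreal (avg_term \<alpha> \<Phi> k x)"
        by (simp add: avg_term_def e_def prod_nonneg flip: ennreal_mult)
    qed
    also have "\<dots> = ennreal (\<Sum>k=-int K..int K. avg_term \<alpha> \<Phi> k x)"
      by (rule sum_ennreal) simp
    finally show "(\<integral>\<^sup>+y. G K y \<partial>lborel) = ennreal (\<Sum>k=-int K..int K. avg_term \<alpha> \<Phi> k x)" .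
  qed
  finally show ?thesis by (simp add: e_def)
qed

subsection \<open>Weights and their measures\<close>

lemma ennpowr_ennreal: "0 \<le> x \<Longrightarrow> ennpowr (ennreal x) t = ennreal (x powr t)"
  by (simp add: ennpowr_def)

lemma nn_integral_cube_pos:
  fixes h :: "real^'n \<Rightarrow> real"
  assumes [measurable]: "h \<in> borel_measurable borel" and pos: "\<And>x. 0 < h x" and "0 < l"
  shows "0 < (\<integral>\<^sup>+x\<in>cube a l. ennreal (h x) \<partial>lborel)"
proof (rule ccontr)
  assume "\<not> ?thesis"
  then have "(\<integral>\<^sup>+x\<in>cube a l. ennreal (h x) \<partial>lborel) = 0" by simp
  then have "AE x in lborel. ennreal (h x) * indicator (cube a l) x = 0"
    by (subst (asm) nn_integral_0_iff_AE) auto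
  then have "AE x in lborel. x \<notin> cube a l"
    using pos by (auto elim!: eventually_mono simp: indicator_def ennreal_eq_0_iff not_le[symmetric] split: if_splits)
  then have "emeasure lborel {x. x \<in> cube a l} = 0"
    by (subst (asm) AE_iff_measurable[OF _ refl]) auto
  moreover have "0 < l ^ CARD('n)" using assms(3) by simp
  ultimately show False
    using assms(3) by (simp add: emeasure_lborel_cube ennreal_eq_0_iff del: zero_less_power_eq)
qed

text \<open>A Borel representative that is positive everywhere, so that one may divide by it
  pointwise and pass between null sets of its density and Lebesgue null sets.\<close>

definition borel_version :: "(real^'n \<Rightarrow> real) \<Rightarrow> (real^'n \<Rightarrow> real) \<Rightarrow> bool" where
  "borel_version \<rho> \<rho>' \<longleftrightarrow> \<rho>' \<in> borel_measurable borel \<and> (\<forall>x. 0 < \<rho>' x) \<and>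
     (AE x in lborel. \<rho> x = \<rho>' x) \<and> radon (rdensity lborel \<rho>')"

lemma emeasure_rdensity_AE_eq:
  assumes "\<rho>' \<in> borel_measurable borel" and ae: "AE x in lborel. \<rho> x = \<rho>' x" and "E \<in> sets borel"
  shows "emeasure (rdensity lborel \<rho>') E = weight_mass \<rho> E"
proof -
  have "emeasure (rdensity lborel \<rho>') E = (\<integral>\<^sup>+x\<in>E. ennreal (\<rho>' x) \<partial>lborel)"
    using assms by (intro emeasure_density) auto
  also have "\<dots> = (\<integral>\<^sup>+x\<in>E. ennreal (\<rho> x) \<partial>lborel)"
    by (rule nn_integral_cong_AE) (use ae in eventually_elim, simp)
  finally show ?thesis by (simp add: weight_mass_def nn_integral_completion)
qed

lemma borel_versionD:
  assumes "borel_version \<rho> \<rho>'"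
  shows "\<rho>' \<in> borel_measurable borel" "0 < \<rho>' x" "AE x in lborel. \<rho> x = \<rho>' x" "radon (rdensity lborel \<rho>')"
    and "E \<in> sets borel \<Longrightarrow> emeasure (rdensity lborel \<rho>') E = weight_mass \<rho> E"
    and "0 < l \<Longrightarrow> 0 < emeasure (rdensity lborel \<rho>') (cube a l)"
  using assms nn_integral_cube_pos[of \<rho>' l a]
  by (auto simp: borel_version_def emeasure_rdensity_AE_eq emeasure_density)

lemma weight_imp_borel_version:
  fixes \<rho> :: "real^'n \<Rightarrow> real"
  assumes \<rho>: "weight \<rho>"
  shows "\<exists>\<rho>'. borel_version \<rho> \<rho>'"
proof -
  obtain \<rho>0 where \<rho>0: "\<rho>0 \<in> borel_measurable lborel" "AE x in lborel. \<rho> x = \<rho>0 x"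
    using \<rho> completion_ex_borel_measurable_real[of \<rho> lborel] by (auto simp: weight_def)
  \<comment> \<open>The value 1 is inserted only on a null set, since the weight is positive almost
    everywhere.\<close>
  define \<rho>' where "\<rho>' x = (if 0 < \<rho>0 x then \<rho>0 x else 1)" for x
  have meas [measurable]: "\<rho>' \<in> borel_measurable borel"
    using \<rho>0(1) unfolding \<rho>'_def[abs_def] by measurable
  have pos: "0 < \<rho>' x" for x by (simp add: \<rho>'_def)
  have "AE x in lborel. 0 < \<rho> x"
    using \<rho> by (simp add: weight_def AE_completion_iff)
  with \<rho>0(2) have ae: "AE x in lborel. \<rho> x = \<rho>' x"
    by eventually_elim (simp add: \<rho>'_def)
  let ?M = "rdensity lborel \<rho>'"
  have fin: "radon ?M"
    unfolding radon_def
  proof (intro conjI allI)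
    fix a b :: "real^'n"
    have "\<rho> absolutely_integrable_on cbox a b"
      using \<rho> by (simp add: weight_def)
    then have "integrable lebesgue (\<lambda>x. indicator (cbox a b) x *\<^sub>R \<rho> x)"
      by (simp add: set_integrable_def)
    then have "(\<integral>\<^sup>+x. ennreal (norm (indicator (cbox a b) x *\<^sub>R \<rho> x)) \<partial>lebesgue) < \<infinity>"
      by (simp add: integrable_iff_bounded)
    moreover have "weight_mass \<rho> (cbox a b) \<le> (\<integral>\<^sup>+x. ennreal (norm (indicator (cbox a b) x *\<^sub>R \<rho> x)) \<partial>lebesgue)"
      unfolding weight_mass_def
      by (intro nn_integral_mono) (auto simp: indicator_def intro!: ennreal_leI)
    ultimately show "emeasure ?M (cbox a b) < \<infinity>"
      by (simp add: emeasure_rdensity_AE_eq[OF meas ae])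
  qed simp
  show ?thesis using meas pos ae fin unfolding borel_version_def by blast
qed

lemma average_cube:
  fixes \<rho> :: "real^'n \<Rightarrow> real"
  assumes M: "radon M" "emeasure M (cube a l) = weight_mass \<rho> (cube a l)" and l: "0 < l"
  shows "average (cube a l) \<rho> = ennreal (measure M (cube a l) / l ^ CARD('n))"
proof -
  have "weight_mass \<rho> (cube a l) = ennreal (measure M (cube a l))"
    using emeasure_cube_finite[OF M(1), of a l] M(2)[symmetric]
    by (simp add: emeasure_eq_ennreal_measure less_top)
  then show ?thesis
    using l by (simp add: average_def emeasure_lborel_cube weight_mass_def divide_ennreal)
qed

lemma measure_cube_pos:
  assumes "radon M" "0 < emeasure M (cube a l)"
  shows "0 < measure M (cube a l)"
  using assms emeasure_cube_finite[OF assms(1), of a l]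
  by (simp add: measure_def enn2real_positive_iff less_top)

text \<open>For \<open>r = 1\<close> the mass of \<open>F\<close> is at least the essential infimum
  times the volume. For \<open>r > 1\<close> Hoelder's inequality is replaced by integrating
  \<open>1 \<le> t * \<rho> + (t * \<rho>) powr (- \<tau>)\<close> over \<open>F\<close>, with
  \<open>t\<close> chosen so that the dual part is small.\<close>

lemma A_class_comparable_on_cubes:
  fixes \<rho> \<rho>' :: "real^'n \<Rightarrow> real"
  assumes A: "\<rho> \<in> A_class r" "1 \<le> r"
    and version: "borel_version \<rho> \<rho>'"
  shows "\<exists>C>0. comparable_on_cubes C (rdensity lborel \<rho>')"
proof -
  note pos = borel_versionD(2)[OF version] and ae = borel_versionD(3)[OF version]
    and fin = borel_versionD(4)[OF version] and mass = borel_versionD(5)[OF version]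
    and cube_pos = borel_versionD(6)[OF version]
  note [measurable] = borel_versionD(1)[OF version]
  define M where "M = rdensity lborel \<rho>'"
  note M = fin[folded M_def]
  define H where "H Q = ennpowr (average Q \<rho>) (1 / r) *
        (if r = 1 then inverse (ess_inf_on Q \<rho>)
         else ennpowr (average Q (\<lambda>x. \<rho> x powr (1 - conjugate_exponent r))) (1 / conjugate_exponent r))" for Q
  have "(SUP Q\<in>cubes. H Q) < \<infinity>"
    using A(1) by (simp add: A_class_def H_def)
  then obtain K where K: "0 \<le> K" "(SUP Q\<in>cubes. H Q) = ennreal K"
    by (cases "SUP Q\<in>cubes. H Q") auto
  have H_le: "H (cube a l) \<le> ennreal K" if "0 < l" for a l
    unfolding K(2)[symmetric] by (rule SUP_upper) (use that in \<open>auto simp: cubes_def\<close>)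
  define C where "C = (if r = 1 then 2 * K + 1 else (4 * K) powr r + 1)"
  have C: "0 < C" using K by (simp add: C_def add_nonneg_pos)
  have "emeasure M (cube a l) \<le> ennreal C * emeasure M F"
    if l: "0 < l" and F [measurable]: "F \<in> sets borel" and sub: "F \<subseteq> cube a l"
      and half: "emeasure lborel (cube a l) \<le> 2 * emeasure lborel F" for a l F
  proof -
    let ?Q = "cube a l"
    define L where "L = l ^ CARD('n)"
    have L: "0 < L" using l by (simp add: L_def)
    have Q: "emeasure lborel ?Q = ennreal L" using l by (simp add: emeasure_lborel_cube L_def)
    have "emeasure lborel F \<le> emeasure lborel ?Q" by (rule emeasure_mono[OF sub]) simp
    then obtain f where f: "0 \<le> f" "emeasure lborel F = ennreal f"
      unfolding Q by (cases "emeasure lborel F") (auto simp: top_unique)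
    have Lf: "L \<le> 2 * f"
      using half f L unfolding Q by (simp flip: ennreal_mult ennreal_numeral)
    define mQ where "mQ = measure M ?Q"
    have mQ: "emeasure M ?Q = ennreal mQ" "0 < mQ"
      using emeasure_cube_finite[OF M, of a l] measure_cube_pos[OF M cube_pos[OF l, folded M_def], of a]
      by (auto simp: mQ_def emeasure_eq_ennreal_measure less_top)
    have "emeasure M F \<le> emeasure M ?Q"
      by (rule emeasure_mono[OF sub]) (simp add: M_def)
    then obtain mF where mF: "0 \<le> mF" "emeasure M F = ennreal mF"
      unfolding mQ by (cases "emeasure M F") (auto simp: top_unique)
    have mF_int: "ennreal mF = (\<integral>\<^sup>+x\<in>F. ennreal (\<rho>' x) \<partial>lborel)"
      unfolding mF(2)[symmetric] M_def by (rule emeasure_density) measurable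
    have avg: "average ?Q \<rho> = ennreal (mQ / L)"
      unfolding mQ_def L_def by (rule average_cube[OF M _ l]) (simp add: M_def mass)
    have avg_pos: "0 < mQ / L" using mQ L by simp
    have "mQ \<le> C * mF"
    proof (cases "r = 1")
      case True
      define e where "e = ess_inf_on ?Q \<rho>"
      have HQ: "ennreal (mQ / L) * inverse e \<le> ennreal K"
        using H_le[OF l, of a] mQ(2) L by (simp add: H_def True avg ennpowr_ennreal e_def)
      have e_le: "e \<le> ennreal (mF / f)"
        unfolding e_def ess_inf_on_def
      proof (rule Sup_least)
        fix c assume "c \<in> {c. AE x in lebesgue. x \<in> ?Q \<longrightarrow> c \<le> ennreal (\<rho> x)}"
        then have "AE x in lborel. x \<in> ?Q \<longrightarrow> c \<le> ennreal (\<rho> x)"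
          by (simp add: AE_completion_iff)
        then have "AE x in lborel. c * indicator F x \<le> ennreal (\<rho>' x) * indicator F x"
          using ae by eventually_elim (use sub in \<open>auto simp: indicator_def\<close>)
        then have "(\<integral>\<^sup>+x. c * indicator F x \<partial>lborel) \<le> (\<integral>\<^sup>+x\<in>F. ennreal (\<rho>' x) \<partial>lborel)"
          by (rule nn_integral_mono_AE)
        then have "c * ennreal f \<le> ennreal mF"
          by (simp add: nn_integral_cmult_indicator f mF_int)
        moreover have "0 < f" using Lf L by linarith
        ultimately show "c \<le> ennreal (mF / f)"
          using mF by (cases c) (auto simp: ennreal_mult_top ennreal_top_mult top_unique field_simps simp flip: ennreal_mult)
      qed
      have "e \<noteq> 0"
      proof
        assume "e = 0"
        then show False using HQ avg_pos by (simp add: ennreal_mult_top top_unique ennreal_eq_0_iff)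
      qed
      moreover have "e \<noteq> top" using e_le by (auto simp: top_unique)
      ultimately obtain e' where e': "0 < e'" "e = ennreal e'"
        by (cases e) (auto simp: ennreal_eq_0_iff order_le_less)
      have "mQ / L * (1 / e') \<le> K"
        using HQ e' avg_pos K by (simp add: inverse_ennreal ennreal_mult[symmetric] divide_inverse)
      then have "mQ \<le> K * (e' * L)"
        using e' L by (simp add: field_simps)
      also have "e' * L \<le> e' * (2 * f)" using Lf e' by (intro mult_left_mono) auto
      then have "K * (e' * L) \<le> K * (e' * (2 * f))" by (rule mult_left_mono) (rule K(1))
      also have "e' * f \<le> mF"
      proof -
        have "0 < f" using Lf L by linarith
        moreover have "e' \<le> mF / f" using e_le e' mF f by simp
        ultimately show ?thesis by (simp add: field_simps)
      qed
      then have "K * (e' * (2 * f)) \<le> 2 * K * mF"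
        using K mult_left_mono[of "e' * f" mF "2 * K"] by (simp add: mult_ac)
      also have "\<dots> \<le> C * mF" using mF by (simp add: C_def True mult_right_mono)
      finally show ?thesis .
    next
      case False
      then have r: "1 < r" using A(2) by simp
      define \<tau> where "\<tau> = 1 / (r - 1)"
      have \<tau>: "0 < \<tau>" using r by (simp add: \<tau>_def)
      have conj: "1 - conjugate_exponent r = - \<tau>" "1 / conjugate_exponent r = (r - 1) / r"
        using r by (auto simp: conjugate_exponent_def \<tau>_def field_simps)
      define J where "J = (\<integral>\<^sup>+x\<in>?Q. ennreal (\<rho>' x powr (- \<tau>)) \<partial>lborel)"
      have J_eq: "(\<integral>\<^sup>+x\<in>?Q. ennreal (\<rho> x powr (- \<tau>)) \<partial>lebesgue) = J"
        unfolding J_def nn_integral_completion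
        by (rule nn_integral_cong_AE) (use ae in eventually_elim, simp)
      have avg2: "average ?Q (\<lambda>x. \<rho> x powr (- \<tau>)) = J / ennreal L"
        using l by (simp add: average_def J_eq emeasure_lborel_cube L_def)
      have HQ: "ennreal ((mQ / L) powr (1 / r)) * ennpowr (J / ennreal L) ((r - 1) / r) \<le> ennreal K"
        using H_le[OF l, of a] avg_pos False unfolding H_def conj avg2 avg
        by (simp add: ennpowr_ennreal)
      have "J \<noteq> top"
      proof
        assume "J = top"
        then have "J / ennreal L = top" by (simp add: ennreal_top_divide)
        then have "top \<le> ennreal K"
          using HQ mQ(2) L by (simp add: ennpowr_def ennreal_mult_top ennreal_eq_0_iff not_le)
        then show False by (simp add: top_unique)
      qed
      then obtain j where j: "0 \<le> j" "J = ennreal j" by (cases J) auto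
      have "0 < J"
        unfolding J_def using less_imp_neq[OF pos] by (intro nn_integral_cube_pos l) auto
      then have j_pos: "0 < j" using j by simp
      define B where "B = j / L"
      have B: "0 < B" using j_pos L by (simp add: B_def)
      have "(mQ / L) powr (1 / r) * B powr ((r - 1) / r) \<le> K"
        using HQ j L B avg_pos K
        by (simp add: divide_ennreal ennpowr_ennreal B_def ennreal_mult[symmetric])
      then have "((mQ / L) powr (1 / r) * B powr ((r - 1) / r)) powr r \<le> K powr r"
        using r by (intro powr_mono2) auto
      then have AB: "mQ / L * B powr (r - 1) \<le> K powr r"
        using r mQ(2) L by (simp add: powr_mult powr_powr)
      \<comment> \<open>Chosen so that \<open>t powr (- \<tau>)\<close> is
        \<open>1 / (4 * B)\<close>: the dual integral over the cube then contributes
        \<open>L / 4\<close>, and since \<open>F\<close> has volume at least \<open>L / 2\<close>,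
        another \<open>L / 4\<close> remains for the mass of \<open>F\<close>.\<close>
      define t where "t = (4 * B) powr (r - 1)"
      have t: "0 < t" using B by (simp add: t_def)
      have t_pow: "t powr (- \<tau>) = 1 / (4 * B)"
        using r B by (simp add: t_def powr_powr \<tau>_def powr_minus_divide)
      have pw: "1 \<le> t * \<rho>' x + t powr (- \<tau>) * \<rho>' x powr (- \<tau>)" for x
      proof (cases "1 \<le> t * \<rho>' x")
        case True
        then show ?thesis by (smt (verit) mult_nonneg_nonneg powr_ge_zero)
      next
        case False
        have "0 < t * \<rho>' x" using t pos by simp
        then have "1 powr (- \<tau>) \<le> (t * \<rho>' x) powr (- \<tau>)"
          using False \<tau> by (intro powr_mono2') auto
        then show ?thesis using \<open>0 < t * \<rho>' x\<close> by (simp add: powr_mult)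
      qed
      have "ennreal f = (\<integral>\<^sup>+x. indicator F x \<partial>lborel)" by (simp add: f)
      also have "\<dots> \<le> (\<integral>\<^sup>+x. ennreal t * (ennreal (\<rho>' x) * indicator F x) +
          ennreal (t powr (- \<tau>)) * (ennreal (\<rho>' x powr (- \<tau>)) * indicator ?Q x) \<partial>lborel)"
      proof (rule nn_integral_mono)
        fix x
        have "1 \<le> ennreal t * ennreal (\<rho>' x) + ennreal (t powr (- \<tau>)) * ennreal (\<rho>' x powr (- \<tau>))"
          using ennreal_leI[OF pw[of x]] t pos[of x]
          by (simp add: ennreal_plus ennreal_mult less_imp_le)
        then show "indicator F x \<le> ennreal t * (ennreal (\<rho>' x) * indicator F x) +
          ennreal (t powr (- \<tau>)) * (ennreal (\<rho>' x powr (- \<tau>)) * indicator ?Q x)"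
          using sub by (auto simp: indicator_def)
      qed
      also have "\<dots> = ennreal t * ennreal mF + ennreal (t powr (- \<tau>)) * J"
        unfolding J_def mF_int by (subst nn_integral_add) (auto simp: nn_integral_cmult)
      also have "\<dots> = ennreal (t * mF + t powr (- \<tau>) * j)"
        using t mF j by (simp add: ennreal_plus ennreal_mult less_imp_le)
      finally have "f \<le> t * mF + t powr (- \<tau>) * j"
        using t mF j by (subst (asm) ennreal_le_iff) auto
      also have "t powr (- \<tau>) * j = L / 4"
        using j_pos L by (simp add: t_pow B_def)
      finally have "L \<le> 4 * (t * mF)" using Lf by linarith
      then have "mQ / L * L \<le> mQ / L * (4 * (t * mF))"
        using avg_pos by (intro mult_left_mono) auto
      then have "mQ \<le> mQ / L * (4 * (t * mF))" using L by simp
      also have "\<dots> = (mQ / L * B powr (r - 1)) * (4 * 4 powr (r - 1)) * mF"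
        by (simp add: t_def powr_mult)
      also have "\<dots> \<le> K powr r * (4 * 4 powr (r - 1)) * mF"
        using AB mF by (intro mult_right_mono) auto
      also have "\<dots> = (4 * K) powr r * mF"
        by (simp add: powr_mult powr_mult_base)
      also have "\<dots> \<le> C * mF" using mF False by (simp add: C_def mult_right_mono)
      finally show ?thesis .
    qed
    then have "ennreal mQ \<le> ennreal C * ennreal mF"
      using C mF by (simp add: ennreal_leI flip: ennreal_mult)
    then show ?thesis by (simp add: mQ mF)
  qed
  then have "comparable_on_cubes C M"
    unfolding comparable_on_cubes_def by blast
  then show ?thesis using C by (auto simp: M_def)
qed

lemma reverse_doubling_imp_measure:
  assumes "reverse_doubling \<rho>" "borel_version \<rho> \<rho>'"
  shows "\<exists>d>1. reverse_doubling_measure d (rdensity lborel \<rho>')"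
proof -
  obtain d where d: "1 < d" and rd: "\<And>a l Q'. 0 < l \<Longrightarrow> Q' \<in> dyadic_subcubes a l \<Longrightarrow>
      ennreal d * weight_mass \<rho> Q' \<le> weight_mass \<rho> (cube a l)"
    using assms(1) unfolding reverse_doubling_def by blast
  have "Q' \<in> sets borel" if "Q' \<in> dyadic_subcubes a l" for Q' and a :: "real^'a" and l
    using that by (auto simp: dyadic_subcubes_def)
  then have "reverse_doubling_measure d (rdensity lborel \<rho>')"
    unfolding reverse_doubling_measure_def using rd by (simp add: borel_versionD(5)[OF assms(2)])
  then show ?thesis using d by blast
qed

text \<open>Since the numbers \<open>1 - 1 / P i\<close> sum to \<open>m - 1 / p\<close>, the
  exponents of \<open>l\<close> add up to \<open>n * (\<alpha> / n + 1 / q - 1 / p) - n / q - n * (m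
  - 1 / p) = \<alpha> - m * n\<close>.\<close>

lemma testing_quantity_cube:
  fixes V :: "(real^'n) measure" and S :: "'m::finite \<Rightarrow> (real^'n) measure" and P :: "'m \<Rightarrow> real"
  assumes V: "radon V" "emeasure V (cube a l) = weight_mass v (cube a l)"
    and S: "\<And>i. radon (S i)" "\<And>i. emeasure (S i) (cube a l) = weight_mass (s i) (cube a l)"
    and P: "\<And>i. 1 < P i" and p: "1 / p = (\<Sum>i\<in>UNIV. 1 / P i)" and l: "0 < l"
  shows "ennreal (measure lebesgue (cube a l) powr (\<alpha> / real CARD('n) + 1 / q - 1 / p)) *
      ennpowr (average (cube a l) v) (1 / q) *
      (\<Prod>i\<in>UNIV. ennpowr (average (cube a l) (s i)) (1 / conjugate_exponent (P i))) =
    ennreal (testing_value \<alpha> q P V S a l)"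
proof -
  let ?n = "real CARD('n)" and ?m = "real CARD('m)"
  let ?Q = "cube a l"
  have vol: "measure lebesgue ?Q = l powr ?n" "l ^ CARD('n) = l powr ?n"
    using l emeasure_lborel_cube[of l a] by (auto simp: measure_def powr_realpow)
  have conj: "1 / conjugate_exponent (P i) = 1 - 1 / P i" for i
    using P[of i] by (simp add: conjugate_exponent_def field_simps)
  have expo: "(\<Sum>i\<in>(UNIV :: 'm set). 1 - 1 / P i) = ?m - 1 / p"
    by (simp add: sum_subtractf p)
  have "(\<Prod>i\<in>UNIV. (measure (S i) ?Q / l powr ?n) powr (1 - 1 / P i)) =
      (\<Prod>i\<in>UNIV. measure (S i) ?Q powr (1 - 1 / P i)) / (\<Prod>i\<in>UNIV. (l powr ?n) powr (1 - 1 / P i))"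
    by (simp only: powr_divide prod_dividef)
  also have "(\<Prod>i\<in>UNIV. (l powr ?n) powr (1 - 1 / P i)) = l powr (?n * (?m - 1 / p))"
    using l by (simp add: powr_powr powr_sum[symmetric] sum_distrib_left[symmetric] expo)
  finally have prod_eq: "(\<Prod>i\<in>UNIV. (measure (S i) ?Q / l powr ?n) powr (1 - 1 / P i)) =
      (\<Prod>i\<in>UNIV. measure (S i) ?Q powr (1 - 1 / P i)) / l powr (?n * (?m - 1 / p))" .
  have "ennreal (measure lebesgue ?Q powr (\<alpha> / ?n + 1 / q - 1 / p)) *
      ennpowr (average ?Q v) (1 / q) *
      (\<Prod>i\<in>UNIV. ennpowr (average ?Q (s i)) (1 / conjugate_exponent (P i))) =
    ennreal ((l powr ?n) powr (\<alpha> / ?n + 1 / q - 1 / p)) *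
      ennreal ((measure V ?Q / l powr ?n) powr (1 / q)) *
      (\<Prod>i\<in>UNIV. ennreal ((measure (S i) ?Q / l powr ?n) powr (1 - 1 / P i)))"
    using average_cube[OF V l] average_cube[OF S l]
    by (simp add: vol conj ennpowr_ennreal)
  also have "\<dots> = ennreal ((l powr ?n) powr (\<alpha> / ?n + 1 / q - 1 / p) *
      (measure V ?Q / l powr ?n) powr (1 / q) *
      (\<Prod>i\<in>UNIV. (measure (S i) ?Q / l powr ?n) powr (1 - 1 / P i)))"
    by (simp add: prod_ennreal ennreal_mult prod_nonneg)
  also have "(l powr ?n) powr (\<alpha> / ?n + 1 / q - 1 / p) *
      (measure V ?Q / l powr ?n) powr (1 / q) *
      (\<Prod>i\<in>UNIV. (measure (S i) ?Q / l powr ?n) powr (1 - 1 / P i)) =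
    (l powr (?n * (\<alpha> / ?n + 1 / q - 1 / p)) / l powr (?n * (1 / q)) / l powr (?n * (?m - 1 / p))) *
      measure V ?Q powr (1 / q) * (\<Prod>i\<in>UNIV. measure (S i) ?Q powr (1 - 1 / P i))"
    unfolding prod_eq by (simp add: powr_divide powr_powr)
  also have "l powr (?n * (\<alpha> / ?n + 1 / q - 1 / p)) / l powr (?n * (1 / q)) / l powr (?n * (?m - 1 / p)) =
      l powr (\<alpha> - ?m * ?n)"
    unfolding powr_diff[symmetric] by (rule arg_cong[where f = "(powr) l"]) (simp add: field_simps)
  finally show ?thesis .
qed

subsection \<open>The two implications\<close>

lemma ennpowr_le_ennreal: "x \<le> ennreal r \<Longrightarrow> 0 \<le> r \<Longrightarrow> 0 \<le> t \<Longrightarrow> ennpowr x t \<le> ennreal (r powr t)"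
  by (cases x) (auto simp: ennpowr_def top_unique intro!: ennreal_leI powr_mono2)

lemma ennreal_le_ennpowr: "ennreal r \<le> x \<Longrightarrow> 0 \<le> r \<Longrightarrow> 0 \<le> t \<Longrightarrow> ennreal (r powr t) \<le> ennpowr x t"
  by (cases x) (auto simp: ennpowr_def intro!: ennreal_leI powr_mono2)

lemma Lr_norm_weighted_eq:
  assumes "AE x in lebesgue. 0 < w x"
  shows "Lr_norm P (\<lambda>x. w x powr P) f = Lr_norm_unweighted P (\<lambda>x. w x * f x)"
proof -
  have "(\<integral>\<^sup>+x. ennreal (\<bar>f x\<bar> powr P * w x powr P) \<partial>lebesgue) =
      (\<integral>\<^sup>+x. ennreal (\<bar>w x * f x\<bar> powr P * 1) \<partial>lebesgue)"
    by (rule nn_integral_cong_AE)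
      (use assms in eventually_elim, simp add: abs_mult powr_mult mult.commute)
  then show ?thesis by (simp add: Lr_norm_def)
qed

text \<open>Both follow from \<open>conjugate_exponent P * (P - 1) = P\<close>. With
  \<open>\<sigma>\<close> for the dual weight, the first turns the norm of \<open>w f\<close> into
  the norm of \<open>f / \<sigma>\<close> with respect to \<open>\<sigma>\<close>; the second
  computes the norm of the test function \<open>\<sigma>\<close>.\<close>

lemma powr_conjugate_exponent:
  fixes w P :: real
  assumes "0 < w" "1 < P"
  shows "w powr (- conjugate_exponent P) * (w powr (- conjugate_exponent P)) powr (- P) = w powr P"
    and "(w powr (- conjugate_exponent P)) powr P * w powr P = w powr (- conjugate_exponent P)"
proof -
  have "conjugate_exponent P * (P - 1) = P"
    using assms(2) by (simp add: conjugate_exponent_def)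
  then have "- conjugate_exponent P + - conjugate_exponent P * - P = P"
    "- conjugate_exponent P * P + P = - conjugate_exponent P"
    by (simp_all add: algebra_simps)
  then show "w powr (- conjugate_exponent P) * (w powr (- conjugate_exponent P)) powr (- P) = w powr P"
    "(w powr (- conjugate_exponent P)) powr P * w powr P = w powr (- conjugate_exponent P)"
    by (simp_all only: powr_powr powr_add[symmetric])
qed

lemma frac_integrand_AE_cong:
  fixes f f' :: "'m::finite \<Rightarrow> real^'n \<Rightarrow> real"
  assumes "\<And>i. AE x in lborel. f i x = f' i x"
  shows "AE y in lborel. frac_integrand \<alpha> f x y = frac_integrand \<alpha> f' x y"
proof -
  have "AE y in lborel. \<forall>i. f i (y $ i) = f' i (y $ i)"
    using AE_lborel_vec_component[OF assms] by (intro eventually_all_finite)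
  then show ?thesis
    by eventually_elim (simp add: frac_integrand_def)
qed

lemma borel_measurable_frac_integrand:
  fixes f f' :: "'m::finite \<Rightarrow> real^'n \<Rightarrow> real"
  assumes f' [measurable]: "\<And>i. f' i \<in> borel_measurable borel" and ae: "\<And>i. AE x in lborel. f i x = f' i x"
  shows "frac_integrand \<alpha> f x \<in> borel_measurable lebesgue"
proof -
  have "frac_integrand \<alpha> f' x \<in> borel_measurable borel"
    unfolding frac_integrand_def[abs_def] by measurable
  then have "frac_integrand \<alpha> f' x \<in> borel_measurable lebesgue"
    by (intro measurable_completion) simp
  moreover have "AE y in lebesgue. frac_integrand \<alpha> f' x y = frac_integrand \<alpha> f x y"
    using frac_integrand_AE_cong[where f = f and f' = f' and \<alpha> = \<alpha> and x = x, OF ae]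
    by (auto simp: AE_completion_iff elim!: eventually_mono)
  ultimately show ?thesis by (rule borel_measurable_AE)
qed

text \<open>The factor 2 makes the inequality strict, so a single \<open>K\<close> already reaches
  \<open>Y / (2 * c)\<close>. This moves the power inside the supremum without any continuity at
  infinity.\<close>

lemma ennreal_powr_le_SUP:
  assumes "ennreal Y \<le> ennreal c * (SUP K. ennreal (N K))" "0 \<le> Y" "0 < c" "0 < q" "\<And>K::nat. 0 \<le> N K"
  shows "ennreal (Y powr q) \<le> ennreal ((2 * c) powr q) * (SUP K. ennreal (N K powr q))"
proof (cases "Y = 0")
  case False
  then have Y: "0 < Y" using assms by simp
  have "ennreal (Y / (2 * c)) < (SUP K. ennreal (N K))"
  proof (rule ccontr)
    assume "\<not> ?thesis"
    then have "ennreal c * (SUP K. ennreal (N K)) \<le> ennreal c * ennreal (Y / (2 * c))"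
      by (intro mult_left_mono) (auto simp: not_less)
    with assms(1) have "ennreal Y \<le> ennreal c * ennreal (Y / (2 * c))"
      by (rule order_trans)
    then have "ennreal Y \<le> ennreal (c * (Y / (2 * c)))"
      using assms(3) Y by (simp add: ennreal_mult[symmetric])
    then have "Y \<le> Y / 2" using assms(3) Y by simp
    then show False using Y by simp
  qed
  then obtain K where "ennreal (Y / (2 * c)) < ennreal (N K)"
    by (auto simp: less_SUP_iff)
  then have "Y / (2 * c) \<le> N K"
    using assms by (simp add: ennreal_less_iff)
  then have "Y \<le> 2 * c * N K"
    using assms(3) by (simp add: field_simps)
  then have "Y powr q \<le> (2 * c * N K) powr q"
    using assms by (intro powr_mono2) auto
  also have "\<dots> = (2 * c) powr q * N K powr q"
    by (rule powr_mult)
  finally have "ennreal (Y powr q) \<le> ennreal ((2 * c) powr q) * ennreal (N K powr q)"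
    by (simp add: ennreal_leI flip: ennreal_mult)
  also have "\<dots> \<le> ennreal ((2 * c) powr q) * (SUP K. ennreal (N K powr q))"
    by (intro mult_left_mono SUP_upper) auto
  finally show ?thesis .
qed simp

lemma SUP_powr_finite:
  assumes "(SUP K::nat. ennreal (N K powr q)) < top" "0 < q" "\<And>K. 0 \<le> N K"
  shows "(SUP K. ennreal (N K)) < top"
proof -
  obtain z where z: "0 \<le> z" "(SUP K. ennreal (N K powr q)) = ennreal z"
    using assms(1) by (cases "SUP K. ennreal (N K powr q)") auto
  have "N K \<le> z powr (1 / q)" for K
  proof -
    have "ennreal (N K powr q) \<le> ennreal z"
      unfolding z(2)[symmetric] by (rule SUP_upper) simp
    then have "N K powr q \<le> z" using z(1) by simp
    then have "(N K powr q) powr (1 / q) \<le> z powr (1 / q)"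
      using assms(2) by (intro powr_mono2) auto
    then show ?thesis using assms(2,3) by (simp add: powr_powr)
  qed
  then have "(SUP K. ennreal (N K)) \<le> ennreal (z powr (1 / q))"
    by (intro SUP_least ennreal_leI)
  then show ?thesis by (simp add: le_less_trans)
qed

context
  fixes p q \<alpha> :: real and P :: "'m::finite \<Rightarrow> real"
    and u v :: "real^'n \<Rightarrow> real" and w s :: "'m \<Rightarrow> real^'n \<Rightarrow> real"
  assumes P: "\<And>i. 1 < P i" and p: "1 / p = (\<Sum>i\<in>UNIV. 1 / P i)" and pq: "p < q"
    and \<alpha>: "0 < \<alpha>" "\<alpha> < real CARD('m) * real CARD('n)"
    and u_pos: "AE x in lborel. 0 < u x"
    and w_pos: "\<And>i. AE x in lborel. 0 < w i x"
    and v: "borel_version (\<lambda>x. u x powr q) v"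
    and s: "\<And>i. borel_version (\<lambda>x. w i x powr (- conjugate_exponent (P i))) (s i)"
begin

private lemmas v_meas [measurable] = borel_versionD(1)[OF v] and v_pos = borel_versionD(2)[OF v]
  and v_ae = borel_versionD(3)[OF v] and v_fin = borel_versionD(4)[OF v]
private lemmas s_meas [measurable] = borel_versionD(1)[OF s] and s_pos = borel_versionD(2)[OF s]
  and s_ae = borel_versionD(3)[OF s] and s_fin = borel_versionD(4)[OF s] and s_cube = borel_versionD(6)[OF s]

private abbreviation V where "V \<equiv> rdensity lborel v"
private abbreviation S where "S i \<equiv> rdensity lborel (s i)"

private abbreviation bounded_with where
  "bounded_with C f \<equiv> (AE x in lebesgue. frac_int_exists \<alpha> f x) \<and>
    Lr_norm_unweighted q (\<lambda>x. u x * frac_int \<alpha> f x)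
      \<le> ennreal C * (\<Prod>i\<in>UNIV. Lr_norm_unweighted (P i) (\<lambda>x. w i x * f i x))"

private lemma p_pos: "0 < p"
proof -
  have "0 < (\<Sum>i\<in>(UNIV :: 'm set). 1 / P i)"
    using P by (intro sum_pos) (auto intro: less_trans[OF zero_less_one])
  then show ?thesis unfolding p[symmetric] by simp
qed

private lemma q_pos: "0 < q"
  using p_pos pq by linarith

private lemma Lr_norm_weighted:
  "Lr_norm (P i) (\<lambda>x. w i x powr P i) f = Lr_norm_unweighted (P i) (\<lambda>x. w i x * f x)"
  using w_pos[of i] by (intro Lr_norm_weighted_eq) (simp add: AE_completion_iff)

text \<open>One bound for the integral of \<open>Z\<close>, the supremum of the \<open>q\<close>-th
  powers of the partial sums, serves twice: \<open>Z\<close> is finite almost everywhere, hence the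
  integral defining the operator exists, and the same bound gives the norm inequality.\<close>

lemma fractional_integral_bounded:
  assumes comp: "0 < C" "comparable_on_cubes C V"
    and rd: "\<And>i. 1 < d i" "\<And>i. reverse_doubling_measure (d i) (S i)"
    and test: "\<And>a l. 0 < l \<Longrightarrow> testing_value \<alpha> q P V S a l \<le> A"
  shows "\<exists>C>0. \<forall>f. (\<forall>i. f i \<in> Lr_space (P i) (\<lambda>x. w i x powr P i)) \<longrightarrow>
               bounded_with C f"
proof -
  obtain D where D: "0 \<le> D" and D_le: "\<And>g X a b. (\<forall>i. g i \<in> borel_measurable borel \<and> (\<forall>x. 0 \<le> g i x) \<and> 0 < X i \<and>
      (\<integral>\<^sup>+x. ennreal (g i x powr P i) \<partial>S i) \<le> ennreal (X i powr P i)) \<Longrightarrow>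
    (\<integral>\<^sup>+x. ennreal ((\<Sum>k=a..b. avg_term \<alpha> (\<lambda>i. rdensity (S i) (g i)) k x) powr q) \<partial>V) \<le>
      ennreal (D * (\<Prod>i\<in>UNIV. X i) powr q)"
    using nn_integral_avg_sum_powr_bound[OF v_fin s_fin s_cube P p_pos p pq rd test \<alpha>(1) comp(2,1)] by blast
  define c where "c = 4 powr (real CARD('m) * real CARD('n) - \<alpha>)"
  have c: "0 < c" by (simp add: c_def)
  \<comment> \<open>The summand 1 only ensures positivity, as \<open>D\<close> may be zero.\<close>
  define C' where "C' = 2 * c * D powr (1 / q) + 1"
  have C': "0 < C'" using c by (simp add: C'_def add_nonneg_pos)
  show ?thesis
  proof (intro exI[of _ C'] conjI[OF C'] allI impI)
    fix f :: "'m \<Rightarrow> real^'n \<Rightarrow> real"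
    assume f: "\<forall>i. f i \<in> Lr_space (P i) (\<lambda>x. w i x powr P i)"
    define nrm where "nrm i = enn2real (Lr_norm_unweighted (P i) (\<lambda>x. w i x * f i x))" for i
    have nrm: "Lr_norm_unweighted (P i) (\<lambda>x. w i x * f i x) = ennreal (nrm i)" "0 \<le> nrm i" for i
    proof -
      have "Lr_norm_unweighted (P i) (\<lambda>x. w i x * f i x) < top"
        using f by (simp add: Lr_space_def flip: Lr_norm_weighted)
      then show "Lr_norm_unweighted (P i) (\<lambda>x. w i x * f i x) = ennreal (nrm i)" "0 \<le> nrm i"
        by (simp_all add: nrm_def)
    qed
    have "\<forall>i. \<exists>f'. f' \<in> borel_measurable borel \<and> (AE x in lborel. f i x = f' x)"
      using f completion_ex_borel_measurable_real[of _ lborel] by (simp add: Lr_space_def) blast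
    then obtain f' where f'_meas: "\<And>i. f' i \<in> borel_measurable borel" and f'_ae: "\<And>i. AE x in lborel. f i x = f' i x"
      by metis
    note [measurable] = f'_meas
    define g where "g i x = \<bar>f' i x\<bar> / s i x" for i x
    let ?J = "\<lambda>x. \<integral>\<^sup>+y. ennreal \<bar>frac_integrand \<alpha> f x y\<bar> \<partial>lebesgue"
    let ?G = "\<lambda>i. \<integral>\<^sup>+x. ennreal (g i x powr P i) \<partial>S i"
    have g_meas [measurable]: "g i \<in> borel_measurable borel" for i
      unfolding g_def[abs_def] by measurable
    have g_nonneg: "0 \<le> g i x" for i x using s_pos[of i x] by (simp add: g_def)
    have g_int: "?G i = ennreal (nrm i powr P i)" for i
    proof -
      let ?I = "\<integral>\<^sup>+x. ennreal (\<bar>f i x\<bar> powr P i * w i x powr P i) \<partial>lebesgue"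
      have "?G i = (\<integral>\<^sup>+x. ennreal (s i x) * ennreal (g i x powr P i) \<partial>lborel)"
        by (rule nn_integral_density) measurable
      also have "\<dots> = (\<integral>\<^sup>+x. ennreal (\<bar>f i x\<bar> powr P i * w i x powr P i) \<partial>lborel)"
      proof (rule nn_integral_cong_AE)
        show "AE x in lborel. ennreal (s i x) * ennreal (g i x powr P i) = ennreal (\<bar>f i x\<bar> powr P i * w i x powr P i)"
          using f'_ae[of i] s_ae[of i] w_pos[of i]
        proof eventually_elim
          case (elim x)
          have "s i x * g i x powr P i = \<bar>f i x\<bar> powr P i * (s i x * s i x powr (- P i))"
            using elim(1) by (simp add: g_def powr_divide powr_minus_divide)
          also have "s i x * s i x powr (- P i) = w i x powr P i"
            using powr_conjugate_exponent(1)[OF elim(3) P[of i]] by (simp only: elim(2))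
          finally show ?case
            using s_pos[of i x] by (simp add: less_imp_le flip: ennreal_mult)
        qed
      qed
      also have "\<dots> = ?I" by (simp only: nn_integral_completion)
      also have "?I = ennreal (nrm i powr P i)"
      proof -
        have eq: "ennpowr ?I (1 / P i) = ennreal (nrm i)"
          using Lr_norm_weighted[of i "f i"] nrm(1)[of i] by (simp add: Lr_norm_def)
        then have "?I \<noteq> top" by (auto simp: ennpowr_def)
        then obtain t where t: "0 \<le> t" "?I = ennreal t" by (cases ?I) auto
        then have "t powr (1 / P i) = nrm i"
          using eq nrm(2)[of i] by (simp add: ennpowr_ennreal)
        then have "nrm i powr P i = t"
          using P[of i] t(1) by (simp add: powr_powr flip: \<open>t powr (1 / P i) = nrm i\<close>)
        then show ?thesis using t by simp
      qed
      finally show ?thesis .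
    qed
    define \<Phi> where "\<Phi> i = density lborel (\<lambda>y. ennreal \<bar>f' i y\<bar>)" for i
    have \<Phi>_eq: "rdensity (S i) (g i) = \<Phi> i" for i
    proof -
      have "rdensity (S i) (g i) = density lborel (\<lambda>x. ennreal (s i x) * ennreal (g i x))"
        by (rule density_density_eq) measurable
      also have "(\<lambda>x. ennreal (s i x) * ennreal (g i x)) = (\<lambda>x. ennreal \<bar>f' i x\<bar>)"
        using s_pos g_nonneg by (simp add: g_def less_imp_le less_imp_neq[symmetric] flip: ennreal_mult)
      finally show ?thesis by (simp add: \<Phi>_def)
    qed
    have \<Phi>: "radon (\<Phi> i)" for i
      unfolding \<Phi>_eq[symmetric] using P[of i]
      by (intro radon_density[where p = "P i"] s_fin g_nonneg) (auto simp: g_int)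
    define N where "N K x = (\<Sum>k=-int K..int K. avg_term \<alpha> \<Phi> k x)" for K x
    have N_nonneg: "0 \<le> N K x" for K x by (simp add: N_def sum_nonneg)
    have N_meas [measurable]: "N K \<in> borel_measurable borel" for K
      unfolding N_def[abs_def] by (intro borel_measurable_sum borel_measurable_avg_term \<Phi>)
    define Z where "Z x = (SUP K. ennreal (N K x powr q))" for x
    have Z_meas [measurable]: "Z \<in> borel_measurable borel"
      unfolding Z_def[abs_def] by measurable
    \<comment> \<open>Some of the norms may be zero, whereas the bound asks for positive
      \<open>X i\<close>; the \<open>\<epsilon>\<close> is removed by a limit afterwards.\<close>
    have Z_le_eps: "(\<integral>\<^sup>+x. Z x \<partial>V) \<le> ennreal (D * (\<Prod>i\<in>UNIV. nrm i + \<epsilon>) powr q)" if \<epsilon>: "0 < \<epsilon>" for \<epsilon>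
    proof -
      have "incseq (\<lambda>K x. ennreal (N K x powr q))"
        unfolding incseq_def le_fun_def N_def using q_pos
        by (intro allI impI ennreal_leI powr_mono2 sum_mono2) (auto intro: sum_nonneg)
      then have "(\<integral>\<^sup>+x. Z x \<partial>V) = (SUP K. \<integral>\<^sup>+x. ennreal (N K x powr q) \<partial>V)"
        unfolding Z_def by (rule nn_integral_monotone_convergence_SUP) measurable
      also have "\<dots> \<le> ennreal (D * (\<Prod>i\<in>UNIV. nrm i + \<epsilon>) powr q)"
      proof (rule SUP_least)
        fix K
        have "\<forall>i. g i \<in> borel_measurable borel \<and> (\<forall>x. 0 \<le> g i x) \<and> 0 < nrm i + \<epsilon> \<and>
            ?G i \<le> ennreal ((nrm i + \<epsilon>) powr P i)"
        proof (intro allI conjI g_meas g_nonneg)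
          fix i
          show "0 < nrm i + \<epsilon>" using nrm(2)[of i] \<epsilon> by linarith
          show "?G i \<le> ennreal ((nrm i + \<epsilon>) powr P i)"
            unfolding g_int using nrm(2)[of i] \<epsilon> P[of i] by (intro ennreal_leI powr_mono2) auto
        qed
        from D_le[OF this, of "- int K" "int K"]
        show "(\<integral>\<^sup>+x. ennreal (N K x powr q) \<partial>V) \<le> ennreal (D * (\<Prod>i\<in>UNIV. nrm i + \<epsilon>) powr q)"
          by (simp only: \<Phi>_eq N_def)
      qed
      finally show ?thesis .
    qed
    let ?X = "\<Prod>i\<in>UNIV. nrm i"
    have X_nonneg: "0 \<le> ?X" using nrm(2) by (simp add: prod_nonneg)
    have Z_le: "(\<integral>\<^sup>+x. Z x \<partial>V) \<le> ennreal (D * ?X powr q)"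
    proof (rule tendsto_lowerbound)
      have "((\<lambda>\<epsilon>. D * (\<Prod>i\<in>UNIV. nrm i + \<epsilon>) powr q) \<longlongrightarrow> D * (\<Prod>i\<in>UNIV. nrm i + 0) powr q) (at_right 0)"
      proof (intro tendsto_mult tendsto_const tendsto_powr' tendsto_prod tendsto_add tendsto_ident_at)
        have "\<forall>\<^sub>F \<epsilon> in at_right 0. (0::real) < \<epsilon>" by (rule eventually_at_right_less)
        then have "\<forall>\<^sub>F \<epsilon> in at_right 0. 0 \<le> (\<Prod>i\<in>UNIV. nrm i + \<epsilon>)"
          by eventually_elim (use nrm(2) in \<open>auto intro!: prod_nonneg add_nonneg_nonneg\<close>)
        then show "(\<Prod>i\<in>UNIV. nrm i + 0) \<noteq> 0 \<or> 0 < q \<and> (\<forall>\<^sub>F \<epsilon> in at_right 0. 0 \<le> (\<Prod>i\<in>UNIV. nrm i + \<epsilon>))"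
          using q_pos by simp
      qed
      then show "((\<lambda>\<epsilon>. ennreal (D * (\<Prod>i\<in>UNIV. nrm i + \<epsilon>) powr q)) \<longlongrightarrow> ennreal (D * ?X powr q)) (at_right 0)"
        by (intro tendsto_ennrealI) simp
      have "\<forall>\<^sub>F \<epsilon> in at_right 0. (0::real) < \<epsilon>" by (rule eventually_at_right_less)
      then show "\<forall>\<^sub>F \<epsilon> in at_right 0. (\<integral>\<^sup>+x. Z x \<partial>V) \<le> ennreal (D * (\<Prod>i\<in>UNIV. nrm i + \<epsilon>) powr q)"
        by eventually_elim (rule Z_le_eps)
    qed simp
    have bound: "?J x \<le> ennreal c * (SUP K. ennreal (N K x))" for x
    proof -
      have "?J x = (\<integral>\<^sup>+y. ennreal \<bar>frac_integrand \<alpha> f' x y\<bar> \<partial>lborel)"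
        unfolding nn_integral_completion
        by (rule nn_integral_cong_AE) (use frac_integrand_AE_cong[where f = f and f' = f' and \<alpha> = \<alpha> and x = x, OF f'_ae] in eventually_elim, simp)
      also have "\<dots> \<le> ennreal c * (SUP K. ennreal (N K x))"
        unfolding c_def N_def \<Phi>_def[abs_def] using \<Phi> \<alpha>
        by (intro nn_integral_frac_integrand_le) (auto simp: \<Phi>_def)
      finally show ?thesis .
    qed
    \<comment> \<open>Finiteness is first known almost everywhere for \<open>V\<close>. As
      \<open>v\<close> is positive everywhere, it holds almost everywhere for Lebesgue
      measure.\<close>
    have "AE x in V. Z x \<noteq> \<infinity>"
      using Z_le by (intro nn_integral_PInf_AE) (auto simp: top_unique)
    then have Z_fin: "AE x in lborel. Z x \<noteq> \<infinity>"
      using v_pos by (subst (asm) AE_density) auto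
    have exists: "AE x in lborel. frac_int_exists \<alpha> f x"
      using Z_fin
    proof eventually_elim
      case (elim x)
      have "(SUP K. ennreal (N K x powr q)) < top"
        using elim unfolding Z_def infinity_ennreal_def less_top .
      then have "(SUP K. ennreal (N K x)) < top"
        using q_pos N_nonneg by (rule SUP_powr_finite)
      then have "ennreal c * (SUP K. ennreal (N K x)) < top"
        by (simp add: ennreal_mult_less_top)
      then have "?J x < top"
        using bound[of x] by (rule le_less_trans[rotated])
      then show ?case
        unfolding frac_int_exists_def integrable_iff_bounded
        using borel_measurable_frac_integrand[where f = f and f' = f' and \<alpha> = \<alpha> and x = x, OF f'_meas f'_ae] by simp
    qed
    have "(\<integral>\<^sup>+x. ennreal (\<bar>u x * frac_int \<alpha> f x\<bar> powr q * 1) \<partial>lebesgue) \<le>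
        (\<integral>\<^sup>+x. ennreal (v x) * (ennreal ((2 * c) powr q) * Z x) \<partial>lborel)"
      unfolding nn_integral_completion
    proof (rule nn_integral_mono_AE)
      show "AE x in lborel. ennreal (\<bar>u x * frac_int \<alpha> f x\<bar> powr q * 1) \<le> ennreal (v x) * (ennreal ((2 * c) powr q) * Z x)"
        using exists v_ae u_pos
      proof eventually_elim
        case (elim x)
        have "ennreal \<bar>frac_int \<alpha> f x\<bar> \<le> ?J x"
          using integral_norm_bound_ennreal[of lebesgue "frac_integrand \<alpha> f x"] elim(1)
          by (simp add: frac_int_def frac_int_exists_def)
        then have "ennreal \<bar>frac_int \<alpha> f x\<bar> \<le> ennreal c * (SUP K. ennreal (N K x))"
          using bound[of x] by (rule order_trans)
        then have "ennreal (\<bar>frac_int \<alpha> f x\<bar> powr q) \<le> ennreal ((2 * c) powr q) * Z x"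
          unfolding Z_def using c q_pos N_nonneg by (intro ennreal_powr_le_SUP) auto
        then have "ennreal (v x) * ennreal (\<bar>frac_int \<alpha> f x\<bar> powr q) \<le> ennreal (v x) * (ennreal ((2 * c) powr q) * Z x)"
          by (rule mult_left_mono) simp
        moreover have "\<bar>u x * frac_int \<alpha> f x\<bar> powr q * 1 = v x * \<bar>frac_int \<alpha> f x\<bar> powr q"
          using elim(3) by (simp add: abs_mult powr_mult flip: elim(2))
        ultimately show ?case
          using v_pos[of x] by (simp add: ennreal_mult less_imp_le)
      qed
    qed
    also have "\<dots> = (\<integral>\<^sup>+x. ennreal ((2 * c) powr q) * Z x \<partial>V)"
      by (rule nn_integral_density[symmetric]) measurable
    also have "\<dots> = ennreal ((2 * c) powr q) * (\<integral>\<^sup>+x. Z x \<partial>V)"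
      by (rule nn_integral_cmult) measurable
    also have "\<dots> \<le> ennreal ((2 * c) powr q) * ennreal (D * ?X powr q)"
      by (rule mult_left_mono[OF Z_le]) simp
    also have "\<dots> = ennreal ((2 * c) powr q * (D * ?X powr q))"
      using D by (simp flip: ennreal_mult)
    finally have "Lr_norm_unweighted q (\<lambda>x. u x * frac_int \<alpha> f x) \<le>
        ennreal (((2 * c) powr q * (D * ?X powr q)) powr (1 / q))"
      unfolding Lr_norm_def using D q_pos by (intro ennpowr_le_ennreal) auto
    also have "((2 * c) powr q * (D * ?X powr q)) powr (1 / q) = 2 * c * D powr (1 / q) * ?X"
      using q_pos c X_nonneg by (simp add: powr_mult powr_powr)
    also have "\<dots> \<le> C' * ?X"
      using X_nonneg by (intro mult_right_mono) (auto simp: C'_def)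
    then have "ennreal (2 * c * D powr (1 / q) * ?X) \<le> ennreal (C' * ?X)"
      by (rule ennreal_leI)
    also have "\<dots> = ennreal C' * (\<Prod>i\<in>UNIV. Lr_norm_unweighted (P i) (\<lambda>x. w i x * f i x))"
      using C' X_nonneg by (simp add: nrm prod_ennreal ennreal_mult)
    finally have "Lr_norm_unweighted q (\<lambda>x. u x * frac_int \<alpha> f x) \<le>
        ennreal C' * (\<Prod>i\<in>UNIV. Lr_norm_unweighted (P i) (\<lambda>x. w i x * f i x))" .
    moreover have "AE x in lebesgue. frac_int_exists \<alpha> f x"
      using exists by (simp add: AE_completion_iff)
    ultimately show "bounded_with C' f" by blast
  qed
qed

text \<open>For \<open>x\<close> and all \<open>y $ i\<close> in the cube the sum of distances is at
  most \<open>m * n * l\<close>, so for the test functions the operator is at least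
  \<open>(m * n * l) powr (\<alpha> - m * n)\<close> times the product of the masses
  \<open>mS i\<close> on the cube. The norms \<open>mS i powr (1 / P i)\<close> on the right then
  leave the powers \<open>1 - 1 / P i\<close>.\<close>

lemma testing_condition_necessary:
  assumes C: "0 < C"
    and bdd: "\<And>f. (\<And>i. f i \<in> Lr_space (P i) (\<lambda>x. w i x powr P i)) \<Longrightarrow>
      bounded_with C f"
    and l: "0 < l"
  shows "testing_value \<alpha> q P V S a l \<le>
    C * (real CARD('m) * real CARD('n)) powr (real CARD('m) * real CARD('n) - \<alpha>)"
proof -
  let ?e = "real CARD('m) * real CARD('n) - \<alpha>"
  let ?Q = "cube a l"
  define mS where "mS i = measure (S i) ?Q" for i
  have mS: "emeasure (S i) ?Q = ennreal (mS i)" "0 < mS i" for i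
    using emeasure_cube_finite[OF s_fin, of i a l] measure_cube_pos[OF s_fin s_cube[OF l], of i a]
    by (auto simp: mS_def emeasure_eq_ennreal_measure less_top)
  have mS_int: "(\<integral>\<^sup>+x\<in>?Q. ennreal (s i x) \<partial>lborel) = ennreal (mS i)" for i
    unfolding mS(1)[symmetric] by (rule emeasure_density[symmetric]) measurable
  have mV: "emeasure V ?Q = ennreal (measure V ?Q)"
    using emeasure_cube_finite[OF v_fin, of a l] by (auto simp: emeasure_eq_ennreal_measure less_top)
  have mV_int: "(\<integral>\<^sup>+x\<in>?Q. ennreal (v x) \<partial>lborel) = ennreal (measure V ?Q)"
    unfolding mV[symmetric] by (rule emeasure_density[symmetric]) measurable
  define f where "f i x = w i x powr (- conjugate_exponent (P i)) * indicator ?Q x" for i x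
  define f' where "f' i x = s i x * indicator ?Q x" for i x
  have f'_meas: "f' i \<in> borel_measurable borel" for i
    unfolding f'_def[abs_def] by measurable
  have f'_ae: "AE x in lborel. f i x = f' i x" for i
    using s_ae[of i] by eventually_elim (simp add: f_def f'_def)
  have f_norm: "Lr_norm (P i) (\<lambda>x. w i x powr P i) (f i) = ennreal (mS i powr (1 / P i))" for i
  proof -
    have "(\<integral>\<^sup>+x. ennreal (\<bar>f i x\<bar> powr P i * w i x powr P i) \<partial>lebesgue) = (\<integral>\<^sup>+x\<in>?Q. ennreal (s i x) \<partial>lborel)"
      unfolding nn_integral_completion
    proof (rule nn_integral_cong_AE)
      show "AE x in lborel. ennreal (\<bar>f i x\<bar> powr P i * w i x powr P i) = ennreal (s i x) * indicator ?Q x"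
        using s_ae[of i] w_pos[of i]
      proof eventually_elim
        case (elim x)
        have "s i x powr P i * w i x powr P i = s i x"
          using powr_conjugate_exponent(2)[OF elim(2) P[of i]] by (simp only: elim(1))
        moreover have "\<bar>s i x\<bar> = s i x" using s_pos[of i x] by simp
        ultimately show ?case
          by (cases "x \<in> ?Q") (simp_all add: f_def elim(1))
      qed
    qed
    then show ?thesis
      using mS(2)[of i] by (simp add: Lr_norm_def mS_int ennpowr_ennreal less_imp_le)
  qed
  have f_meas: "f i \<in> borel_measurable lebesgue" for i
  proof -
    have "f' i \<in> borel_measurable lebesgue"
      using f'_meas[of i] by (intro measurable_completion) simp
    moreover have "AE x in lebesgue. f' i x = f i x"
      using f'_ae[of i] by (auto simp: AE_completion_iff elim!: eventually_mono)
    ultimately show ?thesis by (rule borel_measurable_AE)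
  qed
  have f_space: "f i \<in> Lr_space (P i) (\<lambda>x. w i x powr P i)" for i
    by (simp add: Lr_space_def f_meas f_norm)
  have exists: "AE x in lborel. frac_int_exists \<alpha> f x"
    and le: "Lr_norm_unweighted q (\<lambda>x. u x * frac_int \<alpha> f x) \<le> ennreal C * (\<Prod>i\<in>UNIV. ennreal (mS i powr (1 / P i)))"
    using bdd[OF f_space] by (auto simp: AE_completion_iff f_norm simp flip: Lr_norm_weighted)
  let ?mn = "real CARD('m) * real CARD('n)"
  define \<kappa> where "\<kappa> = (?mn * l) powr (- ?e)"
  have \<kappa>: "0 < \<kappa>" using l by (simp add: \<kappa>_def)
  let ?M = "\<Prod>i\<in>UNIV. mS i"
  have M_pos: "0 < ?M" using mS(2) by (simp add: prod_pos)
  let ?p = "\<lambda>y. \<Prod>i\<in>UNIV. ennreal (s i (y $ i)) * indicator ?Q (y $ i)"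
  have lower: "\<kappa> * ?M \<le> frac_int \<alpha> f x" if x: "x \<in> ?Q" and ex: "frac_int_exists \<alpha> f x" for x
  proof -
    have nonneg: "0 \<le> frac_integrand \<alpha> f x y" for y
      by (simp add: frac_integrand_def f_def prod_nonneg)
    have "ennreal (\<kappa> * ?M) = ennreal \<kappa> * (\<Prod>i\<in>UNIV. \<integral>\<^sup>+y. ennreal (s i y) * indicator ?Q y \<partial>lborel)"
      using \<kappa> mS(2) by (simp add: mS_int prod_ennreal ennreal_mult less_imp_le prod_nonneg)
    also have "\<dots> = ennreal \<kappa> * (\<integral>\<^sup>+y. ?p y \<partial>lborel)"
      by (subst nn_integral_prod_vec[symmetric]) auto
    also have "\<dots> = (\<integral>\<^sup>+y. ennreal \<kappa> * ?p y \<partial>lborel)"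
    proof -
      show ?thesis by (rule nn_integral_cmult[symmetric]) measurable
    qed
    also have "\<dots> \<le> (\<integral>\<^sup>+y. ennreal (frac_integrand \<alpha> f x y) \<partial>lborel)"
    proof (rule nn_integral_mono_AE)
      \<comment> \<open>At this single tuple the integrand is 0 by the convention on division, and
        the lower bound for the kernel fails.\<close>
      have "AE y in lborel. y \<noteq> ((\<chi> i. x) :: (real^'n)^'m)"
        by (rule AE_lborel_singleton)
      then show "AE y in lborel. ennreal \<kappa> * ?p y \<le>
          ennreal (frac_integrand \<alpha> f x y)"
        using frac_integrand_AE_cong[where f = f and f' = f' and \<alpha> = \<alpha> and x = x, OF f'_ae]
      proof eventually_elim
        case (elim y)
        show ?case
        proof (cases "\<forall>i. y $ i \<in> ?Q")
          case True
          define D where "D = (\<Sum>i\<in>UNIV. norm (x - y $ i))"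
          have "D \<le> (\<Sum>i\<in>(UNIV :: 'm set). real CARD('n) * l)"
            unfolding D_def
          proof (rule sum_mono)
            fix i
            have "norm (x - y $ i) \<le> (\<Sum>j\<in>UNIV. \<bar>(x - y $ i) $ j\<bar>)" by (rule norm_le_l1_cart)
            also have "\<dots> \<le> (\<Sum>j\<in>(UNIV :: 'n set). l)"
            proof (rule sum_mono)
              fix j
              have "y $ i \<in> ?Q" using True by blast
              then have "a $ j \<le> y $ i $ j" "y $ i $ j \<le> a $ j + l" by (auto simp: mem_cube)
              moreover have "a $ j \<le> x $ j" "x $ j \<le> a $ j + l" using x by (auto simp: mem_cube)
              ultimately show "\<bar>(x - y $ i) $ j\<bar> \<le> l" by simp
            qed
            finally show "norm (x - y $ i) \<le> real CARD('n) * l" by simp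
          qed
          then have D_le: "D \<le> ?mn * l" by simp
          have "D \<noteq> 0"
          proof
            assume "D = 0"
            then have "\<forall>i. norm (x - y $ i) = 0"
              unfolding D_def by (subst (asm) sum_nonneg_eq_0_iff) auto
            then have "y = (\<chi> i. x)" by (simp add: vec_eq_iff)
            then show False using elim(1) by simp
          qed
          moreover have "0 \<le> D" by (simp add: D_def sum_nonneg)
          ultimately have D_pos: "0 < D" by simp
          have "\<kappa> \<le> D powr (- ?e)"
            unfolding \<kappa>_def using D_pos D_le \<alpha> by (intro powr_mono2') auto
          then have "\<kappa> * (\<Prod>i\<in>UNIV. s i (y $ i)) \<le> D powr (- ?e) * (\<Prod>i\<in>UNIV. s i (y $ i))"
            using s_pos by (intro mult_right_mono prod_nonneg) (auto intro: less_imp_le)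
          also have "D powr (- ?e) = 1 / D powr ?e"
            by (rule powr_minus_divide)
          also have "1 / D powr ?e * (\<Prod>i\<in>UNIV. s i (y $ i)) = frac_integrand \<alpha> f' x y"
            using True by (simp add: frac_integrand_def f'_def D_def)
          finally have "\<kappa> * (\<Prod>i\<in>UNIV. s i (y $ i)) \<le> frac_integrand \<alpha> f x y"
            by (simp only: elim(2))
          then have "ennreal (\<kappa> * (\<Prod>i\<in>UNIV. s i (y $ i))) \<le> ennreal (frac_integrand \<alpha> f x y)"
            by (rule ennreal_leI)
          moreover have "ennreal \<kappa> * ?p y =
              ennreal (\<kappa> * (\<Prod>i\<in>UNIV. s i (y $ i)))"
            using True \<kappa> s_pos by (simp add: prod_ennreal ennreal_mult less_imp_le prod_nonneg)
          ultimately show ?thesis by simp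
        next
          case False
          then have "?p y = 0"
            by (intro prod_zero) (auto simp: indicator_def)
          then show ?thesis by (simp only: mult_zero_right zero_le)
        qed
      qed
    qed
    also have "\<dots> = (\<integral>\<^sup>+y. ennreal (frac_integrand \<alpha> f x y) \<partial>lebesgue)"
      by (simp only: nn_integral_completion)
    \<comment> \<open>The existence clause matters here: a divergent integral would be recorded as 0
      and yield no lower bound.\<close>
    also have "\<dots> = ennreal (frac_int \<alpha> f x)"
      unfolding frac_int_def using ex nonneg
      by (intro nn_integral_eq_integral) (auto simp: frac_int_exists_def)
    finally have "ennreal (\<kappa> * ?M) \<le> ennreal (frac_int \<alpha> f x)" .
    moreover have "0 \<le> frac_int \<alpha> f x"
      unfolding frac_int_def using nonneg by (intro integral_nonneg_AE) simp
    ultimately show ?thesis by simp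
  qed
  have "ennreal ((\<kappa> * ?M) powr q * measure V ?Q) = ennreal ((\<kappa> * ?M) powr q) * (\<integral>\<^sup>+x\<in>?Q. ennreal (v x) \<partial>lborel)"
    by (simp add: mV_int ennreal_mult)
  also have "\<dots> = (\<integral>\<^sup>+x. ennreal ((\<kappa> * ?M) powr q) * (ennreal (v x) * indicator ?Q x) \<partial>lborel)"
    by (rule nn_integral_cmult[symmetric]) measurable
  also have "\<dots> \<le> (\<integral>\<^sup>+x. ennreal (\<bar>u x * frac_int \<alpha> f x\<bar> powr q * 1) \<partial>lborel)"
  proof (rule nn_integral_mono_AE)
    show "AE x in lborel. ennreal ((\<kappa> * ?M) powr q) * (ennreal (v x) * indicator ?Q x) \<le>
        ennreal (\<bar>u x * frac_int \<alpha> f x\<bar> powr q * 1)"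
      using exists v_ae u_pos
    proof eventually_elim
      case (elim x)
      show ?case
      proof (cases "x \<in> ?Q")
        case True
        have "(\<kappa> * ?M) powr q \<le> \<bar>frac_int \<alpha> f x\<bar> powr q"
          using lower[OF True elim(1)] \<kappa> M_pos q_pos by (intro powr_mono2) auto
        then have "(\<kappa> * ?M) powr q * v x \<le> \<bar>frac_int \<alpha> f x\<bar> powr q * v x"
          using v_pos[of x] by (intro mult_right_mono) auto
        also have "\<dots> = \<bar>u x * frac_int \<alpha> f x\<bar> powr q * 1"
          using elim(3) by (simp add: abs_mult powr_mult mult.commute flip: elim(2))
        finally have "ennreal ((\<kappa> * ?M) powr q * v x) \<le> ennreal (\<bar>u x * frac_int \<alpha> f x\<bar> powr q * 1)"
          by (rule ennreal_leI)
        then show ?thesis using True v_pos[of x] by (simp add: ennreal_mult less_imp_le)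
      qed simp
    qed
  qed
  also have "\<dots> = (\<integral>\<^sup>+x. ennreal (\<bar>u x * frac_int \<alpha> f x\<bar> powr q * 1) \<partial>lebesgue)"
    by (simp only: nn_integral_completion)
  finally have "ennreal (((\<kappa> * ?M) powr q * measure V ?Q) powr (1 / q)) \<le> Lr_norm_unweighted q (\<lambda>x. u x * frac_int \<alpha> f x)"
    unfolding Lr_norm_def using q_pos by (intro ennreal_le_ennpowr) auto
  also have "\<dots> \<le> ennreal C * (\<Prod>i\<in>UNIV. ennreal (mS i powr (1 / P i)))" by (rule le)
  also have "\<dots> = ennreal (C * (\<Prod>i\<in>UNIV. mS i powr (1 / P i)))"
    using C by (simp add: prod_ennreal ennreal_mult prod_nonneg)
  finally have "((\<kappa> * ?M) powr q * measure V ?Q) powr (1 / q) \<le> C * (\<Prod>i\<in>UNIV. mS i powr (1 / P i))"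
    using C by (simp add: prod_nonneg)
  moreover have "((\<kappa> * ?M) powr q * measure V ?Q) powr (1 / q) = \<kappa> * ?M * measure V ?Q powr (1 / q)"
    using \<kappa> M_pos q_pos by (simp add: powr_mult powr_powr)
  ultimately have main: "\<kappa> * ?M * measure V ?Q powr (1 / q) \<le> C * (\<Prod>i\<in>UNIV. mS i powr (1 / P i))"
    by simp
  let ?W = "\<Prod>i\<in>UNIV. mS i powr (1 / P i)"
  have W: "0 < ?W" using mS(2) by (intro prod_pos) (auto simp: less_imp_neq[symmetric])
  have MW: "(\<Prod>i\<in>UNIV. mS i powr (1 - 1 / P i)) = ?M / ?W"
    using mS(2) by (simp add: powr_diff prod_dividef less_imp_le)
  have \<kappa>_eq: "?mn powr ?e * \<kappa> = l powr (\<alpha> - ?mn)"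
  proof -
    have "?mn powr ?e * \<kappa> = (?mn powr ?e * ?mn powr (- ?e)) * l powr (- ?e)"
      by (simp add: \<kappa>_def powr_mult)
    also have "?mn powr ?e * ?mn powr (- ?e) = 1"
      by (simp flip: powr_add)
    finally show ?thesis by simp
  qed
  have "l powr (\<alpha> - ?mn) * measure V ?Q powr (1 / q) * (\<Prod>i\<in>UNIV. mS i powr (1 - 1 / P i)) =
      ?mn powr ?e * (\<kappa> * ?M * measure V ?Q powr (1 / q) / ?W)"
    by (simp add: \<kappa>_eq[symmetric] MW)
  also have "\<dots> \<le> ?mn powr ?e * C"
    using main W by (intro mult_left_mono) (auto simp: divide_le_eq)
  also have "\<dots> = C * ?mn powr ?e" by (rule mult.commute)
  finally show ?thesis by (simp only: mS_def)
qed

end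

theorem corollary3p3:
  fixes p q \<alpha> :: real
    and P :: "'m::finite \<Rightarrow> real"
    and u :: "real^'n \<Rightarrow> real"
    and w :: "'m \<Rightarrow> real^'n \<Rightarrow> real"
  assumes "\<And>i. 1 < P i"
    and "1 / p = (\<Sum>i\<in>UNIV. 1 / P i)"
    and "p < q"
    and "0 < \<alpha>" and "\<alpha> < real CARD('m) * real CARD('n)"
    and "u \<in> borel_measurable lebesgue" and "AE x in lebesgue. 0 < u x"
    and "\<And>i. w i \<in> borel_measurable lebesgue" and "\<And>i. AE x in lebesgue. 0 < w i x"
    and "\<And>i. reverse_doubling (\<lambda>x. w i x powr (- conjugate_exponent (P i)))"
    and "(\<lambda>x. u x powr q) \<in> A_infinity"
  shows "(\<exists>C::real. 0 < C \<and>
            (\<forall>f. (\<forall>i. f i \<in> Lr_space (P i) (\<lambda>x. w i x powr P i)) \<longrightarrow>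
               (AE x in lebesgue. frac_int_exists \<alpha> f x) \<and>
               Lr_norm_unweighted q (\<lambda>x. u x * frac_int \<alpha> f x)
                 \<le> ennreal C * (\<Prod>i\<in>UNIV. Lr_norm_unweighted (P i) (\<lambda>x. w i x * f i x))))
     \<longleftrightarrow>
         (SUP Q\<in>cubes.
            ennreal (measure lebesgue Q powr (\<alpha> / real CARD('n) + 1 / q - 1 / p)) *
            ennpowr (average Q (\<lambda>x. u x powr q)) (1 / q) *
            (\<Prod>i\<in>UNIV. ennpowr (average Q (\<lambda>x. w i x powr (- conjugate_exponent (P i))))
                          (1 / conjugate_exponent (P i)))) < \<infinity>"
  (is "?bounded \<longleftrightarrow> (SUP Q\<in>cubes. ?T Q) < \<infinity>")
proof -
  obtain r where r: "1 \<le> r" "(\<lambda>x. u x powr q) \<in> A_class r"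
    using assms(11) by (auto simp: A_infinity_def)
  then have "weight (\<lambda>x. u x powr q)" by (simp add: A_class_def)
  then obtain v where v: "borel_version (\<lambda>x. u x powr q) v"
    using weight_imp_borel_version by blast
  let ?s = "\<lambda>i x. w i x powr (- conjugate_exponent (P i))"
  have "\<exists>s. borel_version (?s i) s" for i
    using assms(10)[of i] by (intro weight_imp_borel_version) (simp add: reverse_doubling_def)
  then obtain s where s: "\<And>i. borel_version (?s i) (s i)" by metis
  let ?V = "rdensity lborel v" and ?S = "\<lambda>i. rdensity lborel (s i)"
  let ?t = "\<lambda>a l. testing_value \<alpha> q P ?V ?S a l"
  \<comment> \<open>Finiteness of the supremum thereby becomes a uniform real bound for
    \<open>testing_value\<close>, the form in which both implications are stated.\<close>
  have T_eq: "?T (cube a l) = ennreal (?t a l)" if "0 < l" for a l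
    by (rule testing_quantity_cube[OF borel_versionD(4)[OF v] borel_versionD(5)[OF v sets_cube]
        borel_versionD(4)[OF s] borel_versionD(5)[OF s sets_cube] assms(1,2) that])
  have u_pos: "AE x in lborel. 0 < u x" and w_pos: "\<And>i. AE x in lborel. 0 < w i x"
    using assms(7,9) by (simp_all add: AE_completion_iff)
  show ?thesis
  proof
    assume ?bounded
    then obtain C where C: "0 < C"
      "\<And>f. (\<And>i. f i \<in> Lr_space (P i) (\<lambda>x. w i x powr P i)) \<Longrightarrow>
        (AE x in lebesgue. frac_int_exists \<alpha> f x) \<and>
        Lr_norm_unweighted q (\<lambda>x. u x * frac_int \<alpha> f x)
          \<le> ennreal C * (\<Prod>i\<in>UNIV. Lr_norm_unweighted (P i) (\<lambda>x. w i x * f i x))"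
      by blast
    let ?A = "C * (real CARD('m) * real CARD('n)) powr (real CARD('m) * real CARD('n) - \<alpha>)"
    have t_le: "?t a l \<le> ?A" if "0 < l" for a l
      by (rule testing_condition_necessary[OF assms(1-5) u_pos w_pos v s C that])
    have "(SUP Q\<in>cubes. ?T Q) \<le> ennreal ?A"
    proof (rule SUP_least)
      fix Q :: "(real^'n) set" assume "Q \<in> cubes"
      then obtain a l where Q: "Q = cube a l" "0 < l" by (auto simp: cubes_def)
      show "?T Q \<le> ennreal ?A"
        unfolding Q(1) T_eq[OF Q(2)] by (rule ennreal_leI[OF t_le[OF Q(2)]])
    qed
    then show "(SUP Q\<in>cubes. ?T Q) < \<infinity>"
      by (rule le_less_trans) simp
  next
    assume "(SUP Q\<in>cubes. ?T Q) < \<infinity>"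
    then obtain A where A: "0 \<le> A" "(SUP Q\<in>cubes. ?T Q) = ennreal A"
      by (cases "SUP Q\<in>cubes. ?T Q") auto
    have test: "?t a l \<le> A" if "0 < l" for a l
    proof -
      have "?T (cube a l) \<le> (SUP Q\<in>cubes. ?T Q)"
        by (rule SUP_upper) (use that in \<open>auto simp: cubes_def\<close>)
      then show ?thesis unfolding A(2) T_eq[OF that] using A(1) by simp
    qed
    obtain C where C: "0 < C" "comparable_on_cubes C ?V"
      using A_class_comparable_on_cubes[OF r(2,1) v] by blast
    have "\<exists>d>1. reverse_doubling_measure d (?S i)" for i
      by (rule reverse_doubling_imp_measure[OF assms(10) s])
    then obtain d where d: "\<And>i. 1 < d i" "\<And>i. reverse_doubling_measure (d i) (?S i)"
      by metis
    show ?bounded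
      by (rule fractional_integral_bounded[OF assms(1-5) u_pos w_pos v s C d test])
  qed
qed

end
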